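(* Let $M$ be a manifold with $c$ cusps, endowed with a veering ideal triangulation $\tau$ that is transverse-taut. Let $\ell_1,\dots,\ell_c$ be oriented simple closed curves in $\partial\overline{M}$ along the ladderpole directions, one in each component of $\partial\overline{M}$, such that the orientations of the curves $\ell_i$ all agree (or all disagree) with the transverse-taut structure. Then for any subset $J$ of $\{1,\dots,c\}$ there exists a nonnegative angle structure $(\theta)$ on $\tau$ such that $h_\theta([\ell_i])=\frac{\pi}{2}$ if $i\in J$ and $h_\theta([\ell_i])=0$ otherwise.
   Context: Ideal triangulations. $\overline{M}$ is a compact oriented 3-manifold whose boundary is a nonempty union of tori (the cusps), decomposed into finitely many truncated tetrahedra $\Delta_1,\dots,\Delta_n$ glued in pairs along all their hexagonal faces. The boundary triangles obtained by truncating the tips remain unglued and give a (possibly non-simplicial) triangulation of $\partial\overline{M}$. Then $\tau=\{\Delta_1,\dots,\Delta_n\}$ is an ideal triangulation of $M=\overline{M}\smallsetminus\partial\overline{M}$. Edges of $M$ are the interior edges (not contained in $\partial\overline{M}$); their endpoints are the vertices of $\partial\overline{M}$. Angle structures. Assign a real variable $\theta_j$ to every pair of opposite edges of every tetrahedron, so that $\Delta_i$ has angles $\theta_{3i-2},\theta_{3i-1},\theta_{3i}$. Impose: (1) these three angles sum to $\pi$ for each $i$; (2) for each edge of $M$, the angles around it (with multiplicity) sum to $2\pi$. A vector in $\mathbb{R}^{3n}$ satisfying (1) and (2) is a generalized angle structure; it is taut if all $\theta_j\in\{0,\pi\}$, and nonnegative if all $\theta_j\ge 0$. Each corner of a boundary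 triangle carries the angle of the tetrahedron edge it truncates. A taut angle structure is transverse-taut if it is equipped with a transverse orientation on all the faces of the triangulation such that, for each tetrahedron, the two faces sharing one $\pi$-angle edge have it pointing inward, and the two faces sharing the other $\pi$-angle edge have it pointing outward. Veering. Given a taut angle structure, every boundary triangle has angles $(0,0,\pi)$, and the link of every vertex $v$ of $\partial\overline{M}$ consists of two $\pi$-angles separated by two sequences of $0$-angles, the two fans of $v$. The structure is veering if for every vertex $v$, either all triangles of the two fans of $v$ have their $\pi$-angle immediately before $v$ in the counterclockwise cyclic order on the vertices of the triangle ($v$ is left-veering), or all have it immediately after $v$ ($v$ is right-veering). The two endpoints of an edge of $M$ veer in the same direction. Right-veering vertices and edges are colored red, left-veering ones blue. A veering ideal triangulation is one equipped with a veering taut angle structure; here this same structure is assumed transverse-taut. Ladders. The edges of the triangulation of $\partial\overline{M}$ joining two vertices of the same color form disjoint simple closed curves, called ladderpoles, passing through all vertices; none bounds a disk, and those in a given torus component are parallel and cut it into annuli called ladders. The edges interior to a ladder, called rungs, connect its two boundary ladderpoles. A simple closed curve along the ladderpole direction is one isotopic to a ladderpole (up to orientation). In the transverse-taut case, the transverse orientation of the faces induces a transverse orientation on the rungs, which crosses all rungs of all ladders of a given cusp in one common direction along the ladders; this is the upward direction. The orientation of $\ell_i$ agrees with the transverse-taut structure if $\ell_i$ is oriented in the upward direction, and disagrees otherwise. Holonomy. A normal curve on a component $V$ of $\partial\overline{M}$ is an embedded oriented closed curve transverse to the 1-skeleton that enters and exits each triangle through different edges; each of its arcs in a triangle cuts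 off one corner, to its left or its right. For a generalized angle structure $(\theta)$, let $\mathcal{A}_\gamma$ (resp. $\mathcal{B}_\gamma$) be the sum, with multiplicity, of the angles of the corners cut off to the left (resp. right) of $\gamma$. For a normal curve $\gamma$ representing a nonzero primitive class $[\gamma]\in H_1(V,\mathbb{Z})$ and $m\in\mathbb{Z}$, the angular holonomy is $h_\theta(m[\gamma])=m(\mathcal{A}_\gamma-\mathcal{B}_\gamma)$; this is well-defined and linear on homology. *)

theory Defs
  imports "HOL-Analysis.Analysis"
begin

section \<open>Ideal triangulations\<close>

text \<open>
  The tetrahedra are the elements of a finite type \<^typ>\<open>'t\<close>; the vertices of each of them are
  labelled by the type \<^typ>\<open>4\<close> (elements 0, 1, 2, 3) in such a way that the labelling induces the
  orientation of the manifold.  If \<open>G t a = (t', \<sigma>)\<close>, then the (hexagonal) face of \<open>t\<close> opposite to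
  the vertex \<open>a\<close> is glued to the face of \<open>t'\<close> opposite to \<open>\<sigma> a\<close>, and \<open>\<sigma>\<close> restricts to the gluing
  on the three vertices of the face.
\<close>

type_synonym 't gluing = "'t \<Rightarrow> 4 \<Rightarrow> 't \<times> (4 \<Rightarrow> 4)"

text \<open>
  Truncating the tip \<open>v\<close> of \<open>t\<close> creates the boundary triangle \<open>(t, v)\<close>.  A flag \<open>(t, v, w)\<close> with
  \<open>v \<noteq> w\<close> has two uses.  It denotes the corner of the boundary triangle \<open>(t, v)\<close> that lies on
  the edge \<open>vw\<close> of \<open>t\<close>, and it also denotes the side of \<open>(t, v)\<close> opposite to this corner, which is
  the side contained in the face of \<open>t\<close> opposite to \<open>w\<close>.
\<close>

type_synonym 't flag = "'t \<times> 4 \<times> 4"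

definition flags :: "'t flag set" where
  "flags = {(t, v, w). v \<noteq> w}"

fun tri :: "'t flag \<Rightarrow> 't \<times> 4" where
  "tri (t, v, w) = (t, v)"

text \<open>
  The corner following \<open>w\<close> in the counterclockwise order on the corners of the boundary triangle at
  the tip \<open>v\<close>.  The boundary is oriented so that \<open>(w, x, y)\<close> is counterclockwise iff \<open>(v, w, x, y)\<close> is
  an even permutation of \<open>(0, 1, 2, 3)\<close>.  (With the other convention left and right are exchanged,
  and the angular holonomy changes sign.)
\<close>

definition ccw_next :: "4 \<Rightarrow> 4 \<Rightarrow> 4" where
  "ccw_next v w = (THE x. \<exists>p. p permutes UNIV \<and> evenperm p \<and> p 0 = v \<and> p 1 = w \<and> p 2 = x)"

fun ccw :: "'t flag \<Rightarrow> 't flag" where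
  "ccw (t, v, w) = (t, v, ccw_next v w)"

definition across :: "'t gluing \<Rightarrow> 4 \<Rightarrow> 't flag \<Rightarrow> 't flag" where
  "across G a = (\<lambda>(t, v, w). case G t a of (t', \<sigma>) \<Rightarrow> (t', \<sigma> v, \<sigma> w))"

text \<open>The side to which a given side of a boundary triangle is glued.\<close>

definition flip :: "'t gluing \<Rightarrow> 't flag \<Rightarrow> 't flag" where
  "flip G s = across G (snd (snd s)) s"

text \<open>
  The vertices of the boundary are represented by the sets of all corners located at them, its
  components (the cusps) by the sets of their triangles, and the edges of the manifold by the sets
  of all edges \<open>(t, e)\<close> of tetrahedra identified with them, where the set \<open>e\<close> consists of the two
  endpoints.
\<close>

definition corner_adj :: "'t gluing \<Rightarrow> 't flag rel" where
  "corner_adj G = {((t, v, w), across G a (t, v, w)) | t v w a. v \<noteq> w \<and> a \<noteq> v \<and> a \<noteq> w}"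

definition bd_vertex :: "'t gluing \<Rightarrow> 't flag \<Rightarrow> 't flag set" where
  "bd_vertex G k = (corner_adj G)\<^sup>* `` {k}"

definition tri_adj :: "'t gluing \<Rightarrow> ('t \<times> 4) rel" where
  "tri_adj G = {(tri s, tri (flip G s)) | s. s \<in> flags}"

definition cusps :: "'t gluing \<Rightarrow> ('t \<times> 4) set set" where
  "cusps G = UNIV // (tri_adj G)\<^sup>*"

definition edge_adj :: "'t gluing \<Rightarrow> ('t \<times> 4 set) rel" where
  "edge_adj G = {((t, e), (t', \<sigma> ` e)) | t e t' \<sigma>. card e = 2 \<and> (\<exists>a. a \<notin> e \<and> G t a = (t', \<sigma>))}"

definition edge_class :: "'t gluing \<Rightarrow> 't \<times> 4 set \<Rightarrow> ('t \<times> 4 set) set" where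
  "edge_class G x = (edge_adj G)\<^sup>* `` {x}"

definition sides_of :: "('t \<times> 4) set \<Rightarrow> 't flag set" where
  "sides_of K = {s \<in> flags. tri s \<in> K}"

definition euler_char :: "'t gluing \<Rightarrow> ('t \<times> 4) set \<Rightarrow> int" where
  "euler_char G K = int (card (bd_vertex G ` sides_of K))
     - int (card ((\<lambda>s. {s, flip G s}) ` sides_of K)) + int (card K)"

text \<open>
  The faces are glued in pairs, and by oddness of \<open>\<sigma>\<close> the gluings are compatible with the
  orientations of the tetrahedra, so the result is a compact oriented 3-manifold (an orientable gluing
  cannot identify an edge with itself in reverse) and its boundary is a closed oriented surface.
  The components of the boundary are tori iff they have Euler characteristic 0.
\<close>

definition ideal_triangulation :: "'t::finite gluing \<Rightarrow> bool" where
  "ideal_triangulation G \<longleftrightarrow>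
     (\<forall>t a t' \<sigma>. G t a = (t', \<sigma>) \<longrightarrow>
        bij \<sigma> \<and> \<not> evenperm \<sigma> \<and> (t', \<sigma> a) \<noteq> (t, a) \<and> G t' (\<sigma> a) = (t, inv \<sigma>)) \<and>
     (\<forall>K \<in> cusps G. euler_char G K = 0)"


section \<open>Angle structures\<close>

text \<open>
  A pair of opposite edges of a tetrahedron is a set \<open>{e, -e}\<close> of two complementary sets of vertices.
\<close>

definition opposite_pairs :: "4 set set set" where
  "opposite_pairs = {{e, -e} | e. card e = 2}"

type_synonym 't angles = "'t \<Rightarrow> 4 set set \<Rightarrow> real"

definition edge_angle :: "'t angles \<Rightarrow> 't \<Rightarrow> 4 set \<Rightarrow> real" where
  "edge_angle \<theta> t e = \<theta> t {e, -e}"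

fun corner_angle :: "'t angles \<Rightarrow> 't flag \<Rightarrow> real" where
  "corner_angle \<theta> (t, v, w) = edge_angle \<theta> t {v, w}"

definition generalized_angle_structure :: "'t::finite gluing \<Rightarrow> 't angles \<Rightarrow> bool" where
  "generalized_angle_structure G \<theta> \<longleftrightarrow>
     (\<forall>t. (\<Sum>q\<in>opposite_pairs. \<theta> t q) = pi) \<and>
     (\<forall>t e. card e = 2 \<longrightarrow> (\<Sum>(t', e')\<in>edge_class G (t, e). edge_angle \<theta> t' e') = 2 * pi)"

definition nonneg_angle_structure :: "'t::finite gluing \<Rightarrow> 't angles \<Rightarrow> bool" where
  "nonneg_angle_structure G \<theta> \<longleftrightarrow>
     generalized_angle_structure G \<theta> \<and> (\<forall>t. \<forall>q\<in>opposite_pairs. 0 \<le> \<theta> t q)"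

definition taut_angle_structure :: "'t::finite gluing \<Rightarrow> 't angles \<Rightarrow> bool" where
  "taut_angle_structure G \<alpha> \<longleftrightarrow>
     generalized_angle_structure G \<alpha> \<and> (\<forall>t. \<forall>q\<in>opposite_pairs. \<alpha> t q \<in> {0, pi})"

text \<open>
  A transverse orientation of the faces: \<open>out t a\<close> says that on the face opposite to \<open>a\<close> it
  points out of \<open>t\<close>.  The faces sharing an edge \<open>e\<close> are those opposite to the vertices in \<open>-e\<close>.
\<close>

definition transverse_taut :: "'t::finite gluing \<Rightarrow> 't angles \<Rightarrow> ('t \<Rightarrow> 4 \<Rightarrow> bool) \<Rightarrow> bool" where
  "transverse_taut G \<alpha> out \<longleftrightarrow>
     taut_angle_structure G \<alpha> \<and>
     (\<forall>t a t' \<sigma>. G t a = (t', \<sigma>) \<longrightarrow> (out t' (\<sigma> a) \<longleftrightarrow> \<not> out t a)) \<and>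
     (\<forall>t. \<exists>e. card e = 2 \<and> edge_angle \<alpha> t e = pi \<and>
              (\<forall>a\<in>-e. \<not> out t a) \<and> (\<forall>a\<in>e. out t a))"


section \<open>Veering structures\<close>

text \<open>
  The corner immediately before \<open>k\<close> in its triangle is \<open>ccw (ccw k)\<close>.  A boundary vertex is given
  by any of its corners; the triangles of its two fans are those having angle 0 there.
  Left-veering vertices are blue, right-veering ones are red.
\<close>

definition left_veering :: "'t gluing \<Rightarrow> 't angles \<Rightarrow> 't flag \<Rightarrow> bool" where
  "left_veering G \<alpha> x \<longleftrightarrow>
     (\<forall>k\<in>bd_vertex G x. corner_angle \<alpha> k = 0 \<longrightarrow> corner_angle \<alpha> (ccw (ccw k)) = pi)"

definition right_veering :: "'t gluing \<Rightarrow> 't angles \<Rightarrow> 't flag \<Rightarrow> bool" where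
  "right_veering G \<alpha> x \<longleftrightarrow>
     (\<forall>k\<in>bd_vertex G x. corner_angle \<alpha> k = 0 \<longrightarrow> corner_angle \<alpha> (ccw k) = pi)"

definition veering :: "'t::finite gluing \<Rightarrow> 't angles \<Rightarrow> bool" where
  "veering G \<alpha> \<longleftrightarrow>
     taut_angle_structure G \<alpha> \<and> (\<forall>x\<in>flags. left_veering G \<alpha> x \<or> right_veering G \<alpha> x)"

definition same_color :: "'t gluing \<Rightarrow> 't angles \<Rightarrow> 't flag \<Rightarrow> 't flag \<Rightarrow> bool" where
  "same_color G \<alpha> x y \<longleftrightarrow>
     left_veering G \<alpha> x \<and> left_veering G \<alpha> y \<or> right_veering G \<alpha> x \<and> right_veering G \<alpha> y"


section \<open>Curves in the 1-skeleton of the boundary\<close>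

text \<open>
  A flag \<open>s\<close>, viewed as a side, is also used as a directed edge of the boundary: it is directed
  so that the triangle \<open>tri s\<close> lies to its left, i.e. from the corner \<open>ccw s\<close> to the corner
  \<open>ccw (ccw s)\<close>.  The reversed edge is then \<open>flip G s\<close>.
\<close>

definition closed_path :: "'t gluing \<Rightarrow> 't flag list \<Rightarrow> bool" where
  "closed_path G ds \<longleftrightarrow> ds \<noteq> [] \<and> set ds \<subseteq> flags \<and>
     (\<forall>i<length ds. bd_vertex G (ccw (ccw (ds ! i)))
                     = bd_vertex G (ccw (ds ! (Suc i mod length ds))))"

text \<open>
  The last condition only matters for paths of length 2, where it excludes an edge followed by its
  reverse.
\<close>

definition simple_closed_curve :: "'t gluing \<Rightarrow> ('t \<times> 4) set \<Rightarrow> 't flag list \<Rightarrow> bool" where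
  "simple_closed_curve G K ds \<longleftrightarrow> closed_path G ds \<and> set ds \<subseteq> sides_of K \<and>
     distinct (map (\<lambda>s. bd_vertex G (ccw s)) ds) \<and> (\<forall>s\<in>set ds. flip G s \<notin> set ds)"

text \<open>
  Free homotopy of closed edge paths.  For essential simple closed curves on a surface, free homotopy
  (as oriented curves) is the same as isotopy.
\<close>

inductive homotopy_step :: "'t gluing \<Rightarrow> 't flag list \<Rightarrow> 't flag list \<Rightarrow> bool" for G where
  rotate: "closed_path G (xs @ ys) \<Longrightarrow> homotopy_step G (xs @ ys) (ys @ xs)"
| spur: "closed_path G (xs @ ys) \<Longrightarrow> closed_path G (xs @ [s, flip G s] @ ys) \<Longrightarrow>
    homotopy_step G (xs @ ys) (xs @ [s, flip G s] @ ys)"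
| triangle: "closed_path G (xs @ ys) \<Longrightarrow> closed_path G (xs @ [s, ccw s, ccw (ccw s)] @ ys) \<Longrightarrow>
    homotopy_step G (xs @ ys) (xs @ [s, ccw s, ccw (ccw s)] @ ys)"

definition freely_homotopic :: "'t gluing \<Rightarrow> 't flag list \<Rightarrow> 't flag list \<Rightarrow> bool" where
  "freely_homotopic G = equivclp (homotopy_step G)"

text \<open>A ladderpole, with either of its two orientations.\<close>

definition ladderpole :: "'t gluing \<Rightarrow> 't angles \<Rightarrow> ('t \<times> 4) set \<Rightarrow> 't flag list \<Rightarrow> bool" where
  "ladderpole G \<alpha> K ds \<longleftrightarrow> simple_closed_curve G K ds \<and>
     (\<forall>s\<in>set ds. same_color G \<alpha> (ccw s) (ccw (ccw s)))"

text \<open>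
  Let \<open>s\<close> be a directed ladderpole edge.  The other two sides of the triangle \<open>tri s\<close> to its left are
  rungs.  A curve running parallel to \<open>s\<close> in this triangle enters it through the rung
  \<open>ccw (ccw s)\<close>, at the tail of \<open>s\<close>, and leaves it through the rung \<open>ccw s\<close>, at the head of \<open>s\<close>.
  It is upward if it crosses the two rungs along their transverse orientation, which is
  inherited from the faces containing them.
\<close>

definition upward_edge :: "('t \<Rightarrow> 4 \<Rightarrow> bool) \<Rightarrow> 't flag \<Rightarrow> bool" where
  "upward_edge out s \<longleftrightarrow>
     (case ccw (ccw s) of (t, v, a) \<Rightarrow> \<not> out t a) \<and> (case ccw s of (t, v, a) \<Rightarrow> out t a)"

definition along_ladderpoles ::
    "'t gluing \<Rightarrow> 't angles \<Rightarrow> ('t \<times> 4) set \<Rightarrow> 't flag list \<Rightarrow> bool" where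
  "along_ladderpoles G \<alpha> K l \<longleftrightarrow> simple_closed_curve G K l \<and>
     (\<exists>P. ladderpole G \<alpha> K P \<and> freely_homotopic G l P)"

definition agrees ::
    "'t gluing \<Rightarrow> 't angles \<Rightarrow> ('t \<Rightarrow> 4 \<Rightarrow> bool) \<Rightarrow> ('t \<times> 4) set \<Rightarrow> 't flag list \<Rightarrow> bool" where
  "agrees G \<alpha> out K l \<longleftrightarrow>
     (\<exists>P. ladderpole G \<alpha> K P \<and> (\<forall>s\<in>set P. upward_edge out s) \<and> freely_homotopic G l P)"


section \<open>First homology of a boundary component\<close>

text \<open>
  Cellular 1-chains are functions on the directed edges changing sign under reversal;
  homology classes are represented by 1-cycles, and equality of classes by \<open>homologous\<close>.
\<close>

definition cycles :: "'t::finite gluing \<Rightarrow> ('t \<times> 4) set \<Rightarrow> ('t flag \<Rightarrow> int) set" where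
  "cycles G K = {z. (\<forall>s. s \<notin> sides_of K \<longrightarrow> z s = 0) \<and>
     (\<forall>s\<in>sides_of K. z (flip G s) = - z s) \<and>
     (\<forall>x\<in>sides_of K. (\<Sum>s | s \<in> flags \<and> ccw s \<in> bd_vertex G x. z s) = 0)}"

text \<open>The 2-chain \<open>k\<close> has coefficient \<open>k T\<close> at the counterclockwise oriented triangle \<open>T\<close>.\<close>

definition homologous ::
    "'t gluing \<Rightarrow> ('t \<times> 4) set \<Rightarrow> ('t flag \<Rightarrow> int) \<Rightarrow> ('t flag \<Rightarrow> int) \<Rightarrow> bool" where
  "homologous G K z z' \<longleftrightarrow> (\<exists>k :: 't \<times> 4 \<Rightarrow> int. (\<forall>T. T \<notin> K \<longrightarrow> k T = 0) \<and>
     (\<forall>s\<in>flags. z s - z' s = k (tri s) - k (tri (flip G s))))"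

definition primitive_class :: "'t::finite gluing \<Rightarrow> ('t \<times> 4) set \<Rightarrow> ('t flag \<Rightarrow> int) \<Rightarrow> bool" where
  "primitive_class G K z \<longleftrightarrow> z \<in> cycles G K \<and> \<not> homologous G K z (\<lambda>_. 0) \<and>
     (\<forall>y\<in>cycles G K. \<forall>m. homologous G K z (\<lambda>s. m * y s) \<longrightarrow> \<bar>m\<bar> = 1)"

definition path_chain :: "'t gluing \<Rightarrow> 't flag list \<Rightarrow> 't flag \<Rightarrow> int" where
  "path_chain G ds s = int (count_list ds s) - int (count_list ds (flip G s))"


section \<open>Normal curves and angular holonomy\<close>

text \<open>
  The boundary triangle \<open>(t, v)\<close> is realized as the triangle spanned by three of the standard basis
  vectors of \<^typ>\<open>real^4\<close>; \<open>side_point s x\<close> is the point at parameter \<open>x\<close> on the directed edge \<open>s\<close>.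
\<close>

definition side_point :: "'t flag \<Rightarrow> real \<Rightarrow> real^4" where
  "side_point s x = (1 - x) *\<^sub>R axis (snd (snd (ccw s))) 1 + x *\<^sub>R axis (snd (snd (ccw (ccw s)))) 1"

text \<open>
  A closed curve transverse to the 1-skeleton is a cyclic list \<open>g\<close>: its \<open>i\<close>-th arc enters the triangle
  \<open>tri s\<close> through the side \<open>s\<close> at parameter \<open>x\<close>, where \<open>g ! i = (s, x)\<close>.  If the next entry is
  \<open>(s', x')\<close>, the arc leaves through the side \<open>flip G s'\<close>, at parameter \<open>1 - x'\<close> because flipping
  reverses the direction.  For someone entering through \<open>s\<close> the corner \<open>ccw s\<close> is on the left and
  \<open>ccw (ccw s)\<close> is on the right.  So leaving through the side \<open>ccw (ccw s)\<close> cuts off the corner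
  \<open>ccw s\<close> to the left, and leaving through the side \<open>ccw s\<close> cuts off the corner \<open>ccw (ccw s)\<close>
  to the right.
\<close>

definition next_entry :: "('t flag \<times> real) list \<Rightarrow> nat \<Rightarrow> 't flag \<times> real" where
  "next_entry g i = g ! (Suc i mod length g)"

definition entry_side :: "('t flag \<times> real) list \<Rightarrow> nat \<Rightarrow> 't flag" where
  "entry_side g i = fst (g ! i)"

definition exit_side :: "'t gluing \<Rightarrow> ('t flag \<times> real) list \<Rightarrow> nat \<Rightarrow> 't flag" where
  "exit_side G g i = flip G (fst (next_entry g i))"

definition curve_arc :: "'t gluing \<Rightarrow> ('t flag \<times> real) list \<Rightarrow> nat \<Rightarrow> (real^4) set" where
  "curve_arc G g i = closed_segment (side_point (entry_side g i) (snd (g ! i)))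
                              (side_point (exit_side G g i) (1 - snd (next_entry g i)))"

definition left_arcs :: "'t gluing \<Rightarrow> ('t flag \<times> real) list \<Rightarrow> nat set" where
  "left_arcs G g = {i. i < length g \<and> exit_side G g i = ccw (ccw (entry_side g i))}"

definition right_arcs :: "'t gluing \<Rightarrow> ('t flag \<times> real) list \<Rightarrow> nat set" where
  "right_arcs G g = {i. i < length g \<and> exit_side G g i = ccw (entry_side g i)}"

text \<open>The last condition is embeddedness: arcs in the same triangle are disjoint.\<close>

definition normal_curve :: "'t gluing \<Rightarrow> ('t \<times> 4) set \<Rightarrow> ('t flag \<times> real) list \<Rightarrow> bool" where
  "normal_curve G K g \<longleftrightarrow> g \<noteq> [] \<and>
     (\<forall>(s, x)\<in>set g. s \<in> sides_of K \<and> 0 < x \<and> x < 1) \<and>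
     {..<length g} = left_arcs G g \<union> right_arcs G g \<and>
     (\<forall>i<length g. \<forall>j<length g. i \<noteq> j \<and> tri (entry_side g i) = tri (entry_side g j) \<longrightarrow>
        curve_arc G g i \<inter> curve_arc G g j = {})"

text \<open>
  Sliding every intersection point with the 1-skeleton to the endpoint on the left of the curve
  deforms the curve to an edge path: the arcs cutting off a corner to the left collapse
  to this corner, and an arc cutting off the corner \<open>ccw (ccw s)\<close> to the right becomes the side opposite
  to this corner, with the triangle on its right.
\<close>

definition normal_curve_chain :: "'t gluing \<Rightarrow> ('t flag \<times> real) list \<Rightarrow> 't flag \<Rightarrow> int" where
  "normal_curve_chain G g = path_chain G
     (map (\<lambda>i. flip G (ccw (ccw (entry_side g i)))) (sorted_list_of_set (right_arcs G g)))"

definition left_angle_sum :: "'t gluing \<Rightarrow> 't angles \<Rightarrow> ('t flag \<times> real) list \<Rightarrow> real" where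
  "left_angle_sum G \<theta> g = (\<Sum>i\<in>left_arcs G g. corner_angle \<theta> (ccw (entry_side g i)))"

definition right_angle_sum :: "'t gluing \<Rightarrow> 't angles \<Rightarrow> ('t flag \<times> real) list \<Rightarrow> real" where
  "right_angle_sum G \<theta> g = (\<Sum>i\<in>right_arcs G g. corner_angle \<theta> (ccw (ccw (entry_side g i))))"

text \<open>
  The graph of the angular holonomy, a well-defined function on homology classes: the class of \<open>z\<close>
  in the first homology of \<open>K\<close> has angular holonomy \<open>h\<close>.
\<close>

definition has_angular_holonomy ::
    "'t::finite gluing \<Rightarrow> 't angles \<Rightarrow> ('t \<times> 4) set \<Rightarrow> ('t flag \<Rightarrow> int) \<Rightarrow> real \<Rightarrow> bool" where
  "has_angular_holonomy G \<theta> K z h \<longleftrightarrow>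
     (\<exists>g m. normal_curve G K g \<and> primitive_class G K (normal_curve_chain G g) \<and>
        homologous G K z (\<lambda>s. m * normal_curve_chain G g s) \<and>
        h = of_int m * (left_angle_sum G \<theta> g - right_angle_sum G \<theta> g))"

end

theory Submission
  imports Defs
begin

text \<open>
  Let \<open>\<alpha>\<close> be the veering structure.  A curve running along a ladder cuts off only corners whose
  \<open>\<alpha>\<close>-angle is 0, so \<open>\<alpha>\<close> gives holonomy 0 to the ladderpoles, and the required structure is found by
  deforming \<open>\<alpha>\<close>.

  A flux is a flow on the boundary surface, recorded by the amounts that leave the
  triangles through their sides.  Adding to each angle the total flux through the four sides
  opposite to the corners with this angle, one at each tip of the tetrahedron, preserves both kinds of
  equations of a generalized angle structure (\<open>generalized_angle_structure_deform\<close>).  Along a closed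
  normal curve the contributions of the tips that the curve does not visit telescope
  (\<open>pair_flux_left_arc\<close>, \<open>pair_flux_right_arc\<close>), so the holonomy of an upward curve in a ladder grows by
  twice the flow crossing the ladder from left to right (\<open>ladder_curve\<close>).  A crossing
  flow of \<open>pi / 4\<close> on the cusps in \<open>J\<close>, and of 0 on the others, is what is wanted.

  In the result all angles must be nonnegative, so an angle 0 may only grow, and an angle \<open>pi\<close> may
  shrink by at most \<open>pi / 4\<close> at each of the four tips.  The circulation of
  size \<open>pi / 4\<close> that enters every triangle through the side opposite to its \<open>pi\<close>-corner and leaves it
  through the other rung has this property; it runs along the ladders and crosses no ladderpole.  To
  make the flow cross the ladderpoles from left to right one subtracts from it a strand running from
  right to left, which follows the circulation inside a ladder, so that it only weakens it, and
  leaves a ladder only from triangles on the right of a pole whose tetrahedron is a hinge, that is,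
  has \<open>pi\<close>-edges of different colours.  There the crossing makes one angle smaller, but all four tips
  of such a tetrahedron lie on the right of poles, two of each colour, and the circulation leaving
  the two tips of the other colour makes up for the loss (\<open>pair_flux_nonneg\<close>).

  Following the circulation and turning left whenever this is permitted is a self-map \<open>walk\<close> of
  the finite set of triangles of a cusp, and every ladder contains a triangle where it turns
  (\<open>ladder_has_turn\<close>).  A nonempty set mapped onto itself by \<open>walk\<close> is a union of closed strands.  It
  meets every ladder of its cusp (\<open>invariant_meets_ladder\<close>), since the edges on one side of a
  ladder form a single ladderpole.  It therefore crosses the chosen ladderpole, and can be
  weighted so as to do this with total weight 1.

  The upward curve in the ladder on the right of an upward ladderpole represents the
  same chain as the ladderpole.  Its class is primitive because the two sides of the ladderpole can be
  joined without crossing it: otherwise \<open>walk\<close>, started on the left, would never reach the ladder on the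
  right (\<open>pole_nonseparating\<close>).  If all curves disagree with the transverse orientation, they all
  agree with the reversed one, which is transverse-taut as well.
\<close>

section \<open>Orientations of a labelled tetrahedron\<close>

abbreviation (input) swap :: "4 \<Rightarrow> 4 \<Rightarrow> 4 \<Rightarrow> 4" where
  "swap \<equiv> Transposition.transpose"

lemma all_4_iff: "(\<forall>i::4. P i) \<longleftrightarrow> P 0 \<and> P 1 \<and> P 2 \<and> P 3"
proof -
  have "(4::4) = 0" by simp
  then show ?thesis unfolding forall_4 by metis
qed

lemma cases_4: "(i::4) = 0 \<or> i = 1 \<or> i = 2 \<or> i = 3"
  using all_4_iff[of "\<lambda>i. i = 0 \<or> i = 1 \<or> i = 2 \<or> i = 3"] by blast

lemma even_perm_fixing_two_points:
  fixes q :: "4 \<Rightarrow> 4"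
  assumes "q permutes UNIV" "evenperm q" "q 0 = 0" "q 1 = 1"
  shows "q 2 = 2"
proof (rule ccontr)
  assume ne: "q 2 \<noteq> 2"
  have inj: "q i = q j \<longleftrightarrow> i = j" for i j
    using permutes_inj[OF assms(1)] by (simp add: inj_eq)
  have "q 2 \<noteq> 0" "q 2 \<noteq> 1" using inj[of 2 0] inj[of 2 1] assms(3,4) by auto
  then have q2: "q 2 = 3" using ne cases_4[of "q 2"] by blast
  have "q 3 \<noteq> 0" "q 3 \<noteq> 1" "q 3 \<noteq> 3"
    using inj[of 3 0] inj[of 3 1] inj[of 3 2] assms(3,4) q2 by auto
  then have q3: "q 3 = 2" using cases_4[of "q 3"] by blast
  have "\<forall>i. q i = swap 2 3 i"
    unfolding all_4_iff using assms(3,4) q2 q3 by (auto simp: Transposition.transpose_def)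
  then have "q = swap 2 3" by blast
  then show False using assms(2) evenperm_swap[of "2::4" 3] by auto
qed

text \<open>
  Two even permutations with the same values at 0 and 1 agree, because their quotient fixes 0 and
  1 and is not the transposition of 2 and 3. Hence every even permutation serves as a witness for
  \<open>ccw_next\<close>.
\<close>

lemma ccw_next_even:
  fixes p :: "4 \<Rightarrow> 4"
  assumes p: "p permutes UNIV" "evenperm p"
  shows "ccw_next (p 0) (p 1) = p 2"
  unfolding ccw_next_def
proof (rule the_equality)
  show "\<exists>p'. p' permutes UNIV \<and> evenperm p' \<and> p' 0 = p 0 \<and> p' 1 = p 1 \<and> p' 2 = p 2"
    using p by blast
next
  fix x assume "\<exists>p'. p' permutes UNIV \<and> evenperm p' \<and> p' 0 = p 0 \<and> p' 1 = p 1 \<and> p' 2 = x"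
  then obtain p' where p': "p' permutes UNIV" "evenperm p'" "p' 0 = p 0" "p' 1 = p 1" "p' 2 = x"
    by blast
  have b: "bij p" "bij p'" using p(1) p'(1) permutes_bij by blast+
  have ip: "inv p permutes UNIV" using p(1) permutes_inv by blast
  have perm: "permutation p'" "permutation (inv p)" "permutation p"
    using p(1) p'(1) ip by (auto simp: permutation_permutes)
  have "evenperm (inv p \<circ> p')"
    using evenperm_comp[OF perm(2,1)] evenperm_inv[OF perm(3)] p(2) p'(2) by simp
  moreover have "(inv p \<circ> p') permutes UNIV" using ip p'(1) permutes_compose by blast
  ultimately have "(inv p \<circ> p') 2 = 2"
    using even_perm_fixing_two_points[of "inv p \<circ> p'"] p'(3,4) b by (simp add: bij_is_inj)
  then show "x = p 2" using p'(5) b(1) by (metis bij_inv_eq_iff comp_apply)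
qed

lemma even_double_transposition:
  fixes a b c d :: 4
  assumes "a \<noteq> b" "c \<noteq> d"
  shows "(swap a b \<circ> swap c d) permutes UNIV \<and> evenperm (swap a b \<circ> swap c d)"
proof
  show "(swap a b \<circ> swap c d) permutes UNIV"
    by (intro permutes_compose permutes_swap_id) auto
  show "evenperm (swap a b \<circ> swap c d)"
    using assms by (simp add: evenperm_comp permutation_swap_id evenperm_swap)
qed

lemma ccw_next_table:
  "ccw_next 0 1 = 2" "ccw_next 0 2 = 3" "ccw_next 0 3 = 1"
  "ccw_next 1 0 = 3" "ccw_next 1 3 = 2" "ccw_next 1 2 = 0"
  "ccw_next 2 3 = 0" "ccw_next 2 0 = 1" "ccw_next 2 1 = 3"
  "ccw_next 3 2 = 1" "ccw_next 3 1 = 0" "ccw_next 3 0 = 2"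
proof -
  have id: "id permutes (UNIV :: 4 set)" "evenperm (id :: 4 \<Rightarrow> 4)" by (auto simp: permutes_id)
  have tr: "ccw_next ((swap a b \<circ> swap c d) 0) ((swap a b \<circ> swap c d) 1)
       = (swap a b \<circ> swap c d) 2" if "a \<noteq> b" "c \<noteq> d" for a b c d :: 4
    using ccw_next_even even_double_transposition that by blast
  show "ccw_next 0 1 = 2" using ccw_next_even[OF id] by simp
  show "ccw_next 0 2 = 3" "ccw_next 0 3 = 1" "ccw_next 1 0 = 3" "ccw_next 1 3 = 2" "ccw_next 1 2 = 0"
    "ccw_next 2 3 = 0" "ccw_next 2 0 = 1" "ccw_next 2 1 = 3" "ccw_next 3 2 = 1" "ccw_next 3 1 = 0" "ccw_next 3 0 = 2"
    using tr[of 1 2 2 3] tr[of 1 3 2 3] tr[of 0 1 2 3] tr[of 0 1 1 3] tr[of 0 1 1 2] tr[of 0 2 1 3]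
      tr[of 1 2 0 1] tr[of 0 2 2 3] tr[of 0 3 1 2] tr[of 0 3 2 3] tr[of 1 3 0 1]
    by (simp_all add: Transposition.transpose_def)
qed

text \<open>
  The cyclic orders seen from the four vertices determine each other: they come from the even
  permutations of \<open>(v, w, x, y)\<close>.
\<close>

lemma tetrahedron_table:
  fixes v w x y :: 4
  assumes "v \<noteq> w" "ccw_next v w = x" "ccw_next v x = y"
  shows "ccw_next v w = x" "ccw_next v x = y" "ccw_next v y = w"
    "ccw_next w v = y" "ccw_next w y = x" "ccw_next w x = v"
    "ccw_next x y = v" "ccw_next x v = w" "ccw_next x w = y"
    "ccw_next y x = w" "ccw_next y w = v" "ccw_next y v = x"
    "v \<noteq> x" "v \<noteq> y" "w \<noteq> x" "w \<noteq> y" "x \<noteq> y" "UNIV = {v, w, x, y}"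
proof -
  have "\<forall>v w. v \<noteq> w \<longrightarrow> (let x = ccw_next v w; y = ccw_next v x in
    ccw_next v y = w \<and>
    ccw_next w v = y \<and> ccw_next w y = x \<and> ccw_next w x = v \<and>
    ccw_next x y = v \<and> ccw_next x v = w \<and> ccw_next x w = y \<and>
    ccw_next y x = w \<and> ccw_next y w = v \<and> ccw_next y v = x \<and>
    v \<noteq> x \<and> v \<noteq> y \<and> w \<noteq> x \<and> w \<noteq> y \<and> x \<noteq> y \<and> (\<forall>z. z = v \<or> z = w \<or> z = x \<or> z = y))"
    unfolding all_4_iff Let_def ccw_next_table by (simp add: ccw_next_table)
  from this[unfolded Let_def, rule_format, OF assms(1), unfolded assms(2,3)]
  show "ccw_next v y = w"
    "ccw_next w v = y" "ccw_next w y = x" "ccw_next w x = v"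
    "ccw_next x y = v" "ccw_next x v = w" "ccw_next x w = y"
    "ccw_next y x = w" "ccw_next y w = v" "ccw_next y v = x"
    "v \<noteq> x" "v \<noteq> y" "w \<noteq> x" "w \<noteq> y" "x \<noteq> y" "UNIV = {v, w, x, y}" by blast+
qed (use assms in simp_all)

text \<open>
  An odd relabelling reverses the orientation, so it turns the successor into the predecessor,
  which is the successor of the successor.
\<close>

lemma ccw_next_odd:
  fixes \<sigma> :: "4 \<Rightarrow> 4"
  assumes "bij \<sigma>" "\<not> evenperm \<sigma>" "v \<noteq> w"
  shows "ccw_next (\<sigma> v) (\<sigma> w) = \<sigma> (ccw_next v (ccw_next v w))"
proof -
  have t: "swap (2::4) 3 permutes UNIV" by (intro permutes_swap_id) auto
  have "\<exists>p. p permutes UNIV \<and> evenperm p \<and> p 0 = v \<and> p 1 = w"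
  proof -
    \<comment> \<open>Moves 0 to \<open>v\<close> and 1 to \<open>w\<close>; composing with the transposition of 2 and 3 corrects its parity.\<close>
    define q where "q = swap (swap 0 v 1) w \<circ> swap 0 v"
    have q: "q permutes UNIV" "q 0 = v" "q 1 = w"
      using assms(3) unfolding q_def
      by (auto simp: Transposition.transpose_def intro!: permutes_compose permutes_swap_id)
    have "evenperm (q \<circ> swap 2 3) \<longleftrightarrow> \<not> evenperm q"
      using q(1) t by (subst evenperm_comp) (auto simp: evenperm_swap permutation_permutes)
    moreover have "q \<circ> swap 2 3 permutes UNIV" using permutes_compose[OF t q(1)] .
    moreover have "(q \<circ> swap 2 3) 0 = v" "(q \<circ> swap 2 3) 1 = w"
      using q by (simp_all add: Transposition.transpose_def)
    ultimately show ?thesis using q by blast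
  qed
  then obtain p where p: "p permutes UNIV" "evenperm p" "p 0 = v" "p 1 = w" by blast
  have p2: "ccw_next v w = p 2" using ccw_next_even[OF p(1,2)] p(3,4) by simp
  have c: "swap (1::4) 3 \<circ> swap 1 2 permutes UNIV" "evenperm (swap (1::4) 3 \<circ> swap 1 2)"
    using even_double_transposition[of 1 3 1 2] by auto
  have "ccw_next v (p 2) = p 3"
    using ccw_next_even[OF permutes_compose[OF c(1) p(1)]] evenperm_comp[of p "swap 1 3 \<circ> swap 1 2"]
      c p by (auto simp: Transposition.transpose_def permutation_permutes)
  then have y: "ccw_next v (ccw_next v w) = p 3" using p2 by simp
  have s: "\<sigma> permutes UNIV" using assms(1) by (rule bij_imp_permutes) simp
  \<comment> \<open>This even permutation starts with \<open>\<sigma> v, \<sigma> w\<close> and continues with the image of the third vertex after them.\<close>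
  let ?q = "\<sigma> \<circ> (p \<circ> swap 2 3)"
  have pt: "p \<circ> swap 2 3 permutes UNIV" using permutes_compose[OF t p(1)] .
  have "?q permutes UNIV" using permutes_compose[OF pt s] .
  moreover have "\<not> evenperm (p \<circ> swap 2 3)"
    using p(1,2) t by (subst evenperm_comp) (auto simp: evenperm_swap permutation_permutes)
  then have "evenperm ?q"
    using assms(2) s pt by (subst evenperm_comp) (auto simp: permutation_permutes)
  ultimately have "ccw_next (?q 0) (?q 1) = ?q 2" by (rule ccw_next_even)
  then show ?thesis using p(3,4) y by (simp add: Transposition.transpose_def)
qed

section \<open>Periodic points and invariant sets of self-maps of finite sets\<close>

lemma funpow_cancel:
  assumes "inj_on f A" "f ` A \<subseteq> A" "x \<in> A"
  shows "(f ^^ i) x = (f ^^ (i + d)) x \<Longrightarrow> x = (f ^^ d) x"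
proof (induction i)
  case (Suc i)
  have mem: "(f ^^ n) x \<in> A" for n by (induction n) (use assms in auto)
  from Suc show ?case using inj_onD[OF assms(1) _ mem mem, of i "i + d"] by simp
qed simp

lemma ex_period:
  assumes "inj_on f A" "f ` A \<subseteq> A" "finite A" "x \<in> A"
  shows "\<exists>n>0. (f ^^ n) x = x"
proof -
  have "range (\<lambda>n. (f ^^ n) x) \<subseteq> A"
  proof
    fix y assume "y \<in> range (\<lambda>n. (f ^^ n) x)"
    then obtain n where "y = (f ^^ n) x" by blast
    moreover have "(f ^^ n) x \<in> A" for n by (induction n) (use assms in auto)
    ultimately show "y \<in> A" by simp
  qed
  then have "\<not> inj (\<lambda>n. (f ^^ n) x)" using assms(3) finite_subset range_inj_infinite by blast
  then obtain m n where mn: "m < n" "(f ^^ m) x = (f ^^ n) x"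
    unfolding inj_on_def by (metis nat_neq_iff)
  then have "x = (f ^^ (n - m)) x" using funpow_cancel[OF assms(1,2,4), of m "n - m"] by simp
  then show ?thesis using mn(1) by (metis zero_less_diff)
qed

text \<open>
  A nonempty subset that the map takes into itself, of least possible size, is mapped onto itself.
\<close>

lemma ex_invariant_subset:
  fixes f :: "'a \<Rightarrow> 'a"
  assumes "finite A" "A \<noteq> {}" "f ` A \<subseteq> A"
  obtains B where "B \<subseteq> A" "B \<noteq> {}" "f ` B = B"
proof -
  define n where "n = (LEAST n. \<exists>B. B \<subseteq> A \<and> B \<noteq> {} \<and> f ` B \<subseteq> B \<and> card B = n)"
  have "\<exists>n B. B \<subseteq> A \<and> B \<noteq> {} \<and> f ` B \<subseteq> B \<and> card B = n" using assms by blast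
  then have "\<exists>B. B \<subseteq> A \<and> B \<noteq> {} \<and> f ` B \<subseteq> B \<and> card B = n" unfolding n_def by (rule LeastI_ex)
  then obtain B where B: "B \<subseteq> A" "B \<noteq> {}" "f ` B \<subseteq> B" "card B = n" by blast
  have "card B \<le> card (f ` B)"
    unfolding B(4) unfolding n_def
  proof (rule Least_le)
    show "\<exists>C. C \<subseteq> A \<and> C \<noteq> {} \<and> f ` C \<subseteq> C \<and> card C = card (f ` B)"
      using B(1-3) by (intro exI[of _ "f ` B"]) auto
  qed
  then have "f ` B = B" using B(1,3) assms(1) by (meson card_seteq finite_subset)
  then show ?thesis using that B by blast
qed

section \<open>Flags of a tetrahedron\<close>

fun rev_flag :: "'t flag \<Rightarrow> 't flag" where
  "rev_flag (t, v, w) = (t, w, v)"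

text \<open>
  The flags \<open>k\<close>, \<open>rev_flag k\<close>, \<open>opp_flag k\<close> and
  \<open>rev_flag (opp_flag k)\<close> are the corners, one at each tip of the tetrahedron, that
  lie on the pair of opposite edges containing the edge of \<open>k\<close>.
\<close>

fun opp_flag :: "'t flag \<Rightarrow> 't flag" where
  "opp_flag (t, v, w) = (t, ccw_next v w, ccw_next v (ccw_next v w))"

lemma flag_cases:
  assumes "k \<in> flags"
  obtains t v w x y where "k = (t, v, w)" "v \<noteq> w" "ccw_next v w = x" "ccw_next v x = y"
  using assms by (cases k) (auto simp: flags_def)

lemma flagI: "v \<noteq> w \<Longrightarrow> (t, v, w) \<in> flags"
  by (simp add: flags_def)

text \<open>
  The identities for \<open>ccw\<close> with \<open>rev_flag\<close> and \<open>opp_flag\<close>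
  say that the three pairs of opposite edges appear in the same cyclic order at all four tips: the
  Klein four-group consists of even permutations.
\<close>

lemma flag_ops:
  assumes "k \<in> flags"
  shows ccw_flag [simp]: "ccw k \<in> flags"
    and rev_in_flags [simp]: "rev_flag k \<in> flags"
    and opp_in_flags [simp]: "opp_flag k \<in> flags"
    and ccw_ccw_ccw [simp]: "ccw (ccw (ccw k)) = k"
    and ccw_neq [simp]: "ccw k \<noteq> k" "ccw (ccw k) \<noteq> k" "k \<noteq> ccw k" "k \<noteq> ccw (ccw k)"
    and rev_rev [simp]: "rev_flag (rev_flag k) = k"
    and opp_opp [simp]: "opp_flag (opp_flag k) = k"
    and opp_rev: "opp_flag (rev_flag k) = rev_flag (opp_flag k)"
    and ccw_rev: "ccw (rev_flag k) = rev_flag (opp_flag (ccw k))"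
    and ccw_opp: "ccw (opp_flag k) = rev_flag (ccw k)"
    and rev_neq [simp]: "rev_flag k \<noteq> k"
    and opp_neq [simp]: "opp_flag k \<noteq> k" "opp_flag k \<noteq> rev_flag k" "rev_flag (opp_flag k) \<noteq> k"
    and tri_ccw [simp]: "tri (ccw k) = tri k"
proof -
  obtain t v w x y where k: "k = (t, v, w)" "v \<noteq> w" "ccw_next v w = x" "ccw_next v x = y"
    using assms by (rule flag_cases)
  note tab = tetrahedron_table[OF k(2,3,4)]
  show "ccw k \<in> flags" "rev_flag k \<in> flags" "opp_flag k \<in> flags" "ccw (ccw (ccw k)) = k"
    "ccw k \<noteq> k" "ccw (ccw k) \<noteq> k" "k \<noteq> ccw k" "k \<noteq> ccw (ccw k)"
    "rev_flag (rev_flag k) = k"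
    "opp_flag (opp_flag k) = k"
    "opp_flag (rev_flag k) = rev_flag (opp_flag k)"
    "ccw (rev_flag k) = rev_flag (opp_flag (ccw k))"
    "ccw (opp_flag k) = rev_flag (ccw k)"
    "rev_flag k \<noteq> k" "opp_flag k \<noteq> k" "opp_flag k \<noteq> rev_flag k" "rev_flag (opp_flag k) \<noteq> k"
    "tri (ccw k) = tri k"
    using tab(1-17) k(2) unfolding k(1) by (auto simp: flags_def)
qed

lemma tri_eq_iff:
  assumes "k \<in> flags" "s \<in> flags"
  shows "tri s = tri k \<longleftrightarrow> s = k \<or> s = ccw k \<or> s = ccw (ccw k)"
proof -
  obtain t v w x y where k: "k = (t, v, w)" "v \<noteq> w" "ccw_next v w = x" "ccw_next v x = y"
    using assms(1) by (rule flag_cases)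
  note tab = tetrahedron_table[OF k(2,3,4)]
  obtain t' v' w' where s: "s = (t', v', w')" "v' \<noteq> w'" using assms(2) by (cases s) (auto simp: flags_def)
  have "w' = v \<or> w' = w \<or> w' = x \<or> w' = y" using tab(18) by blast
  then show ?thesis unfolding s(1) k(1) using tab(1,2) s(2) by auto
qed

lemma sum_triangle:
  fixes f :: "'t::finite flag \<Rightarrow> 'a::comm_monoid_add"
  assumes "k \<in> flags"
  shows "(\<Sum>s | s \<in> flags \<and> tri s = tri k. f s) = f k + f (ccw k) + f (ccw (ccw k))"
proof -
  have "{s. s \<in> flags \<and> tri s = tri k} = {k, ccw k, ccw (ccw k)}"
    using assms tri_eq_iff[OF assms] by auto
  moreover have "ccw (ccw k) \<noteq> ccw k" using assms by (metis ccw_neq(1) ccw_flag)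
  then have "distinct [k, ccw k, ccw (ccw k)]" using assms by (simp add: eq_commute)
  ultimately show ?thesis using assms by (auto simp: add.assoc)
qed

section \<open>Gluings and rotation about the vertices of the boundary\<close>

locale triangulation =
  fixes G :: "'t::finite gluing"
  assumes ideal: "ideal_triangulation G"
begin

lemma gluing:
  assumes "G t a = (t', \<sigma>)"
  shows "bij \<sigma>" "\<not> evenperm \<sigma>" "(t', \<sigma> a) \<noteq> (t, a)" "G t' (\<sigma> a) = (t, inv \<sigma>)"
    "\<sigma> b = \<sigma> c \<longleftrightarrow> b = c" "inv \<sigma> (\<sigma> b) = b"
    "b \<noteq> c \<Longrightarrow> ccw_next (\<sigma> b) (\<sigma> c) = \<sigma> (ccw_next b (ccw_next b c))"
proof -
  show g: "bij \<sigma>" "\<not> evenperm \<sigma>" "(t', \<sigma> a) \<noteq> (t, a)" "G t' (\<sigma> a) = (t, inv \<sigma>)"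
    using ideal assms unfolding ideal_triangulation_def by blast+
  show "\<sigma> b = \<sigma> c \<longleftrightarrow> b = c" using g(1) by (metis bij_inv_eq_iff)
  show "inv \<sigma> (\<sigma> b) = b" using g(1) by (simp add: bij_is_inj)
  show "b \<noteq> c \<Longrightarrow> ccw_next (\<sigma> b) (\<sigma> c) = \<sigma> (ccw_next b (ccw_next b c))"
    using ccw_next_odd[OF g(1,2)] .
qed

text \<open>
  The next corner, in the counterclockwise order, around the vertex of the boundary at which
  \<open>k\<close> lies.
\<close>

definition rot :: "'t flag \<Rightarrow> 't flag" where
  "rot k = ccw (flip G (ccw k))"

lemma flip_eq: "G t w = (t', \<sigma>) \<Longrightarrow> flip G (t, v, w) = (t', \<sigma> v, \<sigma> w)"
  by (simp add: flip_def across_def)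

lemma flip_ops:
  assumes "k \<in> flags"
  shows flip_flag [simp]: "flip G k \<in> flags"
    and flip_flip [simp]: "flip G (flip G k) = k"
    and flip_neq [simp]: "flip G k \<noteq> k" "k \<noteq> flip G k"
proof -
  obtain t v w where k: "k = (t, v, w)" "v \<noteq> w" using assms by (cases k) (auto simp: flags_def)
  obtain t' \<sigma> where g: "G t w = (t', \<sigma>)" by fastforce
  note gl = gluing[OF g]
  have f: "flip G k = (t', \<sigma> v, \<sigma> w)" using flip_eq[OF g] k(1) by simp
  show "flip G k \<in> flags" using f k(2) gl(5) by (auto simp: flags_def)
  show "flip G (flip G k) = k" using f flip_eq[OF gl(4)] gl(6) k(1) by simp
  show "flip G k \<noteq> k" "k \<noteq> flip G k" using gl(3) f k(1) by auto
qed

lemma rot_flag [simp]: "k \<in> flags \<Longrightarrow> rot k \<in> flags"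
  by (simp add: rot_def)

lemma rot_ccw_ccw: "k \<in> flags \<Longrightarrow> ccw (ccw (rot k)) = flip G (ccw k)"
  by (simp add: rot_def)

lemma rot_inverse: "k \<in> flags \<Longrightarrow> ccw (ccw (flip G (ccw (ccw (rot k))))) = k"
  by (simp add: rot_def)

lemma rot_inverse': "k \<in> flags \<Longrightarrow> rot (ccw (ccw (flip G (ccw (ccw k))))) = k"
  by (simp add: rot_def)

lemma rot_inj: "k \<in> flags \<Longrightarrow> k' \<in> flags \<Longrightarrow> rot k = rot k' \<longleftrightarrow> k = k'"
  by (metis rot_inverse)

lemma rot_cases:
  assumes "k \<in> flags"
  obtains t v w x y t' \<sigma> where "k = (t, v, w)" "v \<noteq> w" "ccw_next v w = x" "ccw_next v x = y"
    "G t x = (t', \<sigma>)" "rot k = (t', \<sigma> v, \<sigma> w)"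
proof -
  obtain t v w x y where k: "k = (t, v, w)" "v \<noteq> w" "ccw_next v w = x" "ccw_next v x = y"
    using assms by (rule flag_cases)
  note tab = tetrahedron_table[OF k(2,3,4)]
  obtain t' \<sigma> where g: "G t x = (t', \<sigma>)" by fastforce
  have "rot k = (t', \<sigma> v, \<sigma> w)"
    using k(1,3) tab flip_eq[OF g] gluing(7)[OF g, of v x] unfolding rot_def by simp
  then show ?thesis using that[OF k g] by blast
qed

text \<open>
  The rotation about an edge, seen from the two tips of the tetrahedra that are not ends of the
  edge: the triangles at these tips share sides, along which contributions to the angles around
  the edge cancel.
\<close>

lemma flip_rev_opp:
  assumes "k \<in> flags"
  shows "flip G (rev_flag (opp_flag k)) = opp_flag (rot k)"
proof -
  obtain t v w x y t' \<sigma> where k: "k = (t, v, w)" "v \<noteq> w" "ccw_next v w = x" "ccw_next v x = y"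
    "G t x = (t', \<sigma>)" "rot k = (t', \<sigma> v, \<sigma> w)"
    using assms by (rule rot_cases)
  note gl = gluing[OF k(5)]
  show ?thesis using k tetrahedron_table[OF k(2,3,4)] gl(5,7) by (simp add: flip_eq[OF k(5)])
qed

text \<open>
  Seen from its other end, the rotation about an edge runs backwards.
\<close>

lemma rot_rev_rot:
  assumes "k \<in> flags"
  shows "rot (rev_flag (rot k)) = rev_flag k"
proof -
  obtain t v w x y t' \<sigma> where k: "k = (t, v, w)" "v \<noteq> w" "ccw_next v w = x" "ccw_next v x = y"
    "G t x = (t', \<sigma>)" "rot k = (t', \<sigma> v, \<sigma> w)"
    using assms by (rule rot_cases)
  note gl = gluing[OF k(5)] and tab = tetrahedron_table[OF k(2,3,4)]
  have n: "ccw_next (\<sigma> w) (\<sigma> v) = \<sigma> x" using k(2) tab gl(7)[of w v] by simp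
  have "rot (rev_flag (rot k)) = ccw (flip G (ccw (rev_flag (rot k))))" by (subst rot_def) (rule refl)
  also have "\<dots> = ccw (flip G (t', \<sigma> w, \<sigma> x))" by (simp add: k(6) n)
  also have "flip G (t', \<sigma> w, \<sigma> x) = (t, w, x)" using flip_eq[OF gl(4)] gl(6) by simp
  finally show ?thesis using tab k by simp
qed

lemma rot_neq_rev:
  assumes "k \<in> flags"
  shows "rot k \<noteq> rev_flag k"
proof
  assume eq: "rot k = rev_flag k"
  obtain t v w x y t' \<sigma> where k: "k = (t, v, w)" "v \<noteq> w" "ccw_next v w = x" "ccw_next v x = y"
    "G t x = (t', \<sigma>)" "rot k = (t', \<sigma> v, \<sigma> w)"
    using assms by (rule rot_cases)
  note gl = gluing[OF k(5)] and tab = tetrahedron_table[OF k(2,3,4)]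
  have s: "\<sigma> v = w" "\<sigma> w = v" "t' = t" using eq[unfolded k(6)] by (simp_all add: k(1))
  have "\<sigma> x \<noteq> x" using gl(3) s(3) by auto
  moreover have "\<sigma> x \<noteq> v" "\<sigma> x \<noteq> w" using gl(5)[of x w] gl(5)[of x v] s tab(13,15) by auto
  moreover have "\<sigma> x \<in> {v, w, x, y}" unfolding tab(18)[symmetric] by simp
  ultimately have sx: "\<sigma> x = y" by blast
  have "ccw_next (\<sigma> v) (\<sigma> w) = \<sigma> y" using gl(7)[OF k(2)] tab(1,2) by simp
  then have "\<sigma> y = y" using s tab(4) by simp
  then show False using sx gl(5)[of x y] tab(17) by simp
qed

lemma rot_pow_flag [simp]: "k \<in> flags \<Longrightarrow> (rot ^^ n) k \<in> flags"
  by (induction n) auto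

text \<open>
  An edge of the manifold is not identified with itself in reverse. By \<open>rot_rev_rot\<close>
  a rotation from \<open>k\<close> to \<open>rev_flag k\<close> can be shortened by one step at
  both of its ends; this leads to a rotation by 0 or 1 steps, and one step is excluded since
  gluings reverse the orientation.
\<close>

lemma rot_pow_neq_rev: "k \<in> flags \<Longrightarrow> (rot ^^ n) k \<noteq> rev_flag k"
proof (induction n arbitrary: k rule: induct_nat_012)
  case 0
  then show ?case by (metis funpow_0 rev_neq)
next
  case 1
  then show ?case by (simp add: rot_neq_rev)
next
  case (ge2 n)
  show ?case
  proof
    assume "(rot ^^ Suc (Suc n)) k = rev_flag k"
    then have "rot ((rot ^^ n) (rot k)) = rot (rev_flag (rot k))"
      using rot_rev_rot[OF ge2(3)] by (simp add: funpow_swap1)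
    then have "(rot ^^ n) (rot k) = rev_flag (rot k)"
      using ge2(3) by (subst (asm) rot_inj) auto
    then show False using ge2(1)[of "rot k"] ge2(3) by simp
  qed
qed

lemma rot_periodic:
  assumes "k \<in> flags"
  shows "\<exists>n>0. (rot ^^ n) k = k"
  by (rule ex_period[of rot flags]) (use assms rot_inj in \<open>auto intro!: inj_onI\<close>)

end

context triangulation
begin

lemma corner_adj_iff:
  assumes "k \<in> flags"
  shows "(k, k') \<in> corner_adj G \<longleftrightarrow> k' = rot k \<or> (k' \<in> flags \<and> k = rot k')"
proof
  obtain t v w x y t' \<sigma> where k: "k = (t, v, w)" "v \<noteq> w" "ccw_next v w = x" "ccw_next v x = y"
    "G t x = (t', \<sigma>)" "rot k = (t', \<sigma> v, \<sigma> w)"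
    using assms by (rule rot_cases)
  note tab = tetrahedron_table[OF k(2,3,4)]
  have rot_x: "rot k = across G x (t, v, w)" using k(5,6) by (simp add: across_def)
  {
    assume "(k, k') \<in> corner_adj G"
    then obtain a where a: "k' = across G a (t, v, w)" "a \<noteq> v" "a \<noteq> w"
      unfolding corner_adj_def k(1) by blast
    have "a \<in> {v, w, x, y}" unfolding tab(18)[symmetric] by simp
    then consider "a = x" | "a = y" using a by blast
    then show "k' = rot k \<or> (k' \<in> flags \<and> k = rot k')"
    proof cases
      case 1
      then show ?thesis using a(1) rot_x by simp
    next
      case 2
      obtain t2 \<tau> where g: "G t y = (t2, \<tau>)" by fastforce
      note gl = gluing[OF g]
      have k': "k' = (t2, \<tau> v, \<tau> w)" using a(1) 2 g by (simp add: across_def)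
      have "ccw_next (\<tau> v) (\<tau> w) = \<tau> y" using gl(7)[OF k(2)] tab(1,2) by simp
      then have "rot k' = k"
        using flip_eq[OF gl(4)] gl(6) tab(3) unfolding rot_def k' k(1) by simp
      moreover have "k' \<in> flags" using k' k(2) gl(5) by (simp add: flags_def)
      ultimately show ?thesis by simp
    qed
  }
  assume "k' = rot k \<or> (k' \<in> flags \<and> k = rot k')"
  then show "(k, k') \<in> corner_adj G"
  proof
    assume "k' = rot k"
    then show ?thesis using rot_x tab(13,15) k(1,2) unfolding corner_adj_def by blast
  next
    assume k': "k' \<in> flags \<and> k = rot k'"
    then have "k' \<in> flags" by simp
    then obtain t v w x y t' \<sigma> where k: "k' = (t, v, w)" "v \<noteq> w" "ccw_next v w = x" "ccw_next v x = y"
      "G t x = (t', \<sigma>)" "rot k' = (t', \<sigma> v, \<sigma> w)"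
      by (rule rot_cases)
    note gl = gluing[OF k(5)] and tab = tetrahedron_table[OF k(2,3,4)]
    have "k' = across G (\<sigma> x) (t', \<sigma> v, \<sigma> w)" using k(1) gl(4,6) by (simp add: across_def)
    moreover have "\<sigma> x \<noteq> \<sigma> v" "\<sigma> x \<noteq> \<sigma> w" "\<sigma> v \<noteq> \<sigma> w" using k(2) gl(5) tab(13,15) by auto
    moreover have "k = (t', \<sigma> v, \<sigma> w)" using k' k(6) by simp
    ultimately show ?thesis unfolding corner_adj_def by blast
  qed
qed

lemma corner_adj_flag: "(k, k') \<in> corner_adj G \<Longrightarrow> k \<in> flags"
  unfolding corner_adj_def flags_def by auto

lemma sym_corner_adj: "sym (corner_adj G)"
proof (rule symI)
  fix k k' assume a: "(k, k') \<in> corner_adj G"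
  have k: "k \<in> flags" using corner_adj_flag[OF a] .
  then have "k' = rot k \<or> (k' \<in> flags \<and> k = rot k')" using a corner_adj_iff by blast
  moreover from this have "k' \<in> flags" using k by auto
  ultimately show "(k', k) \<in> corner_adj G" using corner_adj_iff[of k' k] k by blast
qed

text \<open>
  The two faces of a tetrahedron at an edge give the rotation and its inverse, and on a finite set
  the inverse is a power of the rotation.
\<close>

lemma bd_vertex_eq_rot_orbit:
  assumes "k \<in> flags"
  shows "bd_vertex G k = range (\<lambda>n. (rot ^^ n) k)"
proof
  show "bd_vertex G k \<subseteq> range (\<lambda>n. (rot ^^ n) k)"
  proof
    fix j assume "j \<in> bd_vertex G k"
    then have "(k, j) \<in> (corner_adj G)\<^sup>*" by (simp add: bd_vertex_def)
    then show "j \<in> range (\<lambda>n. (rot ^^ n) k)"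
    proof (induction rule: rtrancl_induct)
      case base
      show ?case by (rule range_eqI[of _ _ 0]) simp
    next
      case (step i j)
      then obtain n where n: "i = (rot ^^ n) k" by blast
      have i: "i \<in> flags" using n assms by simp
      consider "j = rot i" | "j \<in> flags" "i = rot j" using step(2) corner_adj_iff[OF i] by blast
      then show ?case
      proof cases
        case 1
        then show ?thesis using n by (intro range_eqI[of _ _ "Suc n"]) simp
      next
        case 2
        obtain m where m: "m > 0" "(rot ^^ m) i = i" using rot_periodic[OF i] by blast
        have "rot ((rot ^^ (m - 1)) i) = rot j" using m 2(2) by (cases m) auto
        then have "j = (rot ^^ (m - 1)) i" using rot_inj i 2(1) by (metis rot_pow_flag)
        then have "j = (rot ^^ (m - 1 + n)) k" using n by (simp add: funpow_add)
        then show ?thesis by blast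
      qed
    qed
  qed
  have "(k, (rot ^^ n) k) \<in> (corner_adj G)\<^sup>*" for n
  proof (induction n)
    case (Suc n)
    then show ?case using corner_adj_iff[of "(rot ^^ n) k"] assms by (simp add: rtrancl.rtrancl_into_rtrancl)
  qed simp
  then show "range (\<lambda>n. (rot ^^ n) k) \<subseteq> bd_vertex G k" by (auto simp: bd_vertex_def)
qed

lemma self_in_bd_vertex [simp]: "k \<in> bd_vertex G k"
  by (simp add: bd_vertex_def)

lemma bd_vertex_flag: "k \<in> flags \<Longrightarrow> j \<in> bd_vertex G k \<Longrightarrow> j \<in> flags"
  by (auto simp: bd_vertex_eq_rot_orbit)

lemma bd_vertex_eq_iff: "bd_vertex G j = bd_vertex G k \<longleftrightarrow> j \<in> bd_vertex G k"
proof
  assume "j \<in> bd_vertex G k"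
  then have "(k, j) \<in> (corner_adj G)\<^sup>*" by (simp add: bd_vertex_def)
  moreover from this have "(j, k) \<in> (corner_adj G)\<^sup>*"
    using sym_corner_adj sym_rtrancl by (metis symD)
  ultimately show "bd_vertex G j = bd_vertex G k"
    unfolding bd_vertex_def by (auto intro: rtrancl_trans)
qed (metis self_in_bd_vertex)

lemma bd_vertex_rot [simp]: "k \<in> flags \<Longrightarrow> bd_vertex G (rot k) = bd_vertex G k"
  by (subst bd_vertex_eq_iff) (auto simp: bd_vertex_eq_rot_orbit intro: range_eqI[of _ _ 1])

lemma rot_in_bd_vertex: "k \<in> flags \<Longrightarrow> j \<in> bd_vertex G k \<Longrightarrow> rot j \<in> bd_vertex G k"
  using bd_vertex_rot[of j] bd_vertex_eq_iff bd_vertex_flag by blast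

lemma bd_vertex_flip_ccw: "s \<in> flags \<Longrightarrow> bd_vertex G (ccw (flip G s)) = bd_vertex G (ccw (ccw s))"
  using bd_vertex_rot[of "ccw (ccw s)"] by (simp add: rot_def)

lemma bd_vertex_flip_ccw_ccw: "s \<in> flags \<Longrightarrow> bd_vertex G (ccw (ccw (flip G s))) = bd_vertex G (ccw s)"
  using bd_vertex_flip_ccw[of "flip G s"] by simp

lemma bij_betw_rot: 
  assumes "k \<in> flags"
  shows "bij_betw rot (bd_vertex G k) (bd_vertex G k)"
proof -
  have "inj_on rot (bd_vertex G k)"
    using rot_inj bd_vertex_flag[OF assms] by (auto intro!: inj_onI)
  moreover have "rot ` bd_vertex G k \<subseteq> bd_vertex G k" using rot_in_bd_vertex[OF assms] by blast
  ultimately show ?thesis by (simp add: bij_betw_def endo_inj_surj)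
qed

lemma sum_bd_vertex_rot:
  "k \<in> flags \<Longrightarrow> (\<Sum>j\<in>bd_vertex G k. f (rot j)) = (\<Sum>j\<in>bd_vertex G k. f j)"
  using sum.reindex_bij_betw[OF bij_betw_rot] .

lemma rev_pow_rot: "k \<in> flags \<Longrightarrow> (rot ^^ n) (rev_flag ((rot ^^ n) k)) = rev_flag k"
proof (induction n)
  case (Suc n)
  have "(rot ^^ Suc n) (rev_flag ((rot ^^ Suc n) k)) = (rot ^^ n) (rot (rev_flag (rot ((rot ^^ n) k))))"
    by (simp add: funpow_swap1)
  also have "\<dots> = rev_flag k" using Suc by (subst rot_rev_rot) auto
  finally show ?case .
qed simp

lemma rev_in_bd_vertex:
  assumes "k \<in> flags" "j \<in> bd_vertex G k"
  shows "rev_flag j \<in> bd_vertex G (rev_flag k)"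
proof -
  obtain n where n: "j = (rot ^^ n) k" using assms by (auto simp: bd_vertex_eq_rot_orbit)
  have "rev_flag j \<in> flags" using bd_vertex_flag[OF assms] by simp
  then have "(rot ^^ n) (rev_flag j) \<in> bd_vertex G (rev_flag j)"
    by (auto simp: bd_vertex_eq_rot_orbit)
  then have "rev_flag k \<in> bd_vertex G (rev_flag j)" using rev_pow_rot[OF assms(1)] n by simp
  then show ?thesis by (metis bd_vertex_eq_iff)
qed

lemma bij_betw_rev_flag:
  assumes "k \<in> flags"
  shows "bij_betw rev_flag (bd_vertex G k) (bd_vertex G (rev_flag k))"
proof (rule bij_betwI[where g = rev_flag])
  show "rev_flag \<in> bd_vertex G k \<rightarrow> bd_vertex G (rev_flag k)" using rev_in_bd_vertex assms by blast
  show "rev_flag \<in> bd_vertex G (rev_flag k) \<rightarrow> bd_vertex G k"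
    using rev_in_bd_vertex[of "rev_flag k"] assms by auto
  show "rev_flag (rev_flag x) = x" if "x \<in> bd_vertex G k" for x
    using rev_rev[OF bd_vertex_flag[OF assms that]] .
  show "rev_flag (rev_flag x) = x" if "x \<in> bd_vertex G (rev_flag k)" for x
    using rev_rev[OF bd_vertex_flag[OF rev_in_flags[OF assms] that]] .
qed

lemma rev_notin_bd_vertex: "k \<in> flags \<Longrightarrow> rev_flag k \<notin> bd_vertex G k"
  using rot_pow_neq_rev[of k] by (simp add: bd_vertex_eq_rot_orbit image_iff) metis

definition flag_edge :: "'t flag \<Rightarrow> 't \<times> 4 set" where
  "flag_edge k = (fst k, {fst (snd k), snd (snd k)})"

lemma edge_class_eq_image:
  assumes "k \<in> flags"
  shows "edge_class G (flag_edge k) = flag_edge ` bd_vertex G k"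
proof
  show "edge_class G (flag_edge k) \<subseteq> flag_edge ` bd_vertex G k"
  proof
    fix z assume "z \<in> edge_class G (flag_edge k)"
    then have "(flag_edge k, z) \<in> (edge_adj G)\<^sup>*" by (simp add: edge_class_def)
    then show "z \<in> flag_edge ` bd_vertex G k"
    proof (induction rule: rtrancl_induct)
      case (step y z)
      then obtain t v w where j: "(t, v, w) \<in> bd_vertex G k" "y = (t, {v, w})"
        by (auto simp: flag_edge_def)
      then have vw: "v \<noteq> w" using bd_vertex_flag[OF assms j(1)] by (simp add: flags_def)
      obtain a t' \<sigma> where a: "a \<notin> {v, w}" "G t a = (t', \<sigma>)" "z = (t', \<sigma> ` {v, w})"
        using step(2) j(2) unfolding edge_adj_def by auto
      have "((t, v, w), (t', \<sigma> v, \<sigma> w)) \<in> corner_adj G"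
        unfolding corner_adj_def using a vw by (auto simp: across_def intro!: exI[of _ a])
      then have "(t', \<sigma> v, \<sigma> w) \<in> bd_vertex G k"
        using j(1) unfolding bd_vertex_def by (simp add: rtrancl.rtrancl_into_rtrancl)
      moreover have "z = flag_edge (t', \<sigma> v, \<sigma> w)" using a(3) by (simp add: flag_edge_def)
      ultimately show ?case by blast
    qed simp
  qed
  have "(flag_edge k, flag_edge j) \<in> (edge_adj G)\<^sup>*" if "(k, j) \<in> (corner_adj G)\<^sup>*" for j
    using that
  proof (induction rule: rtrancl_induct)
    case (step i j)
    obtain t v w a where i: "i = (t, v, w)" "j = across G a (t, v, w)" "v \<noteq> w" "a \<noteq> v" "a \<noteq> w"
      using step(2) unfolding corner_adj_def by blast
    obtain t' \<sigma> where g: "G t a = (t', \<sigma>)" by fastforce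
    have "flag_edge i = (t, {v, w})" "flag_edge j = (t', \<sigma> ` {v, w})" "card {v, w} = 2" "a \<notin> {v, w}"
      using i g by (auto simp: flag_edge_def across_def)
    then have "(flag_edge i, flag_edge j) \<in> edge_adj G"
      unfolding edge_adj_def using g by blast
    then show ?case using step(3) by simp
  qed simp
  then show "flag_edge ` bd_vertex G k \<subseteq> edge_class G (flag_edge k)"
    by (auto simp: bd_vertex_def edge_class_def)
qed

lemma inj_on_flag_edge:
  assumes "k \<in> flags"
  shows "inj_on flag_edge (bd_vertex G k)"
proof (rule inj_onI)
  fix i j assume ij: "i \<in> bd_vertex G k" "j \<in> bd_vertex G k" "flag_edge i = flag_edge j"
  then have "i = j \<or> i = rev_flag j"
    by (cases i; cases j) (auto simp: flag_edge_def doubleton_eq_iff)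
  moreover have "j \<in> flags" using ij(2) bd_vertex_flag[OF assms] by simp
  moreover have "i \<in> bd_vertex G j" using ij by (metis bd_vertex_eq_iff)
  ultimately show "i = j" using rev_notin_bd_vertex[of j] by blast
qed

text \<open>
  Since an edge is not its own reverse, every edge of a tetrahedron in the class belongs to just
  one corner of the vertex, and sums around an edge become sums around a vertex.
\<close>

lemma sum_edge_class:
  assumes "k \<in> flags"
  shows "(\<Sum>(t', e')\<in>edge_class G (flag_edge k). edge_angle \<theta> t' e') = (\<Sum>j\<in>bd_vertex G k. corner_angle \<theta> j)"
proof -
  have "(\<Sum>(t', e')\<in>edge_class G (flag_edge k). edge_angle \<theta> t' e')
      = (\<Sum>j\<in>bd_vertex G k. case flag_edge j of (t', e') \<Rightarrow> edge_angle \<theta> t' e')"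
    unfolding edge_class_eq_image[OF assms] by (rule sum.reindex_cong[OF inj_on_flag_edge[OF assms]]) auto
  also have "\<dots> = (\<Sum>j\<in>bd_vertex G k. corner_angle \<theta> j)"
    by (intro sum.cong) (auto simp: flag_edge_def split: prod.splits)
  finally show ?thesis .
qed

end

section \<open>Pairs of opposite edges\<close>

fun opposite_pair :: "'t flag \<Rightarrow> 4 set set" where
  "opposite_pair (t, v, w) = {{v, w}, - {v, w}}"

lemma corner_angle_eq: "corner_angle \<theta> k = \<theta> (fst k) (opposite_pair k)"
  by (cases k) (simp add: edge_angle_def)

lemma opposite_pair_ops:
  assumes "k \<in> flags"
  shows "opposite_pair (rev_flag k) = opposite_pair k" "opposite_pair (opp_flag k) = opposite_pair k"
    "fst (rev_flag k) = fst k" "fst (opp_flag k) = fst k" "fst (ccw k) = fst k"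
proof -
  obtain t v w x y where k: "k = (t, v, w)" "v \<noteq> w" "ccw_next v w = x" "ccw_next v x = y"
    using assms by (rule flag_cases)
  note tab = tetrahedron_table[OF k(2,3,4)]
  have "- {v, w} = {x, y}" using tab(13-18) k(2) by blast
  moreover have "- {x, y} = {v, w}" using tab(13-18) k(2) by blast
  ultimately show "opposite_pair (opp_flag k) = opposite_pair k"
    using k tab(1,2) by (simp add: insert_commute)
qed (cases k; simp add: insert_commute)+

lemma corner_angle_rev [simp]: "k \<in> flags \<Longrightarrow> corner_angle \<theta> (rev_flag k) = corner_angle \<theta> k"
  and corner_angle_opp [simp]: "k \<in> flags \<Longrightarrow> corner_angle \<theta> (opp_flag k) = corner_angle \<theta> k"
  by (simp_all add: corner_angle_eq opposite_pair_ops)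

lemma opposite_pairs_eq:
  assumes "k \<in> flags"
  shows "opposite_pairs = {opposite_pair k, opposite_pair (ccw k), opposite_pair (ccw (ccw k))}"
    and "distinct [opposite_pair k, opposite_pair (ccw k), opposite_pair (ccw (ccw k))]"
proof -
  obtain t v w x y where k: "k = (t, v, w)" "v \<noteq> w" "ccw_next v w = x" "ccw_next v x = y"
    using assms by (rule flag_cases)
  note tab = tetrahedron_table[OF k(2,3,4)]
  have c: "- {v, w} = {x, y}" "- {v, x} = {w, y}" "- {v, y} = {w, x}" 
    "- {w, x} = {v, y}" "- {w, y} = {v, x}" "- {x, y} = {v, w}"
    using tab(13-18) k(2) by blast+
  have o: "opposite_pair k = {{v, w}, {x, y}}" "opposite_pair (ccw k) = {{v, x}, {w, y}}"
    "opposite_pair (ccw (ccw k)) = {{v, y}, {w, x}}" using k tab(2) c by simp_all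
  show "distinct [opposite_pair k, opposite_pair (ccw k), opposite_pair (ccw (ccw k))]"
    unfolding o using tab(13-17) k(2) by (simp add: doubleton_eq_iff)
  have sub: "{e, - e} \<in> {opposite_pair k, opposite_pair (ccw k), opposite_pair (ccw (ccw k))}" if ce: "card e = 2" for e
  proof -
    obtain a b where e: "e = {a, b}" "a \<noteq> b" using ce by (meson card_2_iff)
    have "a \<in> {v, w, x, y}" "b \<in> {v, w, x, y}" unfolding tab(18)[symmetric] by simp_all
    then have "e = {v, w} \<or> e = {x, y} \<or> e = {v, x} \<or> e = {w, y} \<or> e = {v, y} \<or> e = {w, x}"
      unfolding e(1) using e(2) by (elim insertE) (simp_all add: doubleton_eq_iff)
    then show ?thesis unfolding o by (elim disjE) (simp_all only: c insert_commute insert_iff simp_thms)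
  qed
  have mem: "{e, - e} \<in> opposite_pairs" if "card e = 2" for e
    unfolding opposite_pairs_def using that by blast
  have "opposite_pair k \<in> opposite_pairs" "opposite_pair (ccw k) \<in> opposite_pairs"
    "opposite_pair (ccw (ccw k)) \<in> opposite_pairs"
    using mem[of "{v, w}"] mem[of "{v, x}"] mem[of "{v, y}"] k(2) tab(13,14) unfolding o c by simp_all
  moreover have "opposite_pairs \<subseteq> {opposite_pair k, opposite_pair (ccw k), opposite_pair (ccw (ccw k))}"
    using sub unfolding opposite_pairs_def by blast
  ultimately show "opposite_pairs = {opposite_pair k, opposite_pair (ccw k), opposite_pair (ccw (ccw k))}"
    by (simp add: subset_antisym)
qed

lemma sum_opposite_pairs:
  assumes "k \<in> flags"
  shows "(\<Sum>q\<in>opposite_pairs. \<theta> (fst k) q)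
    = corner_angle \<theta> k + corner_angle \<theta> (ccw k) + corner_angle \<theta> (ccw (ccw k))"
  using opposite_pairs_eq(2)[OF assms] assms unfolding opposite_pairs_eq(1)[OF assms] corner_angle_eq
  by (simp add: opposite_pair_ops add.assoc)

lemma flags_of_opposite_pair:
  assumes "k \<in> flags"
  shows "{j \<in> flags. fst j = fst k \<and> opposite_pair j = opposite_pair k}
    = {k, rev_flag k, opp_flag k, rev_flag (opp_flag k)}"
proof -
  obtain t v w x y where k: "k = (t, v, w)" "v \<noteq> w" "ccw_next v w = x" "ccw_next v x = y"
    using assms by (rule flag_cases)
  note tab = tetrahedron_table[OF k(2,3,4)]
  have c: "- {v, w} = {x, y}" "- {x, y} = {v, w}" using tab(13-18) k(2) by blast+
  show ?thesis
  proof
    show "{j \<in> flags. fst j = fst k \<and> opposite_pair j = opposite_pair k}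
        \<subseteq> {k, rev_flag k, opp_flag k, rev_flag (opp_flag k)}"
    proof
      fix j assume "j \<in> {j \<in> flags. fst j = fst k \<and> opposite_pair j = opposite_pair k}"
      then obtain a b where j: "j = (t, a, b)" "a \<noteq> b" "{{a, b}, - {a, b}} = {{v, w}, {x, y}}"
        using k(1) c by (cases j) (auto simp: flags_def)
      then have "{a, b} = {v, w} \<or> {a, b} = {x, y}" by (metis insertE insertI1 singletonD)
      then show "j \<in> {k, rev_flag k, opp_flag k, rev_flag (opp_flag k)}"
        using j(1) k(1) tab(1,2) by (auto simp: doubleton_eq_iff)
    qed
  qed (use assms in \<open>auto simp: opposite_pair_ops\<close>)
qed

context triangulation
begin

section \<open>Deforming angle structures by flows on the boundary\<close>

text \<open>
  The number \<open>F s\<close> is the amount that leaves the triangle of \<open>s\<close> through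
  the side \<open>s\<close>.
\<close>

definition flux :: "('t flag \<Rightarrow> real) \<Rightarrow> bool" where
  "flux F \<longleftrightarrow> (\<forall>s\<in>flags. F (flip G s) = - F s \<and> F s + F (ccw s) + F (ccw (ccw s)) = 0)"

lemma fluxD:
  assumes "flux F" "s \<in> flags"
  shows "F (flip G s) = - F s" "F s + F (ccw s) + F (ccw (ccw s)) = 0"
  using assms unfolding flux_def by blast+

text \<open>
  Each flag \<open>k\<close> with the pair \<open>q\<close> is a corner with this angle and also
  the side opposite to this corner.
\<close>

definition deform :: "'t angles \<Rightarrow> ('t flag \<Rightarrow> real) \<Rightarrow> 't angles" where
  "deform \<theta> F t q = \<theta> t q + (\<Sum>k | k \<in> flags \<and> fst k = t \<and> opposite_pair k = q. F k)"

definition pair_flux :: "('t flag \<Rightarrow> real) \<Rightarrow> 't flag \<Rightarrow> real" where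
  "pair_flux F k = F k + F (rev_flag k) + F (opp_flag k) + F (rev_flag (opp_flag k))"

lemma corner_angle_deform:
  assumes k: "k \<in> flags"
  shows "corner_angle (deform \<theta> F) k = corner_angle \<theta> k + pair_flux F k"
proof -
  have "rev_flag k \<noteq> rev_flag (opp_flag k)" using k by (metis opp_in_flags opp_neq(1) rev_rev)
  moreover have "opp_flag k \<noteq> rev_flag (opp_flag k)" using rev_neq[of "opp_flag k"] k by (metis opp_in_flags)
  moreover have "k \<noteq> rev_flag k" "k \<noteq> opp_flag k" "rev_flag k \<noteq> opp_flag k" "k \<noteq> rev_flag (opp_flag k)"
    using k by (metis rev_neq opp_neq)+
  ultimately have "distinct [k, rev_flag k, opp_flag k, rev_flag (opp_flag k)]" by simp
  then show ?thesis
    unfolding corner_angle_eq deform_def pair_flux_def using flags_of_opposite_pair[OF k] by simp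
qed

text \<open>
  The pairs appear in the same cyclic order at the four tips, so the twelve terms are those of the
  four triangles at the tips.
\<close>

lemma pair_flux_sum:
  assumes F: "flux F" and k: "k \<in> flags"
  shows "pair_flux F k + pair_flux F (ccw k) + pair_flux F (ccw (ccw k)) = 0"
proof -
  have "F (rev_flag k) + F (rev_flag (opp_flag (ccw k))) + F (opp_flag (ccw (ccw k))) = 0"
    using fluxD(2)[OF F, of "rev_flag k"] k by (simp add: ccw_rev ccw_opp opp_rev[symmetric])
  moreover have "F (opp_flag k) + F (rev_flag (ccw k)) + F (rev_flag (opp_flag (ccw (ccw k)))) = 0"
    using fluxD(2)[OF F, of "opp_flag k"] k by (simp add: ccw_rev ccw_opp)
  moreover have "F (rev_flag (opp_flag k)) + F (opp_flag (ccw k)) + F (rev_flag (ccw (ccw k))) = 0"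
    using fluxD(2)[OF F, of "rev_flag (opp_flag k)"] k by (simp add: ccw_rev ccw_opp opp_rev)
  ultimately show ?thesis using fluxD(2)[OF F k] unfolding pair_flux_def by linarith
qed

text \<open>
  The sum is the flow out of the star of the vertex: it vanishes because the flow is conserved in
  each triangle of the star, and the sides ending at the vertex are shared by two of them.
\<close>

lemma flux_vertex_sum:
  assumes F: "flux F" and k: "k \<in> flags"
  shows "(\<Sum>j\<in>bd_vertex G k. F j) = 0"
proof -
  have "(\<Sum>j\<in>bd_vertex G k. F (ccw (ccw j))) = (\<Sum>j\<in>bd_vertex G k. F (ccw (ccw (rot j))))"
    using sum_bd_vertex_rot[OF k, of "\<lambda>j. F (ccw (ccw j))"] by simp
  also have "\<dots> = (\<Sum>j\<in>bd_vertex G k. - F (ccw j))"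
    using bd_vertex_flag[OF k] F by (intro sum.cong) (auto simp: rot_ccw_ccw fluxD)
  finally have "(\<Sum>j\<in>bd_vertex G k. - F (ccw j) - F (ccw (ccw j))) = 0"
    by (simp add: sum_subtractf sum_negf)
  moreover have "F j = - F (ccw j) - F (ccw (ccw j))" if "j \<in> bd_vertex G k" for j
    using fluxD(2)[OF F bd_vertex_flag[OF k that]] by simp
  ultimately show ?thesis by simp
qed

text \<open>
  The tips at the two ends of the edge contribute flows out of vertex stars. The contributions of
  the other two tips cancel across the faces around the edge, by \<open>flip_rev_opp\<close>.
\<close>

lemma pair_flux_vertex_sum:
  assumes F: "flux F" and k: "k \<in> flags"
  shows "(\<Sum>j\<in>bd_vertex G k. pair_flux F j) = 0"
proof -
  have 1: "(\<Sum>j\<in>bd_vertex G k. F (rev_flag j)) = 0"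
    using sum.reindex_bij_betw[OF bij_betw_rev_flag[OF k], of F] flux_vertex_sum[OF F, of "rev_flag k"] k
    by simp
  have "(\<Sum>j\<in>bd_vertex G k. F (opp_flag j)) = (\<Sum>j\<in>bd_vertex G k. F (opp_flag (rot j)))"
    using sum_bd_vertex_rot[OF k, of "\<lambda>j. F (opp_flag j)"] by simp
  also have "\<dots> = (\<Sum>j\<in>bd_vertex G k. - F (rev_flag (opp_flag j)))"
  proof (rule sum.cong)
    fix j assume "j \<in> bd_vertex G k"
    then have j: "j \<in> flags" using bd_vertex_flag[OF k] by simp
    show "F (opp_flag (rot j)) = - F (rev_flag (opp_flag j))"
      using fluxD(1)[OF F, of "rev_flag (opp_flag j)"] j by (simp add: flip_rev_opp)
  qed simp
  finally have 2: "(\<Sum>j\<in>bd_vertex G k. F (opp_flag j)) = - (\<Sum>j\<in>bd_vertex G k. F (rev_flag (opp_flag j)))"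
    by (simp add: sum_negf)
  show ?thesis unfolding pair_flux_def using 1 2 flux_vertex_sum[OF F k] by (simp add: sum.distrib)
qed

lemma generalized_angle_structure_deform:
  assumes \<theta>: "generalized_angle_structure G \<theta>" and F: "flux F"
  shows "generalized_angle_structure G (deform \<theta> F)"
  unfolding generalized_angle_structure_def
proof (intro conjI allI impI)
  fix t :: "'t"
  define k where "k = (t, 0 :: 4, 1 :: 4)"
  have k: "k \<in> flags" and t: "fst k = t" by (simp_all add: flags_def k_def)
  have "(\<Sum>q\<in>opposite_pairs. \<theta> t q) = pi" using \<theta> unfolding generalized_angle_structure_def by blast
  then show "(\<Sum>q\<in>opposite_pairs. deform \<theta> F t q) = pi"
    using sum_opposite_pairs[OF k, of "deform \<theta> F"] sum_opposite_pairs[OF k, of "\<theta>"]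
      pair_flux_sum[OF F k] k
    by (simp add: corner_angle_deform t)
next
  fix t :: "'t" and e :: "4 set" assume "card e = 2"
  then obtain v w where e: "e = {v, w}" "v \<noteq> w" by (meson card_2_iff)
  define k where "k = (t, v, w)"
  have k: "k \<in> flags" using e by (simp add: flags_def k_def)
  have fe: "(t, e) = flag_edge k" using e by (simp add: k_def flag_edge_def)
  have "(\<Sum>(t', e')\<in>edge_class G (t, e). edge_angle \<theta> t' e') = 2 * pi"
    using \<theta> \<open>card e = 2\<close> unfolding generalized_angle_structure_def by blast
  then have "(\<Sum>j\<in>bd_vertex G k. corner_angle \<theta> j) = 2 * pi"
    unfolding fe sum_edge_class[OF k] .
  moreover have "(\<Sum>j\<in>bd_vertex G k. corner_angle (deform \<theta> F) j) =
     (\<Sum>j\<in>bd_vertex G k. corner_angle \<theta> j + pair_flux F j)"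
    using bd_vertex_flag[OF k] by (intro sum.cong) (auto simp: corner_angle_deform)
  ultimately show "(\<Sum>(t', e')\<in>edge_class G (t, e). edge_angle (deform \<theta> F) t' e') = 2 * pi"
    unfolding fe sum_edge_class[OF k] by (simp add: sum.distrib pair_flux_vertex_sum[OF F k])
qed

text \<open>
  The face containing the side \<open>s\<close> has two further tips. For someone entering the
  tetrahedron through this face along \<open>s\<close>, this is the outward flux through the face
  at the tip on the right minus the one at the tip on the left. Both the sign of the flux and the
  roles of left and right change when the face is seen from the other side, whence
  \<open>cross_flux_flip\<close>.
\<close>

definition cross_flux :: "('t flag \<Rightarrow> real) \<Rightarrow> 't flag \<Rightarrow> real" where
  "cross_flux F s = F (opp_flag (ccw s)) - F (rev_flag (opp_flag (ccw (ccw s))))"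

lemma cross_flux_flip:
  assumes F: "flux F" and s: "s \<in> flags"
  shows "cross_flux F (flip G s) = cross_flux F s"
proof -
  have *: "opp_flag (ccw (flip G e)) = flip G (rev_flag (opp_flag (ccw (ccw e))))" if "e \<in> flags" for e
    using flip_rev_opp[of "ccw (ccw e)"] that by (simp add: rot_def)
  have "F (opp_flag (ccw (flip G s))) = - F (rev_flag (opp_flag (ccw (ccw s))))"
    using *[OF s] fluxD(1)[OF F, of "rev_flag (opp_flag (ccw (ccw s)))"] s by simp
  moreover have "F (opp_flag (ccw s)) = - F (rev_flag (opp_flag (ccw (ccw (flip G s)))))"
    using *[of "flip G s"] fluxD(1)[OF F, of "rev_flag (opp_flag (ccw (ccw (flip G s))))"] s by simp
  ultimately show ?thesis unfolding cross_flux_def by simp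
qed

text \<open>
  The change of the angle cut off by an arc is the flux through the side opposite to this corner,
  up to the difference of \<open>cross_flux\<close> at the two ends of the arc. The differences
  cancel along a closed curve, so its holonomy only sees the flow in its own boundary component.
\<close>

lemma pair_flux_left_arc:
  assumes F: "flux F" and s: "s \<in> flags"
  shows "pair_flux F (ccw s) = F (ccw s) + cross_flux F s - cross_flux F (ccw (ccw s))"
  using fluxD(2)[OF F, of "opp_flag s"] s
  by (simp add: ccw_rev ccw_opp pair_flux_def cross_flux_def)

lemma pair_flux_right_arc:
  assumes F: "flux F" and s: "s \<in> flags"
  shows "- pair_flux F (ccw (ccw s)) = - F (ccw (ccw s)) + cross_flux F s - cross_flux F (ccw s)"
  using fluxD(2)[OF F, of "rev_flag (opp_flag s)"] s
  by (simp add: ccw_rev ccw_opp opp_rev pair_flux_def cross_flux_def)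

end

section \<open>Transverse-taut veering triangulations\<close>

locale veering_triangulation = triangulation G for G :: "'t::finite gluing" +
  fixes \<alpha> :: "'t angles" and out :: "'t \<Rightarrow> 4 \<Rightarrow> bool"
  assumes veering: "veering G \<alpha>" and transverse: "transverse_taut G \<alpha> out"
begin

definition pi_flags :: "'t flag set" where
  "pi_flags = {k \<in> flags. corner_angle \<alpha> k = pi}"

definition points_out :: "'t flag \<Rightarrow> bool" where
  "points_out s = out (fst s) (snd (snd s))"

definition red :: "'t flag \<Rightarrow> bool" where
  "red k \<longleftrightarrow> right_veering G \<alpha> k"

lemma taut: "taut_angle_structure G \<alpha>"
  using veering unfolding veering_def by blast

lemma generalized: "generalized_angle_structure G \<alpha>"
  using taut unfolding taut_angle_structure_def by blast

lemma opposite_pair_mem: "k \<in> flags \<Longrightarrow> opposite_pair k \<in> opposite_pairs"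
  using opposite_pairs_eq(1)[of k] by blast

lemma corner_angle_0_or_pi: "k \<in> flags \<Longrightarrow> corner_angle \<alpha> k = 0 \<or> corner_angle \<alpha> k = pi"
  using taut opposite_pair_mem[of k] unfolding taut_angle_structure_def corner_angle_eq by blast

lemma angle_zero_iff: "k \<in> flags \<Longrightarrow> corner_angle \<alpha> k = 0 \<longleftrightarrow> k \<notin> pi_flags"
  using corner_angle_0_or_pi[of k] by (auto simp: pi_flags_def)

lemma pi_flagD: "x \<in> pi_flags \<Longrightarrow> x \<in> flags"
  by (simp add: pi_flags_def)

lemma angle_sum: "k \<in> flags \<Longrightarrow>
    corner_angle \<alpha> k + corner_angle \<alpha> (ccw k) + corner_angle \<alpha> (ccw (ccw k)) = pi"
  using sum_opposite_pairs[of k \<alpha>] generalized unfolding generalized_angle_structure_def by simp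

lemma pi_flag_cases:
  assumes "k \<in> flags"
  obtains "k \<in> pi_flags" | "ccw k \<in> pi_flags" | "ccw (ccw k) \<in> pi_flags"
  using angle_sum[OF assms] assms angle_zero_iff pi_neq_zero
  by (metis add.right_neutral ccw_flag)

lemma ccw_not_pi:
  assumes "x \<in> pi_flags"
  shows "ccw x \<notin> pi_flags" "ccw (ccw x) \<notin> pi_flags"
proof -
  have x: "x \<in> flags" "corner_angle \<alpha> x = pi" using assms by (auto simp: pi_flags_def)
  have "corner_angle \<alpha> (ccw x) + corner_angle \<alpha> (ccw (ccw x)) = 0" using angle_sum[OF x(1)] x(2) by simp
  moreover have "corner_angle \<alpha> (ccw x) \<ge> 0" "corner_angle \<alpha> (ccw (ccw x)) \<ge> 0"
    using corner_angle_0_or_pi[of "ccw x"] corner_angle_0_or_pi[of "ccw (ccw x)"] x by auto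
  ultimately have "corner_angle \<alpha> (ccw x) = 0" "corner_angle \<alpha> (ccw (ccw x)) = 0" by linarith+
  then show "ccw x \<notin> pi_flags" "ccw (ccw x) \<notin> pi_flags" by (auto simp: pi_flags_def)
qed

lemma pi_flag_unique:
  assumes "x \<in> pi_flags" "y \<in> pi_flags" "tri x = tri y"
  shows "x = y"
  using assms ccw_not_pi tri_eq_iff[of y x] pi_flagD by blast

lemma pi_flag_rev [simp]: "k \<in> flags \<Longrightarrow> rev_flag k \<in> pi_flags \<longleftrightarrow> k \<in> pi_flags"
  and pi_flag_opp [simp]: "k \<in> flags \<Longrightarrow> opp_flag k \<in> pi_flags \<longleftrightarrow> k \<in> pi_flags"
  by (simp_all add: pi_flags_def)

lemma points_out_flip:
  assumes "s \<in> flags"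
  shows "points_out (flip G s) \<longleftrightarrow> \<not> points_out s"
proof -
  obtain t v w where s: "s = (t, v, w)" by (cases s) auto
  obtain t' \<sigma> where g: "G t w = (t', \<sigma>)" by fastforce
  have "out t' (\<sigma> w) \<longleftrightarrow> \<not> out t w" using transverse g unfolding transverse_taut_def by blast
  then show ?thesis using flip_eq[OF g] s by (simp add: points_out_def)
qed

text \<open>
  The pair of \<open>pi\<close>-edges of a tetrahedron consists of its bottom edge, shared by the
  two faces pointing inward, and its top edge. The faces opposite to the ends of the bottom edge
  are the outward ones, so for a \<open>pi\<close>-corner \<open>x\<close> the value
  \<open>points_out x\<close> says that \<open>x\<close> lies on the bottom edge.
\<close>

lemma points_out_pi:
  assumes "x \<in> pi_flags"
  shows "points_out (ccw x) \<longleftrightarrow> \<not> points_out x" "points_out (ccw (ccw x)) \<longleftrightarrow> \<not> points_out x"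
    "points_out (rev_flag x) \<longleftrightarrow> points_out x" "points_out (opp_flag x) \<longleftrightarrow> \<not> points_out x"
proof -
  note xf = pi_flagD[OF assms]
  obtain t v w a b where k: "x = (t, v, w)" "v \<noteq> w" "ccw_next v w = a" "ccw_next v a = b"
    using xf by (rule flag_cases)
  note tab = tetrahedron_table[OF k(2,3,4)]
  have c: "- {v, w} = {a, b}" using tab(13-18) k(2) by blast
  obtain e where e: "card e = 2" "edge_angle \<alpha> t e = pi" "\<forall>a\<in>-e. \<not> out t a" "\<forall>a\<in>e. out t a"
    using transverse unfolding transverse_taut_def by blast
  obtain p q where pq: "e = {p, q}" "p \<noteq> q" using e(1) by (meson card_2_iff)
  have "(t, p, q) \<in> pi_flags" using e(2) pq by (simp add: pi_flags_def flags_def)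
  moreover have "opposite_pair (t, p, q) \<in> opposite_pairs" using pq by (intro opposite_pair_mem flagI)
  moreover have fx: "fst x = t" "fst (ccw x) = t" "fst (ccw (ccw x)) = t"
    using xf k(1) by (simp_all add: opposite_pair_ops)
  moreover have "\<alpha> t (opposite_pair (ccw x)) \<noteq> pi" "\<alpha> t (opposite_pair (ccw (ccw x))) \<noteq> pi"
    using ccw_not_pi[OF assms] xf fx by (simp_all add: pi_flags_def corner_angle_eq)
  moreover have "\<alpha> t (opposite_pair (t, p, q)) = pi"
    using e(2) pq by (simp add: edge_angle_def)
  ultimately have "opposite_pair (t, p, q) = opposite_pair x"
    using opposite_pairs_eq(1)[OF xf] by (metis insertE singletonD)
  then have "e = {v, w} \<or> e = - {v, w}" using pq k(1) by (simp add: doubleton_eq_iff) blast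
  then have ov: "out t v = out t w" "out t a = (\<not> out t w)" "out t b = (\<not> out t w)"
    using e(3,4) c by auto
  show "points_out (ccw x) \<longleftrightarrow> \<not> points_out x" "points_out (ccw (ccw x)) \<longleftrightarrow> \<not> points_out x"
    "points_out (rev_flag x) \<longleftrightarrow> points_out x" "points_out (opp_flag x) \<longleftrightarrow> \<not> points_out x"
    using ov k(1) tab(1,2) by (simp_all add: points_out_def)
qed

lemma red_cong: "bd_vertex G j = bd_vertex G k \<Longrightarrow> red j \<longleftrightarrow> red k"
  by (simp add: red_def right_veering_def)

lemma left_or_red: "k \<in> flags \<Longrightarrow> left_veering G \<alpha> k \<or> red k"
  using veering unfolding veering_def red_def by blast

lemma left_zero: "left_veering G \<alpha> k \<Longrightarrow> j \<in> bd_vertex G k \<Longrightarrow> j \<in> flags \<Longrightarrow> j \<notin> pi_flags \<Longrightarrow> ccw (ccw j) \<in> pi_flags"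
  unfolding left_veering_def by (auto simp: angle_zero_iff pi_flags_def)

lemma red_zero: "red k \<Longrightarrow> j \<in> bd_vertex G k \<Longrightarrow> j \<in> flags \<Longrightarrow> j \<notin> pi_flags \<Longrightarrow> ccw j \<in> pi_flags"
  unfolding red_def right_veering_def by (auto simp: angle_zero_iff pi_flags_def)

lemma red_before_pi:
  assumes "x \<in> pi_flags"
  shows "red (ccw (ccw x))"
proof -
  note x = pi_flagD[OF assms]
  have "\<not> left_veering G \<alpha> (ccw (ccw x))"
    using left_zero[of "ccw (ccw x)" "ccw (ccw x)"] ccw_not_pi[OF assms] x by auto
  then show ?thesis using left_or_red[of "ccw (ccw x)"] x by simp
qed

lemma blue_after_pi:
  assumes "x \<in> pi_flags"
  shows "\<not> red (ccw x)"
  using red_zero[of "ccw x" "ccw x"] ccw_not_pi[OF assms] pi_flagD[OF assms] by auto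

text \<open>
  If two adjacent corners at a vertex had angle \<open>pi\<close>, then the other end of the side
  between them would come immediately before \<open>pi\<close> in one triangle and immediately
  after it in the other, so it would be both red and blue.
\<close>

lemma rot_pi:
  assumes "x \<in> pi_flags"
  shows "rot x \<notin> pi_flags"
proof
  assume r: "rot x \<in> pi_flags"
  note x = pi_flagD[OF assms]
  have "bd_vertex G (ccw (rot x)) = bd_vertex G (ccw (ccw x))"
    using bd_vertex_flip_ccw_ccw[of "ccw x"] x by (simp add: rot_def)
  then show False using red_cong red_before_pi[OF assms] blue_after_pi[OF r] by blast
qed

lemma ex_zero_corner:
  assumes "k \<in> flags"
  obtains j where "j \<in> bd_vertex G k" "j \<in> flags" "j \<notin> pi_flags"
  using assms rot_pi[of k] rot_in_bd_vertex[of k k] by (metis rot_flag self_in_bd_vertex)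

lemma left_iff_not_red:
  assumes k: "k \<in> flags"
  shows "left_veering G \<alpha> k \<longleftrightarrow> \<not> red k"
proof -
  obtain j where j: "j \<in> bd_vertex G k" "j \<in> flags" "j \<notin> pi_flags"
    using ex_zero_corner[OF k] .
  have "\<not> (left_veering G \<alpha> k \<and> red k)"
    using left_zero[OF _ j] red_zero[OF _ j] ccw_not_pi(1)[of "ccw j"] j(2) by auto
  then show ?thesis using left_or_red[OF k] by blast
qed

lemma red_zero_iff:
  assumes j: "j \<in> flags" "j \<notin> pi_flags"
  shows "red j \<longleftrightarrow> ccw j \<in> pi_flags"
proof
  assume "ccw j \<in> pi_flags"
  then show "red j" using red_before_pi[of "ccw j"] j by simp
next
  assume "red j"
  then show "ccw j \<in> pi_flags" using red_zero[of j j] j by simp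
qed

text \<open>
  The two ends of an edge veer in the same direction because the pairs of opposite edges have the
  same cyclic order at both ends of a tetrahedron's edge.
\<close>

lemma red_rev [simp]:
  assumes k: "k \<in> flags"
  shows "red (rev_flag k) \<longleftrightarrow> red k"
proof -
  obtain j where j: "j \<in> bd_vertex G k" "j \<in> flags" "j \<notin> pi_flags"
    using ex_zero_corner[OF k] .
  have "rev_flag j \<in> bd_vertex G (rev_flag k)" using rev_in_bd_vertex[OF k j(1)] .
  then have "red (rev_flag k) \<longleftrightarrow> red (rev_flag j)" by (intro red_cong) (metis bd_vertex_eq_iff)
  also have "\<dots> \<longleftrightarrow> red j" using j by (simp add: red_zero_iff ccw_rev)
  also have "\<dots> \<longleftrightarrow> red k" using j(1) by (intro red_cong) (metis bd_vertex_eq_iff)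
  finally show ?thesis .
qed

lemma red_opp_zero:
  assumes j: "j \<in> flags" "j \<notin> pi_flags"
  shows "red (opp_flag j) \<longleftrightarrow> red j"
  using j by (simp add: red_zero_iff ccw_opp)

section \<open>Rungs and ladderpole edges of a triangle\<close>

text \<open>
  A triangle is represented by its \<open>pi\<close>-corner \<open>x\<close>. The corners after
  and before \<open>x\<close> are blue and red, so the colour of \<open>x\<close> decides which
  side is the ladderpole edge. One of the two rungs is the side \<open>x\<close> opposite to the
  \<open>pi\<close>-corner, and \<open>rung x\<close> is the other one.
\<close>

definition pole :: "'t flag \<Rightarrow> 't flag" where
  "pole x = (if red x then ccw x else ccw (ccw x))"

definition rung :: "'t flag \<Rightarrow> 't flag" where
  "rung x = (if red x then ccw (ccw x) else ccw x)"

text \<open>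
  Counterclockwise, the side \<open>x\<close> leads from blue to red and \<open>rung x\<close>
  from red to blue (\<open>side_kinds\<close>). Since gluing reverses the direction of a side,
  \<open>rung x\<close> is glued to the side opposite to the \<open>pi\<close>-corner of the next
  triangle, which as a flag is that corner itself.
\<close>

definition advance :: "'t flag \<Rightarrow> 't flag" where
  "advance x = flip G (rung x)"

text \<open>
  The \<open>pi\<close>-corner of the triangle on the other side of the ladderpole edge. It has
  the same colour, but lies at the other end of this edge, on a top edge instead of a bottom edge
  or conversely.
\<close>

definition cross :: "'t flag \<Rightarrow> 't flag" where
  "cross x = (if red x then ccw (ccw (flip G (ccw x))) else ccw (flip G (ccw (ccw x))))"

lemma pole_flag [simp]: "x \<in> flags \<Longrightarrow> pole x \<in> flags"
  and rung_flag [simp]: "x \<in> flags \<Longrightarrow> rung x \<in> flags"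
  and tri_pole [simp]: "x \<in> flags \<Longrightarrow> tri (pole x) = tri x"
  and tri_rung [simp]: "x \<in> flags \<Longrightarrow> tri (rung x) = tri x"
  and advance_flag [simp]: "x \<in> flags \<Longrightarrow> advance x \<in> flags"
  and cross_flag [simp]: "x \<in> flags \<Longrightarrow> cross x \<in> flags"
  by (simp_all add: pole_def rung_def advance_def cross_def)

lemma side_kinds:
  assumes x: "x \<in> pi_flags"
  shows "\<not> red (ccw x)" "red (ccw (ccw x))"
    "red (ccw (rung x))" "\<not> red (ccw (ccw (rung x)))"
    "red (ccw (pole x)) = red x" "red (ccw (ccw (pole x))) = red x"
  using red_before_pi[OF x] blue_after_pi[OF x] pi_flagD[OF x] by (auto simp: rung_def pole_def)

lemma side_cases:
  assumes x: "x \<in> pi_flags" and s: "s \<in> flags" "tri s = tri x"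
  obtains "s = x" | "s = rung x" | "s = pole x"
  using tri_eq_iff[of x s] s pi_flagD[OF x] unfolding rung_def pole_def by metis

lemma ex_pi_flag:
  assumes "s \<in> flags"
  obtains x where "x \<in> pi_flags" "tri x = tri s"
  using pi_flag_cases[OF assms] assms tri_ccw by (metis ccw_flag)

lemma flip_ends:
  assumes "s \<in> flags"
  shows "red (ccw (flip G s)) = red (ccw (ccw s))" "red (ccw (ccw (flip G s))) = red (ccw s)"
  using assms by (auto intro!: red_cong simp: bd_vertex_flip_ccw bd_vertex_flip_ccw_ccw)

lemma advance_pi [simp]:
  assumes x: "x \<in> pi_flags"
  shows "advance x \<in> pi_flags"
proof -
  note xf = pi_flagD[OF x]
  have "advance x \<in> flags" using xf by simp
  then obtain y where y: "y \<in> pi_flags" "tri y = tri (advance x)" using ex_pi_flag by blast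
  have e: "\<not> red (ccw (advance x))" "red (ccw (ccw (advance x)))"
    using side_kinds[OF x] xf by (simp_all add: advance_def flip_ends)
  have "advance x = y"
    using side_cases[OF y(1) \<open>advance x \<in> flags\<close> y(2)[symmetric]] side_kinds[OF y(1)] e by metis
  then show ?thesis using y by simp
qed

lemma flip_pole:
  assumes x: "x \<in> pi_flags"
  obtains y where "y \<in> pi_flags" "pole y = flip G (pole x)" "red y = red x" "points_out y = (\<not> points_out x)"
proof -
  note xf = pi_flagD[OF x]
  have sf: "flip G (pole x) \<in> flags" using xf by simp
  then obtain y where y: "y \<in> pi_flags" "tri y = tri (flip G (pole x))" using ex_pi_flag by blast
  have e: "red (ccw (flip G (pole x))) = red x" "red (ccw (ccw (flip G (pole x)))) = red x"
    using side_kinds[OF x] xf by (simp_all add: flip_ends)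
  have p: "flip G (pole x) = pole y"
    using side_cases[OF y(1) sf y(2)[symmetric]] side_kinds[OF y(1)] e by metis
  have r: "red y = red x" using e p side_kinds[OF y(1)] by simp
  have "points_out y = (\<not> points_out (pole y))" using points_out_pi[OF y(1)] by (simp add: pole_def)
  also have "\<dots> = points_out (pole x)" unfolding p[symmetric] using xf by (simp add: points_out_flip)
  also have "\<dots> = (\<not> points_out x)" using points_out_pi[OF x] by (simp add: pole_def)
  finally show ?thesis using that y(1) p r by metis
qed

lemma cross_props:
  assumes x: "x \<in> pi_flags"
  shows "cross x \<in> pi_flags" "pole (cross x) = flip G (pole x)" "red (cross x) = red x"
    "points_out (cross x) = (\<not> points_out x)"
proof -
  obtain y where y: "y \<in> pi_flags" "pole y = flip G (pole x)" "red y = red x" "points_out y = (\<not> points_out x)"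
    using flip_pole[OF x] .
  have "cross x = y" using y(2,3) pi_flagD[OF y(1)] by (auto simp: cross_def pole_def) (metis ccw_ccw_ccw)+
  then show "cross x \<in> pi_flags" "pole (cross x) = flip G (pole x)" "red (cross x) = red x"
    "points_out (cross x) = (\<not> points_out x)" using y by auto
qed

lemma pole_inj: "x \<in> pi_flags \<Longrightarrow> y \<in> pi_flags \<Longrightarrow> pole x = pole y \<Longrightarrow> x = y"
  using pi_flag_unique[of x y] pi_flagD tri_pole by metis

lemma rung_inj: "x \<in> pi_flags \<Longrightarrow> y \<in> pi_flags \<Longrightarrow> rung x = rung y \<Longrightarrow> x = y"
  using pi_flag_unique[of x y] pi_flagD tri_rung by metis

lemma cross_cross [simp]:
  assumes x: "x \<in> pi_flags"
  shows "cross (cross x) = x"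
  using cross_props[OF x] cross_props[of "cross x"] pole_inj[of "cross (cross x)" x] x pi_flagD[OF x]
  by simp

lemma points_out_advance [simp]: "x \<in> pi_flags \<Longrightarrow> points_out (advance x) = points_out x"
  using points_out_pi[of x] pi_flagD[of x] by (simp add: advance_def points_out_flip rung_def)

lemma advance_inj: "x \<in> pi_flags \<Longrightarrow> y \<in> pi_flags \<Longrightarrow> advance x = advance y \<longleftrightarrow> x = y"
  using rung_inj[of x y] unfolding advance_def by (metis flip_flip pi_flagD rung_flag)

lemma finite_flags [simp]: "finite (A :: 't flag set)"
  by (rule finite)

lemma bij_advance: "bij_betw advance pi_flags pi_flags"
proof -
  have "inj_on advance pi_flags" using advance_inj by (auto intro!: inj_onI)
  moreover have "advance ` pi_flags \<subseteq> pi_flags" by auto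
  ultimately show ?thesis by (simp add: bij_betw_def endo_inj_surj)
qed

text \<open>
  The end of the ladderpole edge at which the \<open>pi\<close>-corner \<open>x\<close> does not
  lie.
\<close>

definition far_end :: "'t flag \<Rightarrow> 't flag" where
  "far_end x = (if red x then ccw (ccw x) else ccw x)"

lemma far_end_flag [simp]: "x \<in> flags \<Longrightarrow> far_end x \<in> flags"
  by (simp add: far_end_def)

lemma bd_vertex_cross: "x \<in> pi_flags \<Longrightarrow> bd_vertex G (cross x) = bd_vertex G (far_end x)"
  using bd_vertex_flip_ccw_ccw[of "ccw x"] bd_vertex_flip_ccw[of "ccw (ccw x)"] pi_flagD[of x]
  by (simp add: cross_def far_end_def)

lemma bd_vertex_far_end_cross: "x \<in> pi_flags \<Longrightarrow> bd_vertex G (far_end (cross x)) = bd_vertex G x"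
  using bd_vertex_cross[of "cross x"] cross_props(1)[of x] by simp

text \<open>
  Turning around a vertex, one always crosses the faces in the same transverse direction, except
  that this direction changes at every corner with angle \<open>pi\<close>.
\<close>

lemma incoming_rot:
  assumes j: "j \<in> flags"
  shows "points_out (ccw (ccw (rot j))) \<longleftrightarrow> (if j \<in> pi_flags then points_out j else points_out (ccw (ccw j)))"
proof -
  have *: "points_out (ccw (ccw (rot j))) \<longleftrightarrow> \<not> points_out (ccw j)" using j by (simp add: rot_ccw_ccw points_out_flip)
  show ?thesis
  proof (cases "j \<in> pi_flags")
    case True
    then show ?thesis using * points_out_pi[OF True] by simp
  next
    case False
    then consider "ccw j \<in> pi_flags" | "ccw (ccw j) \<in> pi_flags" using pi_flag_cases[OF j] by metis
    then show ?thesis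
      using * False points_out_pi[of "ccw j"] points_out_pi[of "ccw (ccw j)"] j by cases auto
  qed
qed

text \<open>
  By \<open>incoming_rot\<close>, corners on bottom edges and corners on top edges alternate among
  the \<open>pi\<close>-corners of a vertex, and there are two of these since the angles add up to
  \<open>2 * pi\<close>.
\<close>

lemma vertex_pi_flags:
  assumes k: "k \<in> flags"
  shows "card {x \<in> bd_vertex G k. x \<in> pi_flags \<and> points_out x} = 1"
    "card {x \<in> bd_vertex G k. x \<in> pi_flags \<and> \<not> points_out x} = 1"
proof -
  let ?B = "bd_vertex G k"
  define b :: "'t flag \<Rightarrow> int" where "b j = of_bool (points_out (ccw (ccw j)))" for j
  have fin: "finite ?B" by simp
  \<comment> \<open>The changes of direction, counted with sign, have sum 0 on going once around the vertex.\<close>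
  have "0 = (\<Sum>j\<in>?B. b (rot j)) - (\<Sum>j\<in>?B. b j)"
    using sum_bd_vertex_rot[OF k, of b] by simp
  also have "\<dots> = (\<Sum>j\<in>?B. b (rot j) - b j)" by (simp add: sum_subtractf)
  also have "\<dots> = (\<Sum>j\<in>?B. of_bool (j \<in> pi_flags \<and> points_out j) - of_bool (j \<in> pi_flags \<and> \<not> points_out j))"
  proof (rule sum.cong)
    fix j assume "j \<in> ?B"
    then have j: "j \<in> flags" using bd_vertex_flag[OF k] by simp
    show "b (rot j) - b j = of_bool (j \<in> pi_flags \<and> points_out j) - of_bool (j \<in> pi_flags \<and> \<not> points_out j)"
      using incoming_rot[OF j] points_out_pi[of j] by (auto simp: b_def)
  qed simp
  also have "\<dots> = int (card {x \<in> ?B. x \<in> pi_flags \<and> points_out x}) - int (card {x \<in> ?B. x \<in> pi_flags \<and> \<not> points_out x})"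
    using fin by (simp add: sum_subtractf sum.If_cases of_bool_def Int_def)
  finally have eq: "card {x \<in> ?B. x \<in> pi_flags \<and> points_out x} = card {x \<in> ?B. x \<in> pi_flags \<and> \<not> points_out x}" by simp
  have "(\<Sum>j\<in>?B. corner_angle \<alpha> j) = 2 * pi"
  proof -
    obtain t v w where kk: "k = (t, v, w)" "v \<noteq> w" using k by (cases k) (auto simp: flags_def)
    then have "card {v, w} = 2" "flag_edge k = (t, {v, w})" by (auto simp: flag_edge_def)
    then show ?thesis
      using generalized sum_edge_class[OF k, of \<alpha>] unfolding generalized_angle_structure_def by metis
  qed
  also have "(\<Sum>j\<in>?B. corner_angle \<alpha> j) = (\<Sum>j\<in>?B. if j \<in> pi_flags then pi else 0)"
    using bd_vertex_flag[OF k] angle_zero_iff by (intro sum.cong) (auto simp: pi_flags_def simp del: corner_angle.simps)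
  also have "\<dots> = pi * card {x \<in> ?B. x \<in> pi_flags}"
    using fin by (simp add: sum.If_cases Int_def)
  finally have "card {x \<in> ?B. x \<in> pi_flags} = 2" by simp
  moreover have "{x \<in> ?B. x \<in> pi_flags} = {x \<in> ?B. x \<in> pi_flags \<and> points_out x} \<union> {x \<in> ?B. x \<in> pi_flags \<and> \<not> points_out x}"
    by blast
  moreover have "card ({x \<in> ?B. x \<in> pi_flags \<and> points_out x} \<union> {x \<in> ?B. x \<in> pi_flags \<and> \<not> points_out x})
      = card {x \<in> ?B. x \<in> pi_flags \<and> points_out x} + card {x \<in> ?B. x \<in> pi_flags \<and> \<not> points_out x}"
    by (rule card_Un_disjoint) auto
  ultimately show "card {x \<in> ?B. x \<in> pi_flags \<and> points_out x} = 1" "card {x \<in> ?B. x \<in> pi_flags \<and> \<not> points_out x} = 1"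
    using eq by auto
qed

lemma vertex_pi_flag_unique:
  assumes "x \<in> pi_flags" "y \<in> pi_flags" "bd_vertex G x = bd_vertex G y" "points_out x = points_out y"
  shows "x = y"
proof -
  note x = pi_flagD[OF assms(1)]
  have "y \<in> bd_vertex G x" using assms(3) bd_vertex_eq_iff by blast
  define S where "S = {z \<in> bd_vertex G x. z \<in> pi_flags \<and> points_out z = points_out x}"
  have "x \<in> S" "y \<in> S" using assms(1,2,4) \<open>y \<in> bd_vertex G x\<close> by (simp_all add: S_def)
  moreover have "card S = 1"
    using vertex_pi_flags[OF x] unfolding S_def by (cases "points_out x") simp_all
  then obtain z where "S = {z}" by (rule card_1_singletonE)
  ultimately show ?thesis by simp
qed

lemma vertex_has_pi_flag:
  assumes "k \<in> flags"
  obtains x where "x \<in> bd_vertex G k" "x \<in> pi_flags"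
proof -
  have "{x \<in> bd_vertex G k. x \<in> pi_flags \<and> points_out x} \<noteq> {}"
    using vertex_pi_flags(1)[OF assms] by (metis card.empty zero_neq_one)
  then show ?thesis using that by blast
qed

end

context veering_triangulation
begin

section \<open>Ladders\<close>

definition ladder :: "'t flag \<Rightarrow> 't flag set" where
  "ladder x = range (\<lambda>n. (advance ^^ n) x)"

lemma advance_pow_pi [simp]: "x \<in> pi_flags \<Longrightarrow> (advance ^^ n) x \<in> pi_flags"
  by (induction n) auto

lemma ladder_pi: "x \<in> pi_flags \<Longrightarrow> y \<in> ladder x \<Longrightarrow> y \<in> pi_flags"
  by (auto simp: ladder_def)

lemma self_in_ladder [simp]: "x \<in> ladder x"
  unfolding ladder_def by (rule range_eqI[of _ _ 0]) simp

lemma advance_pow_in_ladder [simp]: "(advance ^^ n) x \<in> ladder x"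
  by (simp add: ladder_def)

lemma ladder_advance: "y \<in> ladder x \<Longrightarrow> advance y \<in> ladder x"
  unfolding ladder_def by (auto intro: range_eqI[of _ _ "Suc n" for n])

lemma advance_periodic:
  assumes "x \<in> pi_flags"
  shows "\<exists>n>0. (advance ^^ n) x = x"
  using ex_period[OF bij_betw_imp_inj_on[OF bij_advance]
      equalityD1[OF bij_betw_imp_surj_on[OF bij_advance]] finite_flags assms] .

lemma ladder_sym:
  assumes x: "x \<in> pi_flags" and y: "y \<in> ladder x"
  shows "x \<in> ladder y"
proof -
  obtain n where n: "y = (advance ^^ n) x" using y by (auto simp: ladder_def)
  obtain p where p: "p > 0" "(advance ^^ p) x = x" using advance_periodic[OF x] by blast
  have "(advance ^^ (p * m)) x = x" for m
    by (induction m) (simp_all add: funpow_add p)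
  then have "(advance ^^ (p * n - n + n)) x = x" using p by (metis add.commute le_add_diff_inverse2 mult_le_mono1 nat_mult_1 One_nat_def Suc_leI)
  then have "(advance ^^ (p * n - n)) y = x" using n by (simp add: funpow_add)
  then show ?thesis by (metis advance_pow_in_ladder)
qed

lemma ladder_mono: "y \<in> ladder x \<Longrightarrow> ladder y \<subseteq> ladder x"
  unfolding ladder_def by (auto simp flip: funpow_add comp_apply[of "advance ^^ m" for m]) 

lemma ladder_eq:
  assumes "x \<in> pi_flags" "y \<in> ladder x"
  shows "ladder y = ladder x"
  using ladder_mono[OF assms(2)] ladder_mono[OF ladder_sym[OF assms]] by blast

lemma ladder_eq_advance [simp]: "x \<in> pi_flags \<Longrightarrow> ladder (advance x) = ladder x"
  using ladder_eq ladder_advance self_in_ladder by blast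

lemma ladder_induct [consumes 2, case_names self advance]:
  assumes "x \<in> pi_flags" "y \<in> ladder x" "P x" "\<And>z. z \<in> ladder x \<Longrightarrow> P z \<Longrightarrow> P (advance z)"
  shows "P y"
proof -
  have "P ((advance ^^ n) x)" for n by (induction n) (use assms in auto)
  then show ?thesis using assms(2) by (auto simp: ladder_def)
qed

lemma ladder_backward_induct [consumes 2, case_names self retreat]:
  assumes x: "x \<in> pi_flags" "y \<in> ladder x" and P: "P x" "\<And>z. z \<in> ladder x \<Longrightarrow> P (advance z) \<Longrightarrow> P z"
  shows "P y"
proof -
  have *: "P z" if "z \<in> ladder x" "P ((advance ^^ n) z)" for n z
    using that
  proof (induction n arbitrary: z)
    case (Suc n)
    have "P ((advance ^^ n) (advance z))" using Suc(3) by (simp add: funpow_swap1)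
    then have "P (advance z)" using Suc(1)[OF ladder_advance[OF Suc(2)]] by blast
    then show ?case using P(2)[OF Suc(2)] by blast
  qed simp
  obtain n where "x = (advance ^^ n) y" using ladder_sym[OF x] by (auto simp: ladder_def)
  then show ?thesis using *[OF x(2), of n] P(1) by metis
qed

lemma points_out_ladder:
  assumes "x \<in> pi_flags" "y \<in> ladder x"
  shows "points_out y = points_out x"
  using assms
proof (induction rule: ladder_induct)
  case (advance z)
  then show ?case using points_out_advance[of z] ladder_pi[of x z] \<open>x \<in> pi_flags\<close> by simp
qed simp

lemma bij_advance_ladder:
  assumes "x \<in> pi_flags"
  shows "bij_betw advance (ladder x) (ladder x)"
proof -
  have "inj_on advance (ladder x)"
    using advance_inj ladder_pi[OF assms] by (auto intro!: inj_onI)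
  moreover have "advance ` ladder x \<subseteq> ladder x" using ladder_advance by blast
  ultimately show ?thesis by (simp add: bij_betw_def endo_inj_surj)
qed

text \<open>
  While a ladder passes triangles with their ladderpole edges on one side, it turns around their
  common vertex on the other side: for red \<open>pi\<close>-corners this vertex is the blue
  corner after them, and for blue ones it is the red corner before them.
\<close>

lemma rot_ccw_red:
  assumes "w \<in> pi_flags" "red w"
  shows "rot (ccw w) = ccw (advance w)"
  using assms pi_flagD[of w] by (simp add: rot_def advance_def rung_def)

lemma rot_ccw_blue:
  assumes "w \<in> pi_flags" "\<not> red w"
  shows "rot (ccw (ccw (advance w))) = ccw (ccw w)"
  using assms pi_flagD[of w] by (simp add: rot_def advance_def rung_def)

text \<open>
  Otherwise the ladder would turn around a single vertex all of whose corners have angle 0.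
\<close>

lemma ladder_has_blue:
  assumes x: "x \<in> pi_flags"
  shows "\<exists>y\<in>ladder x. \<not> red y"
proof (rule ccontr)
  assume "\<not> ?thesis"
  then have r: "red y" if "y \<in> ladder x" for y using that by blast
  note xf = pi_flagD[OF x]
  have "(rot ^^ n) (ccw x) = ccw ((advance ^^ n) x)" for n
    by (induction n) (simp_all add: rot_ccw_red x r)
  then have "j \<notin> pi_flags" if jb: "j \<in> bd_vertex G (ccw x)" for j
  proof -
    obtain n where "j = (rot ^^ n) (ccw x)" using jb xf by (auto simp: bd_vertex_eq_rot_orbit)
    then have "j = ccw ((advance ^^ n) x)" using \<open>\<And>n. (rot ^^ n) (ccw x) = ccw ((advance ^^ n) x)\<close> by simp
    then show ?thesis using ccw_not_pi(1)[OF advance_pow_pi[OF x]] by simp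
  qed
  then show False using vertex_has_pi_flag[of "ccw x"] xf by (metis ccw_flag)
qed

lemma ladder_has_red:
  assumes x: "x \<in> pi_flags"
  shows "\<exists>y\<in>ladder x. red y"
proof (rule ccontr)
  assume "\<not> ?thesis"
  then have r: "\<not> red y" if "y \<in> ladder x" for y using that by blast
  note xf = pi_flagD[OF x]
  have "(rot ^^ n) (ccw (ccw x)) \<in> (\<lambda>y. ccw (ccw y)) ` ladder x" for n
  proof (induction n)
    case (Suc n)
    then obtain y where y: "y \<in> ladder x" "(rot ^^ n) (ccw (ccw x)) = ccw (ccw y)" by blast
    obtain w where w: "w \<in> ladder x" "y = advance w"
      using y(1) bij_betw_imp_surj_on[OF bij_advance_ladder[OF x]] by blast
    have "(rot ^^ Suc n) (ccw (ccw x)) = ccw (ccw w)"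
      using y w rot_ccw_blue[of w] ladder_pi[OF x] r by simp
    then show ?case using w by blast
  qed simp
  then have "j \<notin> pi_flags" if jb: "j \<in> bd_vertex G (ccw (ccw x))" for j
  proof -
    obtain n where "j = (rot ^^ n) (ccw (ccw x))" using jb xf by (auto simp: bd_vertex_eq_rot_orbit)
    then have "j \<in> (\<lambda>y. ccw (ccw y)) ` ladder x"
      using \<open>\<And>n. (rot ^^ n) (ccw (ccw x)) \<in> (\<lambda>y. ccw (ccw y)) ` ladder x\<close> by blast
    then obtain y where "j = ccw (ccw y)" "y \<in> ladder x" by (rule imageE)
    then show ?thesis using ccw_not_pi(2) ladder_pi[OF x] by blast
  qed
  then show False using vertex_has_pi_flag[of "ccw (ccw x)"] xf by (metis ccw_flag)
qed

text \<open>
  The edges on one side of a ladder belong to the \<open>pi\<close>-corners of one colour. The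
  next one of them along the ladder is \<open>pole_succ x\<close>.
\<close>

definition pole_succ_steps :: "'t flag \<Rightarrow> nat" where
  "pole_succ_steps x = (LEAST n. n > 0 \<and> red ((advance ^^ n) x) = red x)"

definition pole_succ :: "'t flag \<Rightarrow> 't flag" where
  "pole_succ x = (advance ^^ pole_succ_steps x) x"

lemma pole_succ_steps:
  assumes "x \<in> pi_flags"
  shows "pole_succ_steps x > 0" "red (pole_succ x) = red x"
    "\<And>n. 0 < n \<Longrightarrow> n < pole_succ_steps x \<Longrightarrow> red ((advance ^^ n) x) = (\<not> red x)"
proof -
  have "\<exists>n. n > 0 \<and> red ((advance ^^ n) x) = red x" using advance_periodic[OF assms] by metis
  from LeastI_ex[OF this] show "pole_succ_steps x > 0" "red (pole_succ x) = red x"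
    unfolding pole_succ_def pole_succ_steps_def by blast+
  show "\<And>n. 0 < n \<Longrightarrow> n < pole_succ_steps x \<Longrightarrow> red ((advance ^^ n) x) = (\<not> red x)"
    using not_less_Least unfolding pole_succ_steps_def by blast
qed

text \<open>
  Between \<open>x\<close> and \<open>pole_succ x\<close> the ladder turns around the vertex of
  \<open>x\<close>, so the edge of \<open>pole_succ x\<close> has its far end there: it is
  adjacent to the edge of \<open>x\<close> in the same ladderpole.
\<close>

lemma pole_succ_props:
  assumes x: "x \<in> pi_flags"
  shows "pole_succ x \<in> pi_flags" "pole_succ x \<in> ladder x" "points_out (pole_succ x) = points_out x" "red (pole_succ x) = red x"
    "bd_vertex G (far_end (pole_succ x)) = bd_vertex G x"
proof -
  note xf = pi_flagD[OF x]
  show n: "pole_succ x \<in> pi_flags" "pole_succ x \<in> ladder x" using x by (simp_all add: pole_succ_def)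
  show "points_out (pole_succ x) = points_out x" using points_out_ladder[OF x n(2)] .
  show c: "red (pole_succ x) = red x" using pole_succ_steps[OF x] by simp
  show "bd_vertex G (far_end (pole_succ x)) = bd_vertex G x"
  proof (cases "red x")
    case True
    have "bd_vertex G (ccw (ccw ((advance ^^ n) x))) = bd_vertex G x" if "0 < n" "n \<le> pole_succ_steps x" for n
      using that
    proof (induction n)
      case (Suc n)
      let ?w = "(advance ^^ n) x"
      have w: "?w \<in> pi_flags" "?w \<in> flags" using x pi_flagD by simp_all
      show ?case
      proof (cases "n = 0")
        case True
        have "rot (ccw (ccw (advance x))) = x"
          using \<open>red x\<close> xf by (simp add: rot_def advance_def rung_def)
        then show ?thesis using True bd_vertex_rot[of "ccw (ccw (advance x))"] xf by simp
      next
        case False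
        then have "\<not> red ?w" using pole_succ_steps(3)[OF x, of n] Suc.prems \<open>red x\<close> by simp
        from rot_ccw_blue[OF w(1) this] 
        have "bd_vertex G (ccw (ccw (advance ?w))) = bd_vertex G (ccw (ccw ?w))"
          using bd_vertex_rot[of "ccw (ccw (advance ?w))"] w by simp
        then show ?thesis using Suc False by simp
      qed
    qed simp
    from this[of "pole_succ_steps x"] show ?thesis using pole_succ_steps(1)[OF x] c True by (simp add: far_end_def pole_succ_def)
  next
    case False
    have "bd_vertex G (ccw ((advance ^^ n) x)) = bd_vertex G x" if "0 < n" "n \<le> pole_succ_steps x" for n
      using that
    proof (induction n)
      case (Suc n)
      let ?w = "(advance ^^ n) x"
      have w: "?w \<in> pi_flags" "?w \<in> flags" using x pi_flagD by simp_all
      show ?case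
      proof (cases "n = 0")
        case True
        have "rot x = ccw (advance x)"
          using \<open>\<not> red x\<close> xf by (simp add: rot_def advance_def rung_def)
        then show ?thesis using True bd_vertex_rot[OF xf] by simp
      next
        case False
        then have "red ?w" using pole_succ_steps(3)[OF x, of n] Suc.prems \<open>\<not> red x\<close> by simp
        from rot_ccw_red[OF w(1) this] 
        have "bd_vertex G (ccw (advance ?w)) = bd_vertex G (ccw ?w)"
          using bd_vertex_rot[of "ccw ?w"] w by simp
        then show ?thesis using Suc False by simp
      qed
    qed simp
    from this[of "pole_succ_steps x"] show ?thesis using pole_succ_steps(1)[OF x] c False by (simp add: far_end_def pole_succ_def)
  qed
qed

lemma pole_succ_unique:
  assumes x: "x \<in> pi_flags" and y: "y \<in> pi_flags"
    and "points_out y = points_out x" "bd_vertex G (far_end y) = bd_vertex G x"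
  shows "y = pole_succ x"
proof -
  note n = pole_succ_props[OF x]
  have "cross y = cross (pole_succ x)"
    using assms n cross_props[OF y] cross_props[OF n(1)]
    by (intro vertex_pi_flag_unique) (simp_all add: bd_vertex_cross)
  then show ?thesis using cross_cross[OF y] cross_cross[OF n(1)] by metis
qed

text \<open>
  On the other side of a ladderpole its edges follow each other in the opposite order.
\<close>

lemma pole_succ_cross:
  assumes x: "x \<in> pi_flags"
  shows "pole_succ (cross (pole_succ x)) = cross x"
proof -
  note n = pole_succ_props[OF x]
  show ?thesis
    using n cross_props[OF x] cross_props[OF n(1)] x
    by (intro pole_succ_unique[symmetric]) (simp_all add: bd_vertex_cross bd_vertex_far_end_cross)
qed

lemma pole_succ_induct:
  assumes x: "x \<in> pi_flags" and y: "y \<in> ladder x" "red y = red x"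
    and P: "P x" "\<And>z. z \<in> ladder x \<Longrightarrow> red z = red x \<Longrightarrow> P z \<Longrightarrow> P (pole_succ z)"
  shows "P y"
proof -
  have "P ((advance ^^ n) z)"
    if "z \<in> ladder x" "red z = red x" "P z" "red ((advance ^^ n) z) = red x" for n z
    using that
  proof (induction n arbitrary: z rule: less_induct)
    case (less n)
    have z: "z \<in> pi_flags" using ladder_pi[OF x less(2)] .
    show ?case
    proof (cases "n = 0")
      case True
      then show ?thesis using less by simp
    next
      case False
      let ?m = "pole_succ_steps z"
      have m: "0 < ?m" "?m \<le> n"
        using pole_succ_steps[OF z] less(3,5) False by (simp, metis linorder_not_le neq0_conv)
      have e: "(advance ^^ n) z = (advance ^^ (n - ?m)) (pole_succ z)"
        using m by (simp add: pole_succ_def funpow_add[symmetric, THEN fun_cong, unfolded comp_apply])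
      have "pole_succ z \<in> ladder x" using pole_succ_props(2)[OF z] ladder_eq[OF x less(2)] by simp
      moreover have "red (pole_succ z) = red x" using pole_succ_props(4)[OF z] less(3) by simp
      moreover have "P (pole_succ z)" using P(2) less by blast
      ultimately show ?thesis using less(1)[of "n - ?m" "pole_succ z"] less(5) m e by simp
    qed
  qed
  moreover obtain n where "y = (advance ^^ n) x" using y(1) by (auto simp: ladder_def)
  ultimately show ?thesis using y(2) P(1) self_in_ladder by blast
qed

text \<open>
  The edges on one side of a ladder form a single ladderpole, so there is a single ladder on the
  other side of it.
\<close>

lemma cross_ladder:
  assumes x: "x \<in> pi_flags" and y: "y \<in> ladder x" "red y = red x"
  shows "cross y \<in> ladder (cross x)"
  using x y
proof (rule pole_succ_induct)
  show "cross x \<in> ladder (cross x)" by simp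
next
  fix z assume z: "z \<in> ladder x" "red z = red x" "cross z \<in> ladder (cross x)"
  have zp: "z \<in> pi_flags" using ladder_pi[OF x z(1)] .
  have cn: "cross (pole_succ z) \<in> pi_flags" using cross_props(1) pole_succ_props(1)[OF zp] by blast
  have "cross z \<in> ladder (cross (pole_succ z))" using pole_succ_props(2)[OF cn] pole_succ_cross[OF zp] by simp
  then have "cross (pole_succ z) \<in> ladder (cross z)" using ladder_sym[OF cn] by blast
  then show "cross (pole_succ z) \<in> ladder (cross x)" using ladder_eq[OF cross_props(1)[OF x] z(3)] by simp
qed

section \<open>The walk that turns left at hinges\<close>

text \<open>
  The \<open>pi\<close>-corner of a triangle on the right of an upward ladderpole edge is at the
  lower end, on the bottom edge of its tetrahedron, if the edge is red, and at the upper end, on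
  the top edge, if it is blue; see \<open>upward_pole\<close>.
\<close>

definition right_of_pole :: "'t flag \<Rightarrow> bool" where
  "right_of_pole x \<longleftrightarrow> red x = points_out x"

text \<open>
  The two edges of the tetrahedron with angle \<open>pi\<close> have different colours.
\<close>

definition hinge :: "'t flag \<Rightarrow> bool" where
  "hinge x \<longleftrightarrow> red (opp_flag x) \<noteq> red x"

definition turns :: "'t flag \<Rightarrow> bool" where
  "turns x \<longleftrightarrow> right_of_pole x \<and> hinge x"

text \<open>
  The face containing \<open>rung x\<close> has a third edge, not ending at this tip. In the
  tetrahedron of \<open>x\<close> this edge has angle 0 and the colour of \<open>x\<close>, while
  in the next tetrahedron it is opposite to the edge of the \<open>pi\<close>-corner
  \<open>advance x\<close>.
\<close>

lemma hinge_advance: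
  assumes x: "x \<in> pi_flags"
  shows "hinge (advance x) \<longleftrightarrow> red (advance x) \<noteq> red x"
proof -
  note xf = pi_flagD[OF x]
  let ?s = "rung x"
  have s: "?s \<in> flags" "?s \<notin> pi_flags" using xf ccw_not_pi[OF x] by (auto simp: rung_def)
  have "opp_flag (rot (rev_flag (opp_flag ?s))) = flip G ?s"
    using flip_rev_opp[of "rev_flag (opp_flag ?s)"] s(1) by (simp add: opp_rev)
  then have "opp_flag (advance x) = rot (rev_flag (opp_flag ?s))"
    unfolding advance_def using s(1) by (metis opp_in_flags opp_opp rev_in_flags rot_flag)
  then have "red (opp_flag (advance x)) = red (rev_flag (opp_flag ?s))"
    using s(1) by (intro red_cong) simp
  also have "\<dots> = red ?s" using s by (simp add: red_opp_zero)
  also have "\<dots> = red x" using side_kinds[OF x] by (simp add: rung_def)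
  finally show ?thesis unfolding hinge_def by blast
qed

text \<open>
  A ladder has ladderpole edges on both of its sides, so somewhere along it a triangle on the left
  of its pole is followed by one on the right of its pole, and \<open>hinge_advance\<close> makes
  the latter a hinge.
\<close>

lemma ladder_has_turn:
  assumes x: "x \<in> pi_flags"
  obtains y where "y \<in> ladder x" "turns y"
proof -
  obtain a where a: "a \<in> ladder x" "red a = points_out x"
    using ladder_has_red[OF x] ladder_has_blue[OF x] by metis
  obtain b where b: "b \<in> ladder x" "red b \<noteq> points_out x"
    using ladder_has_red[OF x] ladder_has_blue[OF x] by metis
  have bp: "b \<in> pi_flags" using ladder_pi[OF x b(1)] .
  have lb: "ladder b = ladder x" using ladder_eq[OF x b(1)] .
  have "\<exists>w\<in>ladder x. red w \<noteq> points_out x \<and> red (advance w) = points_out x"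
  proof (rule ccontr)
    assume no: "\<not> ?thesis"
    have "a \<in> ladder b" using a lb by simp
    with bp have "red a \<noteq> points_out x"
      by (induction rule: ladder_induct) (use b no lb in auto)
    then show False using a by simp
  qed
  then obtain w where w: "w \<in> ladder x" "red w \<noteq> points_out x" "red (advance w) = points_out x" by blast
  have wp: "w \<in> pi_flags" using ladder_pi[OF x w(1)] .
  have "turns (advance w)"
    unfolding turns_def right_of_pole_def
    using w hinge_advance[OF wp] points_out_ladder[OF x ladder_advance[OF w(1)]] by auto
  then show ?thesis using that ladder_advance[OF w(1)] by blast
qed

definition walk :: "'t flag \<Rightarrow> 't flag" where
  "walk x = (if turns x then cross x else advance x)"

lemma walk_pi [simp]: "x \<in> pi_flags \<Longrightarrow> walk x \<in> pi_flags"
  by (simp add: walk_def cross_props)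

lemma tri_cross:
  assumes "x \<in> pi_flags"
  shows "tri (cross x) = tri (flip G (pole x))"
  using cross_props[OF assms] tri_pole[of "cross x"] pi_flagD by metis

lemma advance_surj:
  assumes "x \<in> pi_flags"
  obtains w where "w \<in> pi_flags" "x = advance w"
  using bij_advance assms unfolding bij_betw_def by blast

lemma tri_adj_pi_flags:
  assumes "(T, T') \<in> tri_adj G" and x: "x \<in> pi_flags" "tri x = T"
  shows "\<exists>y\<in>pi_flags. tri y = T' \<and> (y = advance x \<or> x = advance y \<or> y = cross x)"
proof -
  obtain s where s: "s \<in> flags" "T = tri s" "T' = tri (flip G s)" using assms(1) unfolding tri_adj_def by blast
  note xf = pi_flagD[OF x(1)]
  have "tri s = tri x" using s x by simp
  from side_cases[OF x(1) s(1) this] show ?thesis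
  proof cases
    case 1
    obtain w where w: "w \<in> pi_flags" "x = advance w" using advance_surj[OF x(1)] .
    then have "flip G s = rung w" using 1 pi_flagD[OF w(1)] by (simp add: advance_def)
    then show ?thesis using w s pi_flagD[OF w(1)] by auto
  next
    case 2
    then show ?thesis using s x(1) by (intro bexI[of _ "advance x"]) (simp_all add: advance_def[symmetric])
  next
    case 3
    then show ?thesis using s x(1) tri_cross[OF x(1)] cross_props(1)[OF x(1)] by auto
  qed
qed

text \<open>
  An invariant set follows the ladder to a triangle where it turns, so it crosses the ladderpole
  on the left. It also comes from the ladder on the right: if it were never entered by a crossing,
  then it would contain with every triangle of the ladder the previous one, at which it does not
  turn, hence would not turn anywhere in the ladder. In both cases \<open>cross_ladder\<close>
  applies.
\<close>

lemma invariant_meets_cross: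
  assumes S: "S \<subseteq> pi_flags" "walk ` S = S" and x: "x \<in> pi_flags" "ladder x \<inter> S \<noteq> {}"
  shows "ladder (cross x) \<inter> S \<noteq> {}"
proof -
  obtain o1 where o1: "o1 \<in> ladder x" "o1 \<in> S" using x(2) by blast
  have o1p: "o1 \<in> pi_flags" using o1(2) S(1) by blast
  have lo: "ladder o1 = ladder x" using ladder_eq[OF x(1) o1(1)] .
  obtain h where h: "h \<in> ladder x" "turns h" using ladder_has_turn[OF x(1)] .
  show ?thesis
  proof (cases "right_of_pole x")
    case True
    have "\<exists>y\<in>ladder x \<inter> S. turns y"
    proof (rule ccontr)
      assume no: "\<not> ?thesis"
      have "h \<in> ladder o1" using h lo by simp
      with o1p have "h \<in> S"
      proof (induction rule: ladder_induct)
        case (advance z)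
        then have "\<not> turns z" using no lo by blast
        then have "advance z = walk z" by (simp add: walk_def)
        then show ?case using S(2) advance(2) by (metis imageI)
      qed (use o1 in simp)
      then show False using no h by blast
    qed
    then obtain y where y: "y \<in> ladder x" "y \<in> S" "turns y" by blast
    have "red y = red x"
      using y(3) True points_out_ladder[OF x(1) y(1)] by (simp add: turns_def right_of_pole_def)
    then have "cross y \<in> ladder (cross x)" using cross_ladder[OF x(1) y(1)] by blast
    moreover have "cross y \<in> S" using y S(2) by (metis imageI walk_def)
    ultimately show ?thesis by blast
  next
    case False
    have "\<exists>y\<in>S. turns y \<and> cross y \<in> ladder x"
    proof (rule ccontr)
      assume no: "\<not> ?thesis"
      have retreat: "z \<in> S \<and> \<not> turns z" if zs: "z \<in> ladder x" "advance z \<in> S" for z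
      proof -
        obtain w where w: "w \<in> S" "walk w = advance z" using zs(2) S(2) by (metis imageE)
        have zp: "z \<in> pi_flags" "w \<in> pi_flags" using ladder_pi[OF x(1) zs(1)] w S(1) by auto
        have "\<not> turns w" using no w ladder_advance[OF zs(1)] by (auto simp: walk_def)
        then have "advance w = advance z" using w by (simp add: walk_def)
        then show ?thesis using advance_inj[OF zp(2,1)] w \<open>\<not> turns w\<close> by simp
      qed
      have "advance h \<in> ladder o1" using h lo ladder_advance by simp
      with o1p have "advance h \<in> S"
        by (induction rule: ladder_backward_induct) (use o1 retreat lo in auto)
      then show False using retreat h by blast
    qed
    then obtain y where y: "y \<in> S" "turns y" "cross y \<in> ladder x" by blast
    have yp: "y \<in> pi_flags" using y S(1) by blast
    have "red (cross y) = red x"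
      using y(2) False points_out_ladder[OF x(1) y(3)] cross_props[OF yp] by (auto simp: turns_def right_of_pole_def)
    then have "y \<in> ladder (cross x)" using cross_ladder[OF x(1) y(3)] cross_cross[OF yp] by simp
    then show ?thesis using y(1) by blast
  qed
qed

lemma invariant_meets_ladder:
  assumes S: "S \<subseteq> pi_flags" "walk ` S = S" and z: "z \<in> S"
    and x: "x \<in> pi_flags" "(tri z, tri x) \<in> (tri_adj G)\<^sup>*"
  shows "ladder x \<inter> S \<noteq> {}"
proof -
  have "ladder x \<inter> S \<noteq> {}" if "x \<in> pi_flags" "tri x = T" "(tri z, T) \<in> (tri_adj G)\<^sup>*" for x T
    using that(3,1,2)
  proof (induction arbitrary: x rule: rtrancl_induct)
    case base
    then have "x = z" using pi_flag_unique z S(1) by blast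
    then show ?case using z self_in_ladder by blast
  next
    case (step T T')
    obtain s where "s \<in> flags" "T = tri s" using step(2) unfolding tri_adj_def by blast
    then obtain w where w: "w \<in> pi_flags" "tri w = T" using ex_pi_flag by metis
    obtain y where y: "y \<in> pi_flags" "tri y = T'" "y = advance w \<or> w = advance y \<or> y = cross w"
      using tri_adj_pi_flags[OF step(2) w] by blast
    have "y = x" using pi_flag_unique[OF y(1) step(4)] y(2) step(5) by simp
    moreover have "ladder w \<inter> S \<noteq> {}" using step(3) w by blast
    ultimately show ?case
      using y(1,3) w invariant_meets_cross[OF S w(1)] ladder_eq_advance[of w] ladder_eq_advance[of y] by metis
  qed
  then show ?thesis using x by blast
qed

end

context triangulation
begin

section \<open>Cusps and stationary weights\<close>

lemma sym_tri_adj: "sym (tri_adj G)"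
proof (rule symI)
  fix T T' assume "(T, T') \<in> tri_adj G"
  then obtain s where "s \<in> flags" "T = tri s" "T' = tri (flip G s)" unfolding tri_adj_def by blast
  then have "flip G s \<in> flags" "T' = tri (flip G s)" "T = tri (flip G (flip G s))" by simp_all
  then show "(T', T) \<in> tri_adj G" unfolding tri_adj_def by blast
qed

lemma equiv_tri_adj: "equiv UNIV ((tri_adj G)\<^sup>*)"
  using sym_rtrancl[OF sym_tri_adj] by (auto intro!: equivI refl_onI trans_rtrancl)

lemma cusp_eq:
  assumes "K \<in> cusps G" "T \<in> K"
  shows "K = (tri_adj G)\<^sup>* `` {T}"
proof -
  obtain U where U: "K = (tri_adj G)\<^sup>* `` {U}" using assms(1) unfolding cusps_def by (rule quotientE)
  then have "(U, T) \<in> (tri_adj G)\<^sup>*" using assms(2) by blast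
  then show ?thesis using U equiv_class_eq[OF equiv_tri_adj] by blast
qed

lemma cusp_closed: "K \<in> cusps G \<Longrightarrow> s \<in> flags \<Longrightarrow> tri s \<in> K \<Longrightarrow> tri (flip G s) \<in> K"
  using cusp_eq[of K "tri s"] unfolding tri_adj_def by blast

lemma cusp_connected: "K \<in> cusps G \<Longrightarrow> T \<in> K \<Longrightarrow> T' \<in> K \<Longrightarrow> (T, T') \<in> (tri_adj G)\<^sup>*"
  using cusp_eq[of K T] by blast

lemma cusps_disjoint: "K \<in> cusps G \<Longrightarrow> L \<in> cusps G \<Longrightarrow> T \<in> K \<Longrightarrow> T \<in> L \<Longrightarrow> K = L"
  using cusp_eq[of K T] cusp_eq[of L T] by simp

end

context veering_triangulation
begin

text \<open>
  Such a weight describes a flow along \<open>walk\<close> that is conserved at every triangle.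
\<close>

definition stationary :: "('t flag \<Rightarrow> real) \<Rightarrow> bool" where
  "stationary \<mu> \<longleftrightarrow> (\<forall>x. 0 \<le> \<mu> x \<and> \<mu> x \<le> 1) \<and>
     (\<forall>y\<in>pi_flags. (\<Sum>x | x \<in> pi_flags \<and> walk x = y. \<mu> x) = \<mu> y)"

lemma cusp_walk:
  assumes "K \<in> cusps G" "x \<in> pi_flags" "tri x \<in> K"
  shows "tri (walk x) \<in> K"
  using cusp_closed[OF assms(1), of "pole x"] cusp_closed[OF assms(1), of "rung x"] assms pi_flagD[OF assms(2)]
  by (simp add: walk_def tri_cross advance_def)

lemma ladder_in_cusp:
  assumes K: "K \<in> cusps G" and x: "x \<in> pi_flags" "tri x \<in> K" and y: "y \<in> ladder x"
  shows "tri y \<in> K"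
  using x(1) y
proof (induction rule: ladder_induct)
  case (advance z)
  have "z \<in> flags" using ladder_pi[OF x(1) advance(1)] pi_flagD by blast
  then show ?case using cusp_closed[OF K, of "rung z"] advance(2) by (simp add: advance_def)
qed (rule x(2))

lemma invariant_weight:
  assumes S: "S \<subseteq> pi_flags" "walk ` S = S"
  shows "(\<Sum>x | x \<in> pi_flags \<and> walk x = y. of_bool (x \<in> S) * (c :: real)) = of_bool (y \<in> S) * c"
proof -
  have inj: "inj_on walk S" using S by (simp add: eq_card_imp_inj_on)
  have "(\<Sum>x | x \<in> pi_flags \<and> walk x = y. of_bool (x \<in> S) * c) = (\<Sum>x | x \<in> S \<and> walk x = y. c)"
    using S(1) by (intro sum.mono_neutral_cong_right) auto
  also have "\<dots> = of_bool (y \<in> S) * c"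
  proof (cases "y \<in> S")
    case True
    then obtain x where x: "x \<in> S" "walk x = y" using S(2) by (metis imageE)
    have "{z. z \<in> S \<and> walk z = y} = {x}" using x inj by (auto dest: inj_onD)
    then show ?thesis using True by simp
  next
    case False
    then have "{z. z \<in> S \<and> walk z = y} = {}" using imageI[of _ S walk] unfolding S(2) by blast
    then show ?thesis using False by simp
  qed
  finally show ?thesis .
qed

text \<open>
  On each cusp in \<open>J\<close> the weight is constant on a set invariant under
  \<open>walk\<close>, and normalized by the number of times this set turns in the given ladder,
  which is positive by \<open>invariant_meets_ladder\<close>.
\<close>

lemma ex_stationary:
  fixes V :: "'i \<Rightarrow> ('t \<times> 4) set" and x :: "'i \<Rightarrow> 't flag"
  assumes I: "finite I" "inj_on V I" "V ` I \<subseteq> cusps G"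
    and x: "\<And>i. i \<in> I \<Longrightarrow> x i \<in> pi_flags" "\<And>i. i \<in> I \<Longrightarrow> tri (x i) \<in> V i"
    and J: "J \<subseteq> I"
  shows "\<exists>\<mu>. stationary \<mu> \<and>
    (\<forall>i\<in>I. (\<Sum>y | y \<in> ladder (x i) \<and> turns y. \<mu> y) = of_bool (i \<in> J))"
proof -
  have "\<exists>S. S \<subseteq> pi_flags \<and> S \<noteq> {} \<and> walk ` S = S \<and> tri ` S \<subseteq> V i" if i: "i \<in> I" for i
  proof -
    let ?A = "{y \<in> pi_flags. tri y \<in> V i}"
    have "x i \<in> ?A" using x i by simp
    then have ne: "?A \<noteq> {}" by blast
    have closed: "walk ` ?A \<subseteq> ?A"
    proof
      fix z assume "z \<in> walk ` ?A"
      then obtain y where y: "z = walk y" "y \<in> pi_flags" "tri y \<in> V i" by blast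
      have "V i \<in> cusps G" using I(3) i by blast
      then show "z \<in> ?A" using y cusp_walk[of "V i" y] by simp
    qed
    obtain S where S: "S \<subseteq> ?A" "S \<noteq> {}" "walk ` S = S"
      by (rule ex_invariant_subset[OF finite_flags ne closed])
    then have "S \<subseteq> pi_flags" "tri ` S \<subseteq> V i" by auto
    then show ?thesis using S(2,3) by blast
  qed
  then obtain S where S: "\<And>i. i \<in> I \<Longrightarrow> S i \<subseteq> pi_flags" "\<And>i. i \<in> I \<Longrightarrow> S i \<noteq> {}"
      "\<And>i. i \<in> I \<Longrightarrow> walk ` S i = S i" "\<And>i. i \<in> I \<Longrightarrow> tri ` S i \<subseteq> V i" by metis
  define A where "A i = {y. y \<in> ladder (x i) \<and> turns y \<and> y \<in> S i}" for i
  have A: "card (A i) > 0" if i: "i \<in> I" for i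
  proof -
    obtain z where z: "z \<in> S i" using S(2)[OF i] by blast
    then have "(tri z, tri (x i)) \<in> (tri_adj G)\<^sup>*"
      using cusp_connected[of "V i"] I(3) i x(2)[OF i] S(4)[OF i] by blast
    from invariant_meets_ladder[OF S(1,3)[OF i] z x(1)[OF i] this]
    obtain w where w: "w \<in> ladder (x i)" "w \<in> S i" by blast
    have "\<exists>y\<in>ladder (x i) \<inter> S i. turns y"
    proof (rule ccontr)
      assume no: "\<not> ?thesis"
      obtain h where h: "h \<in> ladder (x i)" "turns h" using ladder_has_turn[OF x(1)[OF i]] .
      have lw: "ladder w = ladder (x i)" using ladder_eq[OF x(1)[OF i] w(1)] .
      have "w \<in> pi_flags" "h \<in> ladder w" using w S(1)[OF i] h lw by auto
      then have "h \<in> S i"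
      proof (induction rule: ladder_induct)
        case (advance z)
        then have "\<not> turns z" using no lw by blast
        then have "advance z = walk z" by (simp add: walk_def)
        then show ?case using S(3)[OF i] advance(2) by (metis imageI)
      qed (use w in simp)
      then show False using no h by blast
    qed
    then have "A i \<noteq> {}" unfolding A_def by blast
    then show ?thesis using finite_flags[of "A i"] by (simp add: card_gt_0_iff)
  qed
  \<comment> \<open>The cusps are disjoint, so at most one summand is nonzero.\<close>
  define \<mu> where "\<mu> y = (\<Sum>i\<in>J. of_bool (y \<in> S i) * (1 / card (A i)))" for y
  have finJ: "finite J" using I(1) J finite_subset by blast
  have same: "i = j" if "i \<in> I" "j \<in> I" "y \<in> S i" "tri y \<in> V j" for i j y
  proof -
    have "tri y \<in> V i" using S(4)[OF that(1)] that(3) by blast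
    then have "V i = V j" using cusps_disjoint that I(3) by blast
    then show ?thesis using I(2) that by (auto dest: inj_onD)
  qed
  have \<mu>: "\<mu> y = (if i \<in> J then of_bool (y \<in> S i) * (1 / card (A i)) else 0)" if "i \<in> I" "tri y \<in> V i" for i y
  proof -
    have "of_bool (y \<in> S j) * (1 / real (card (A j))) = (if j = i then of_bool (y \<in> S i) * (1 / card (A i)) else 0)"
      if j: "j \<in> J" for j
    proof (cases "j = i")
      case False
      then have "y \<notin> S j" using same[of j i y] j J \<open>i \<in> I\<close> \<open>tri y \<in> V i\<close> by blast
      then show ?thesis using False by simp
    qed simp
    then have "\<mu> y = (\<Sum>j\<in>J. if j = i then of_bool (y \<in> S i) * (1 / card (A i)) else 0)"
      unfolding \<mu>_def by (intro sum.cong) auto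
    also have "\<dots> = (if i \<in> J then of_bool (y \<in> S i) * (1 / card (A i)) else 0)" using finJ by simp
    finally show ?thesis .
  qed
  have "0 \<le> \<mu> y \<and> \<mu> y \<le> 1" for y
  proof (cases "\<exists>i\<in>J. y \<in> S i")
    case True
    then obtain i where i: "i \<in> J" "y \<in> S i" by blast
    then have "i \<in> I" "tri y \<in> V i" using J S(4) by blast+
    then have "\<mu> y = 1 / card (A i)" using \<mu>[of i y] i by simp
    then show ?thesis using A[OF \<open>i \<in> I\<close>] by simp
  next
    case False
    then show ?thesis unfolding \<mu>_def by (simp add: sum.neutral)
  qed
  moreover have "(\<Sum>x | x \<in> pi_flags \<and> walk x = y. \<mu> x) = \<mu> y" for y
  proof -
    have "(\<Sum>x | x \<in> pi_flags \<and> walk x = y. \<mu> x)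
      = (\<Sum>i\<in>J. \<Sum>x | x \<in> pi_flags \<and> walk x = y. of_bool (x \<in> S i) * (1 / card (A i)))"
      unfolding \<mu>_def by (rule sum.swap)
    also have "\<dots> = \<mu> y"
      unfolding \<mu>_def
    proof (rule sum.cong[OF refl])
      fix i assume "i \<in> J"
      then have "i \<in> I" using J by blast
      then show "(\<Sum>x | x \<in> pi_flags \<and> walk x = y. of_bool (x \<in> S i) * (1 / card (A i)))
          = of_bool (y \<in> S i) * (1 / card (A i))"
        by (intro invariant_weight S)
    qed
    finally show ?thesis .
  qed
  ultimately have "stationary \<mu>" unfolding stationary_def by blast
  moreover have "(\<Sum>y | y \<in> ladder (x i) \<and> turns y. \<mu> y) = of_bool (i \<in> J)" if i: "i \<in> I" for i
  proof -
    have lad: "tri y \<in> V i" if "y \<in> ladder (x i)" for y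
      using ladder_in_cusp[of "V i" "x i" y] I(3) i x that by blast
    have "(\<Sum>y | y \<in> ladder (x i) \<and> turns y. \<mu> y)
      = (\<Sum>y | y \<in> ladder (x i) \<and> turns y. if i \<in> J then of_bool (y \<in> S i) * (1 / card (A i)) else 0)"
      using \<mu>[OF i] lad by (intro sum.cong) auto
    also have "\<dots> = (if i \<in> J then (\<Sum>y\<in>A i. 1 / card (A i)) else 0)"
    proof (cases "i \<in> J")
      case True
      have "(\<Sum>y | y \<in> ladder (x i) \<and> turns y. of_bool (y \<in> S i) * (1 / card (A i))) = (\<Sum>y\<in>A i. 1 / card (A i))"
        by (intro sum.mono_neutral_cong_right) (auto simp: A_def)
      then show ?thesis using True by simp
    qed simp
    also have "\<dots> = of_bool (i \<in> J)" using A[OF i] by (auto simp: card_gt_0_iff)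
    finally show ?thesis .
  qed
  ultimately show ?thesis by blast
qed

section \<open>The flow across the ladders\<close>

definition walk_side :: "'t flag \<Rightarrow> 't flag" where
  "walk_side x = (if turns x then pole x else rung x)"

definition strand :: "('t flag \<Rightarrow> real) \<Rightarrow> 't flag \<Rightarrow> real" where
  "strand \<mu> s = (\<Sum>x | x \<in> pi_flags \<and> walk_side x = s. \<mu> x)"

text \<open>
  The flow along the ladders that enters every triangle through the side opposite to its
  \<open>pi\<close>-corner and leaves it through the other rung.
\<close>

definition circulation :: "'t flag \<Rightarrow> real" where
  "circulation s = of_bool (s \<in> rung ` pi_flags) - of_bool (s \<in> pi_flags)"

text \<open>
  The strands run from right to left, so subtracting them makes the flow cross ladders from left
  to right. With the unit \<open>pi / 4\<close> each of the four tips of a tetrahedron lowers its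
  angle \<open>pi\<close> by at most \<open>pi / 4\<close>, and a crossing flow of one unit
  changes the holonomy by \<open>pi / 2\<close>.
\<close>

definition ladder_flow :: "('t flag \<Rightarrow> real) \<Rightarrow> 't flag \<Rightarrow> real" where
  "ladder_flow \<mu> s = pi / 4 * (circulation s - strand \<mu> s + strand \<mu> (flip G s))"

lemma side_distinct:
  assumes x: "x \<in> pi_flags"
  shows "rung x \<noteq> x" "pole x \<noteq> x" "pole x \<noteq> rung x" "rung x \<notin> pi_flags" "pole x \<notin> pi_flags"
    "pole x \<notin> rung ` pi_flags" "x \<notin> rung ` pi_flags"
proof -
  note xf = pi_flagD[OF x]
  have cc: "ccw (ccw x) \<noteq> ccw x" using ccw_neq(1)[OF ccw_flag[OF xf]] .
  show "rung x \<noteq> x" "pole x \<noteq> x" using xf by (simp_all add: rung_def pole_def)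
  show pr: "pole x \<noteq> rung x" using cc cc[symmetric] by (simp add: rung_def pole_def)
  show np: "rung x \<notin> pi_flags" "pole x \<notin> pi_flags"
    using ccw_not_pi[OF x] by (simp_all add: rung_def pole_def)
  show "pole x \<notin> rung ` pi_flags"
  proof
    assume "pole x \<in> rung ` pi_flags"
    then obtain y where y: "y \<in> pi_flags" "pole x = rung y" by blast
    then have "x = y" using pi_flag_unique[OF x y(1)] xf pi_flagD[OF y(1)] by (metis tri_pole tri_rung)
    then show False using y pr by simp
  qed
  show "x \<notin> rung ` pi_flags"
  proof
    assume "x \<in> rung ` pi_flags"
    then obtain y where y: "y \<in> pi_flags" "x = rung y" by blast
    then show False using side_kinds(1)[OF x] side_kinds(3)[OF y(1)] by simp
  qed
qed

lemma walk_side_flag [simp]: "x \<in> flags \<Longrightarrow> walk_side x \<in> flags"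
  and tri_walk_side [simp]: "x \<in> flags \<Longrightarrow> tri (walk_side x) = tri x"
  by (simp_all add: walk_side_def)

lemma strand_on_triangle:
  assumes x: "x \<in> pi_flags" and s: "s \<in> flags" "tri s = tri x"
  shows "strand \<mu> s = (if s = walk_side x then \<mu> x else 0)"
proof -
  define E where "E = {y. y \<in> pi_flags \<and> walk_side y = s}"
  have "y = x" if "y \<in> E" for y
  proof -
    have y: "y \<in> pi_flags" "walk_side y = s" using that by (simp_all add: E_def)
    have "tri y = tri s" using tri_walk_side[OF pi_flagD[OF y(1)]] y(2) by simp
    also have "\<dots> = tri x" by (rule s(2))
    finally show ?thesis by (rule pi_flag_unique[OF y(1) x])
  qed
  then have sub: "E \<subseteq> {x}" by (rule subsetI[OF iffD2[OF singleton_iff]])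
  show ?thesis
  proof (cases "s = walk_side x")
    case True
    have "x \<in> E" unfolding E_def True using x by simp
    then have "{x} \<subseteq> E" by simp
    with sub have "E = {x}" by (rule subset_antisym)
    then show ?thesis using True unfolding strand_def E_def[symmetric] by simp
  next
    case False
    have "x \<notin> E" using False unfolding E_def by simp
    then have "E = {}" using sub subset_singletonD by (metis insertI1)
    then show ?thesis using False unfolding strand_def E_def[symmetric] by simp
  qed
qed

lemma strand_pi:
  assumes x: "x \<in> pi_flags"
  shows "strand \<mu> x = 0" 
  using strand_on_triangle[OF x, of x] side_distinct[OF x] pi_flagD[OF x] unfolding walk_side_def by auto

lemma tri_flip_walk_side:
  assumes y: "y \<in> pi_flags"
  shows "tri (flip G (walk_side y)) = tri (walk y)"
  using tri_cross[OF y] by (simp add: walk_side_def walk_def advance_def)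

lemma flux_ladder_flow:
  assumes \<mu>: "stationary \<mu>"
  shows "flux (ladder_flow \<mu>)"
  unfolding flux_def
proof (intro ballI conjI)
  fix s :: "'t flag" assume s: "s \<in> flags"
  obtain x where x: "x \<in> pi_flags" "tri x = tri s" using ex_pi_flag[OF s] .
  note xf = pi_flagD[OF x(1)]
  have c: "s \<in> pi_flags \<longleftrightarrow> flip G s \<in> rung ` pi_flags" if "s \<in> flags" for s
  proof
    assume "s \<in> pi_flags"
    then obtain w where "w \<in> pi_flags" "s = advance w" using advance_surj by blast
    then show "flip G s \<in> rung ` pi_flags" using pi_flagD[of w] by (simp add: advance_def)
  next
    assume "flip G s \<in> rung ` pi_flags"
    then obtain w where w: "w \<in> pi_flags" "flip G s = rung w" by blast
    then have "s = advance w" using that unfolding advance_def by (metis flip_flip)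
    then show "s \<in> pi_flags" using w by simp
  qed
  have "circulation (flip G s) = - circulation s"
    using c[OF s] c[of "flip G s"] s by (simp add: circulation_def)
  then show "ladder_flow \<mu> (flip G s) = - ladder_flow \<mu> s"
    using s by (simp add: ladder_flow_def algebra_simps)
  let ?T = "{j. j \<in> flags \<and> tri j = tri x}"
  have T: "?T = {x, rung x, pole x}" using side_cases[OF x(1)] xf by auto
  have d: "distinct [x, rung x, pole x]" using side_distinct[OF x(1)] by simp
  have "(\<Sum>j\<in>?T. circulation j) = circulation x + circulation (rung x) + circulation (pole x)"
    unfolding T using d by simp
  also have "\<dots> = 0" using side_distinct[OF x(1)] x(1) by (simp add: circulation_def)
  finally have 1: "(\<Sum>j\<in>?T. circulation j) = 0" .
  have 2: "(\<Sum>j\<in>?T. strand \<mu> j) = \<mu> x"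
  proof -
    have "(\<Sum>j\<in>?T. strand \<mu> j) = (\<Sum>j\<in>?T. if j = walk_side x then \<mu> x else 0)"
      using strand_on_triangle[OF x(1)] by (intro sum.cong) auto
    also have "\<dots> = \<mu> x" using xf by simp
    finally show ?thesis .
  qed
  have "(\<Sum>j\<in>?T. strand \<mu> (flip G j)) = (\<Sum>(j, y)\<in>(SIGMA j:?T. {y. y \<in> pi_flags \<and> walk_side y = flip G j}). \<mu> y)"
    unfolding strand_def by (rule sum.Sigma) auto
  also have "\<dots> = (\<Sum>y | y \<in> pi_flags \<and> walk y = x. \<mu> y)"
  proof (rule sum.reindex_bij_witness[of _ "\<lambda>y. (flip G (walk_side y), y)" snd])
    fix p assume "p \<in> (SIGMA j:?T. {y. y \<in> pi_flags \<and> walk_side y = flip G j})"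
    then obtain j y where p: "p = (j, y)" "j \<in> flags" "tri j = tri x" "y \<in> pi_flags" "walk_side y = flip G j"
      by auto
    have j: "j = flip G (walk_side y)" using p by simp
    then have "tri (walk y) = tri x" using tri_flip_walk_side[OF p(4)] p(3) by simp
    then have "walk y = x" using pi_flag_unique[of "walk y" x] p(4) x(1) by simp
    then show "(flip G (walk_side (snd p)), snd p) = p" "snd p \<in> {y. y \<in> pi_flags \<and> walk y = x}"
      "\<mu> (snd p) = (case p of (j, y) \<Rightarrow> \<mu> y)"
      using p(1,4) j \<open>walk y = x\<close> by simp_all
  next
    fix y assume "y \<in> {y. y \<in> pi_flags \<and> walk y = x}"
    then show "snd (flip G (walk_side y), y) = y"
      "(flip G (walk_side y), y) \<in> (SIGMA j:?T. {y. y \<in> pi_flags \<and> walk_side y = flip G j})"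
      using tri_flip_walk_side[of y] pi_flagD[of y] by auto
  qed
  also have "\<dots> = \<mu> x" using \<mu> x(1) unfolding stationary_def by blast
  finally have 3: "(\<Sum>j\<in>?T. strand \<mu> (flip G j)) = \<mu> x" .
  have "(\<Sum>j\<in>?T. ladder_flow \<mu> j) = pi / 4 * ((\<Sum>j\<in>?T. circulation j) - (\<Sum>j\<in>?T. strand \<mu> j) + (\<Sum>j\<in>?T. strand \<mu> (flip G j)))"
    unfolding ladder_flow_def by (simp only: sum_distrib_left[symmetric] sum.distrib sum_subtractf)
  then have "(\<Sum>j\<in>?T. ladder_flow \<mu> j) = 0" using 1 2 3 by simp
  then show "ladder_flow \<mu> s + ladder_flow \<mu> (ccw s) + ladder_flow \<mu> (ccw (ccw s)) = 0"
    using sum_triangle[OF s, of "ladder_flow \<mu>"] x(2) by simp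
qed

lemma ladder_flow_values:
  assumes x: "x \<in> pi_flags"
  shows "ladder_flow \<mu> x = pi / 4 * (strand \<mu> (flip G x) - 1)"
    "ladder_flow \<mu> (rung x) = pi / 4 * (1 - (if turns x then 0 else \<mu> x))"
    "ladder_flow \<mu> (pole x) = pi / 4 * ((if turns (cross x) then \<mu> (cross x) else 0) - (if turns x then \<mu> x else 0))"
proof -
  note xf = pi_flagD[OF x]
  note sd = side_distinct[OF x]
  have cx: "cross x \<in> pi_flags" using cross_props[OF x] by simp
  then have cf: "cross x \<in> flags" by (rule pi_flagD)
  show "ladder_flow \<mu> x = pi / 4 * (strand \<mu> (flip G x) - 1)"
    using sd x by (simp add: ladder_flow_def circulation_def strand_pi)
  have "strand \<mu> (flip G (rung x)) = 0" using strand_pi[OF advance_pi[OF x]] by (simp add: advance_def)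
  then show "ladder_flow \<mu> (rung x) = pi / 4 * (1 - (if turns x then 0 else \<mu> x))"
    using sd x xf by (simp add: ladder_flow_def circulation_def strand_on_triangle[OF x] walk_side_def)
  have "strand \<mu> (pole (cross x)) = (if turns (cross x) then \<mu> (cross x) else 0)"
    using strand_on_triangle[OF cx pole_flag[OF cf] tri_pole[OF cf]] side_distinct(3)[OF cx]
    by (simp add: walk_side_def)
  then have "strand \<mu> (flip G (pole x)) = (if turns (cross x) then \<mu> (cross x) else 0)"
    unfolding cross_props(2)[OF x] .
  then show "ladder_flow \<mu> (pole x) = pi / 4 * ((if turns (cross x) then \<mu> (cross x) else 0) - (if turns x then \<mu> x else 0))"
    using sd x xf by (simp add: ladder_flow_def circulation_def strand_on_triangle[OF x] walk_side_def)
qed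

lemma stationaryD: "stationary \<mu> \<Longrightarrow> 0 \<le> \<mu> x \<and> \<mu> x \<le> 1"
  unfolding stationary_def by blast

lemma ladder_flow_bounds:
  assumes \<mu>: "stationary \<mu>" and x: "x \<in> pi_flags"
  shows "ladder_flow \<mu> x \<ge> - pi / 4" "ladder_flow \<mu> (rung x) \<ge> 0"
    "turns x \<Longrightarrow> ladder_flow \<mu> (rung x) = pi / 4" "ladder_flow \<mu> (pole x) \<ge> - pi / 4"
    "\<not> turns x \<Longrightarrow> ladder_flow \<mu> (pole x) \<ge> 0"
proof -
  note b = stationaryD[OF \<mu>]
  have "strand \<mu> (flip G x) \<ge> 0" unfolding strand_def using b by (intro sum_nonneg) blast
  then have "pi / 4 * (strand \<mu> (flip G x) - 1) \<ge> pi / 4 * (- 1)"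
    by (intro mult_left_mono) auto
  then show "ladder_flow \<mu> x \<ge> - pi / 4" by (simp add: ladder_flow_values[OF x])
  show "ladder_flow \<mu> (rung x) \<ge> 0" using b[of x] by (simp add: ladder_flow_values[OF x])
  show "turns x \<Longrightarrow> ladder_flow \<mu> (rung x) = pi / 4" by (simp add: ladder_flow_values[OF x])
  have "pi / 4 * ((if turns (cross x) then \<mu> (cross x) else 0) - (if turns x then \<mu> x else 0)) \<ge> pi / 4 * (- 1)"
    using b[of x] b[of "cross x"] by (intro mult_left_mono) auto
  then show "ladder_flow \<mu> (pole x) \<ge> - pi / 4" by (simp add: ladder_flow_values[OF x])
  show "\<not> turns x \<Longrightarrow> ladder_flow \<mu> (pole x) \<ge> 0"
    using b[of "cross x"] by (simp add: ladder_flow_values[OF x])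
qed

text \<open>
  The tips of the bottom edge and those of the top edge differ in \<open>points_out\<close>, and
  they differ in colour just in case of a hinge. So at a hinge all four tips are on the same side
  of their poles.
\<close>

lemma turns_tips:
  assumes x: "x \<in> pi_flags"
  shows "red (rev_flag (opp_flag x)) = red (opp_flag x)"
    "turns (rev_flag x) = turns x" "turns (rev_flag (opp_flag x)) = turns (opp_flag x)"
    "hinge x \<Longrightarrow> turns (opp_flag x) = turns x"
    "\<not> hinge x \<Longrightarrow> \<not> turns x \<and> \<not> turns (opp_flag x)"
proof -
  note xf = pi_flagD[OF x]
  have ox: "opp_flag x \<in> pi_flags" using x xf by simp
  show r: "red (rev_flag (opp_flag x)) = red (opp_flag x)" using xf by simp
  show "turns (rev_flag x) = turns x"
    using xf points_out_pi[OF x] by (simp add: turns_def right_of_pole_def hinge_def opp_rev)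
  show "turns (rev_flag (opp_flag x)) = turns (opp_flag x)"
    using xf points_out_pi[OF ox] by (simp add: turns_def right_of_pole_def hinge_def opp_rev)
  show "hinge x \<Longrightarrow> turns (opp_flag x) = turns x"
    using xf points_out_pi[OF x] by (auto simp: turns_def right_of_pole_def hinge_def)
  show "\<not> hinge x \<Longrightarrow> \<not> turns x \<and> \<not> turns (opp_flag x)"
    using xf by (auto simp: turns_def hinge_def)
qed

text \<open>
  At a tip with red \<open>pi\<close>-corner, the blue angle gets the flux through the ladderpole
  edge, and the red angle the flux through the rung; at a blue one it is the other way round.
  Where the walk does not turn, both are nonnegative. Where it turns, the tetrahedron is a hinge,
  so each of the two angles gets the flux through ladderpole edges from two tips, each at least
  \<open>- pi / 4\<close>, and exactly \<open>pi / 4\<close> through a rung from each of the other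
  two.
\<close>

lemma pair_flux_nonneg:
  assumes \<mu>: "stationary \<mu>" and x: "x \<in> pi_flags"
  defines "F \<equiv> ladder_flow \<mu>"
  shows "pair_flux F x \<ge> - pi" "pair_flux F (ccw x) \<ge> 0" "pair_flux F (ccw (ccw x)) \<ge> 0"
proof -
  note xf = pi_flagD[OF x]
  let ?r = "rev_flag x" and ?o = "opp_flag x" and ?p = "rev_flag (opp_flag x)"
  have p: "?r \<in> pi_flags" "?o \<in> pi_flags" "?p \<in> pi_flags" using x xf by simp_all
  note b = ladder_flow_bounds[OF \<mu> x, folded F_def] ladder_flow_bounds[OF \<mu> p(1), folded F_def]
    ladder_flow_bounds[OF \<mu> p(2), folded F_def] ladder_flow_bounds[OF \<mu> p(3), folded F_def]
  show "pair_flux F x \<ge> - pi" unfolding pair_flux_def using b(1,6,11,16) by linarith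
  have c1: "pair_flux F (ccw x) = F (ccw x) + F (ccw ?r) + F (ccw ?o) + F (ccw ?p)"
    using xf by (simp add: pair_flux_def ccw_rev ccw_opp opp_rev)
  have c2: "pair_flux F (ccw (ccw x)) = F (ccw (ccw x)) + F (ccw (ccw ?r)) + F (ccw (ccw ?o)) + F (ccw (ccw ?p))"
    using xf by (simp add: pair_flux_def ccw_rev ccw_opp opp_rev)
  have e1: "F (ccw y) = (if red y then F (pole y) else F (rung y))" for y by (simp add: pole_def rung_def)
  have e2: "F (ccw (ccw y)) = (if red y then F (rung y) else F (pole y))" for y by (simp add: pole_def rung_def)
  note t = turns_tips[OF x] red_rev[OF xf]
  have "pair_flux F (ccw x) \<ge> 0 \<and> pair_flux F (ccw (ccw x)) \<ge> 0"
  proof (cases "turns x")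
    case True
    then have hx: "hinge x" by (simp add: turns_def)
    then have h: "red ?o = (\<not> red x)" by (auto simp: hinge_def)
    have tr: "turns ?r" "turns ?o" "turns ?p" using t True hx by simp_all
    note f = b(3)[OF True] b(8)[OF tr(1)] b(13)[OF tr(2)] b(18)[OF tr(3)] b(4,9,14,19)
    show ?thesis
    proof
      show "pair_flux F (ccw x) \<ge> 0" unfolding c1 e1 t(1,6) h using f by (cases "red x") simp_all
      show "pair_flux F (ccw (ccw x)) \<ge> 0" unfolding c2 e2 t(1,6) h using f by (cases "red x") simp_all
    qed
  next
    case False
    then have tr: "\<not> turns ?r" "\<not> turns ?o" "\<not> turns ?p" using t by blast+
    note f = b(5)[OF False] b(10)[OF tr(1)] b(15)[OF tr(2)] b(20)[OF tr(3)] b(2,7,12,17)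
    show ?thesis
    proof
      show "pair_flux F (ccw x) \<ge> 0" unfolding c1 e1 using f by (simp add: add_nonneg_nonneg)
      show "pair_flux F (ccw (ccw x)) \<ge> 0" unfolding c2 e2 using f by (simp add: add_nonneg_nonneg)
    qed
  qed
  then show "pair_flux F (ccw x) \<ge> 0" "pair_flux F (ccw (ccw x)) \<ge> 0" by blast+
qed

lemma nonneg_deform:
  assumes \<mu>: "stationary \<mu>"
  shows "nonneg_angle_structure G (deform \<alpha> (ladder_flow \<mu>))"
  unfolding nonneg_angle_structure_def
proof (intro conjI allI ballI)
  show "generalized_angle_structure G (deform \<alpha> (ladder_flow \<mu>))"
    using generalized_angle_structure_deform[OF generalized flux_ladder_flow[OF \<mu>]] .
  fix t :: 't and q assume q: "q \<in> opposite_pairs"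
  obtain x where x: "x \<in> pi_flags" "tri x = tri (t, 0, 1)" using ex_pi_flag[of "(t, 0, 1)"] by (auto simp: flags_def)
  note xf = pi_flagD[OF x(1)]
  have tx: "fst x = t" using x(2) by (cases x) simp
  let ?\<theta> = "deform \<alpha> (ladder_flow \<mu>)"
  have z: "corner_angle \<alpha> x = pi" "corner_angle \<alpha> (ccw x) = 0" "corner_angle \<alpha> (ccw (ccw x)) = 0"
    using x(1) ccw_not_pi[OF x(1)] angle_zero_iff[of "ccw x"] angle_zero_iff[of "ccw (ccw x)"] xf
    by (simp_all add: pi_flags_def)
  have "corner_angle ?\<theta> x \<ge> 0" "corner_angle ?\<theta> (ccw x) \<ge> 0" "corner_angle ?\<theta> (ccw (ccw x)) \<ge> 0"
    using pair_flux_nonneg[OF \<mu> x(1)] z xf by (simp_all add: corner_angle_deform)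
  then show "0 \<le> ?\<theta> t q"
    using q unfolding opposite_pairs_eq(1)[OF xf] corner_angle_eq using tx xf
    by (auto simp: opposite_pair_ops)
qed

end

section \<open>Homology classes of closed paths\<close>

lemma cyclic_induct:
  assumes step: "\<And>i. i < n \<Longrightarrow> Q i \<Longrightarrow> Q (Suc i mod n)" and i: "i < n" "Q i" and j: "j < (n::nat)"
  shows "Q j"
proof -
  have "Q ((i + d) mod n)" for d
  proof (induction d)
    case (Suc d)
    then have "Q (Suc ((i + d) mod n) mod n)" using step i by simp
    then show ?case by (simp add: mod_Suc_eq)
  qed (use i in simp)
  from this[of "n + j - i"] have "Q ((n + j) mod n)" using i by simp
  then show ?thesis using j by simp
qed

lemma sum_cyclic_shift:
  fixes f :: "nat \<Rightarrow> 'a::comm_monoid_add"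
  shows "(\<Sum>i<n. f (Suc i mod n)) = (\<Sum>i<n. f i)"
proof (cases n)
  case (Suc m)
  have "(\<Sum>i<n. f (Suc i mod n)) = (\<Sum>i<m. f (Suc i mod n)) + f 0"
    using Suc by simp
  also have "(\<Sum>i<m. f (Suc i mod n)) = (\<Sum>i<m. f (Suc i))"
    using Suc by (intro sum.cong) auto
  finally show ?thesis using Suc sum.lessThan_Suc_shift[of f m] by (simp add: add.commute)
qed simp

lemma sum_count_list:
  assumes "finite A"
  shows "(\<Sum>s\<in>A. int (count_list ds s)) = (\<Sum>i<length ds. of_bool (ds ! i \<in> A))"
proof (induction ds)
  case (Cons d ds)
  have "(\<Sum>s\<in>A. int (count_list (d # ds) s)) = (\<Sum>s\<in>A. of_bool (s = d) + int (count_list ds s))"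
    by (intro sum.cong) auto
  also have "\<dots> = of_bool (d \<in> A) + (\<Sum>s\<in>A. int (count_list ds s))"
    using assms by (simp add: sum.distrib of_bool_def)
  finally show ?case using Cons by (simp add: sum.lessThan_Suc_shift del: sum.lessThan_Suc count_list.simps)
qed simp

lemma count_list_distinct: "distinct xs \<Longrightarrow> count_list xs x = of_bool (x \<in> set xs)"
  by (induction xs) auto

context triangulation
begin

lemma homologous_refl: "homologous G K z z"
  unfolding homologous_def by (intro exI[of _ "\<lambda>_. 0"]) simp

lemma homologous_sym:
  assumes "homologous G K z z'"
  shows "homologous G K z' z"
proof -
  obtain k :: "'t \<times> 4 \<Rightarrow> int" where k: "\<forall>T. T \<notin> K \<longrightarrow> k T = 0" "\<forall>s\<in>flags. z s - z' s = k (tri s) - k (tri (flip G s))"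
    using assms unfolding homologous_def by blast
  have "\<forall>s\<in>flags. z' s - z s = - k (tri s) - - k (tri (flip G s))"
  proof
    fix s :: "'t flag" assume "s \<in> flags"
    then have "z s - z' s = k (tri s) - k (tri (flip G s))" using k(2) by blast
    then show "z' s - z s = - k (tri s) - - k (tri (flip G s))" by linarith
  qed
  then show ?thesis using k(1) unfolding homologous_def by (intro exI[of _ "\<lambda>T. - k T"]) simp
qed

lemma homologous_trans:
  assumes "homologous G K x y" "homologous G K y z"
  shows "homologous G K x z"
proof -
  obtain k :: "'t \<times> 4 \<Rightarrow> int" where k: "\<forall>T. T \<notin> K \<longrightarrow> k T = 0" "\<forall>s\<in>flags. x s - y s = k (tri s) - k (tri (flip G s))"
    using assms(1) unfolding homologous_def by blast
  obtain k' :: "'t \<times> 4 \<Rightarrow> int" where k': "\<forall>T. T \<notin> K \<longrightarrow> k' T = 0" "\<forall>s\<in>flags. y s - z s = k' (tri s) - k' (tri (flip G s))"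
    using assms(2) unfolding homologous_def by blast
  have "\<forall>s\<in>flags. x s - z s = (k (tri s) + k' (tri s)) - (k (tri (flip G s)) + k' (tri (flip G s)))"
  proof
    fix s :: "'t flag" assume "s \<in> flags"
    then have "x s - y s = k (tri s) - k (tri (flip G s))" "y s - z s = k' (tri s) - k' (tri (flip G s))"
      using k(2) k'(2) by blast+
    then show "x s - z s = (k (tri s) + k' (tri s)) - (k (tri (flip G s)) + k' (tri (flip G s)))"
      by linarith
  qed
  then show ?thesis using k(1) k'(1) unfolding homologous_def by (intro exI[of _ "\<lambda>T. k T + k' T"]) simp
qed

lemma cusp_bd_vertex:
  assumes K: "K \<in> cusps G" and k: "k \<in> flags" "tri k \<in> K" and j: "j \<in> bd_vertex G k"
  shows "tri j \<in> K"
proof -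
  have "tri ((rot ^^ n) k) \<in> K" for n
  proof (induction n)
    case (Suc n)
    let ?k = "(rot ^^ n) k"
    have kf: "?k \<in> flags" using k by simp
    then have "tri (flip G (ccw ?k)) \<in> K" using Suc cusp_closed[OF K, of "ccw ?k"] by simp
    moreover have "tri (rot ?k) = tri (flip G (ccw ?k))" unfolding rot_def[of ?k] using kf by simp
    ultimately show ?case by simp
  qed (use k in simp)
  then show ?thesis using j k by (auto simp: bd_vertex_eq_rot_orbit)
qed

lemma closed_pathD:
  assumes "closed_path G ds"
  shows "ds \<noteq> []" "set ds \<subseteq> flags" "\<And>i. i < length ds \<Longrightarrow> ds ! i \<in> flags"
    "\<And>i. i < length ds \<Longrightarrow> bd_vertex G (ccw (ccw (ds ! i))) = bd_vertex G (ccw (ds ! (Suc i mod length ds)))"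
  using assms unfolding closed_path_def by (auto dest: nth_mem)

lemma closed_path_in_cusp:
  assumes K: "K \<in> cusps G" and ds: "closed_path G ds" and s: "s \<in> set ds" "s \<in> sides_of K"
  shows "set ds \<subseteq> sides_of K"
proof -
  let ?n = "length ds"
  note cp = closed_pathD[OF ds]
  obtain i where i: "i < ?n" "ds ! i = s" using s(1) by (meson in_set_conv_nth)
  have step: "tri (ds ! (Suc i mod ?n)) \<in> K" if i: "i < ?n" "tri (ds ! i) \<in> K" for i
  proof -
    let ?s = "ds ! i" and ?s' = "ds ! (Suc i mod ?n)"
    have s: "?s \<in> flags" "?s' \<in> flags" using cp(1,3) i(1) by simp_all
    have "ccw ?s' \<in> bd_vertex G (ccw (ccw ?s))" using cp(4)[OF i(1)] by simp
    moreover have "ccw (ccw ?s) \<in> flags" "tri (ccw (ccw ?s)) \<in> K" using s i(2) by simp_all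
    ultimately have "tri (ccw ?s') \<in> K" using cusp_bd_vertex[OF K] by blast
    then show ?thesis using s by simp
  qed
  have "tri (ds ! j) \<in> K" if "j < ?n" for j
    using cyclic_induct[of ?n "\<lambda>i. tri (ds ! i) \<in> K" i j] step i s(2) that by (simp add: sides_of_def)
  then have "tri s \<in> K" if "s \<in> set ds" for s using that by (metis in_set_conv_nth)
  then show ?thesis using cp(2) by (auto simp: sides_of_def)
qed

lemma path_chain_eqI: "(\<And>s. count_list xs s = count_list ys s) \<Longrightarrow> path_chain G xs = path_chain G ys"
  unfolding path_chain_def by (rule ext) simp

text \<open>
  A path inside one cusp stays there under homotopies, and inserting the boundary of a triangle
  changes the chain by this boundary.
\<close>

lemma homotopy_step_homologous:
  assumes K: "K \<in> cusps G" and st: "homotopy_step G p q"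
  shows "(set p \<subseteq> sides_of K \<longleftrightarrow> set q \<subseteq> sides_of K) \<and>
    (set p \<subseteq> sides_of K \<longrightarrow> homologous G K (path_chain G p) (path_chain G q))"
  using st
proof cases
  case (rotate xs ys)
  then have "path_chain G p = path_chain G q" by (intro path_chain_eqI) simp
  then show ?thesis using rotate by (auto simp: homologous_refl)
next
  case (spur xs ys s)
  have ne: "xs @ ys \<noteq> []" using spur(3) closed_pathD(1) by blast
  have sub: "set p \<subseteq> sides_of K \<longleftrightarrow> set q \<subseteq> sides_of K"
  proof
    assume p: "set p \<subseteq> sides_of K"
    obtain u where u: "u \<in> set p" using ne spur(1) by (metis list.set_intros(1) neq_Nil_conv)
    then have "u \<in> set q" using spur(1,2) by auto
    then show "set q \<subseteq> sides_of K" using closed_path_in_cusp[OF K] spur(2,4) p u by blast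
  qed (use spur(1,2) in auto)
  have sf: "s \<in> flags" using closed_pathD(2)[OF spur(4)] by simp
  have "path_chain G p u = path_chain G q u" if u: "u \<in> flags" for u
  proof -
    have "s = flip G u \<longleftrightarrow> flip G s = u" using u sf by (metis flip_flip)
    moreover have "flip G s = flip G u \<longleftrightarrow> s = u" using u sf by (metis flip_flip)
    ultimately show ?thesis unfolding spur(1,2) path_chain_def by auto
  qed
  then have "homologous G K (path_chain G p) (path_chain G q)"
    unfolding homologous_def by (intro exI[of _ "\<lambda>_. 0"]) simp
  then show ?thesis using sub by blast
next
  case (triangle xs ys s)
  have ne: "xs @ ys \<noteq> []" using triangle(3) closed_pathD(1) by blast
  have sub: "set p \<subseteq> sides_of K \<longleftrightarrow> set q \<subseteq> sides_of K"
  proof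
    assume p: "set p \<subseteq> sides_of K"
    obtain u where u: "u \<in> set p" using ne triangle(1) by (metis list.set_intros(1) neq_Nil_conv)
    then have "u \<in> set q" using triangle(1,2) by auto
    then show "set q \<subseteq> sides_of K" using closed_path_in_cusp[OF K] triangle(2,4) p u by blast
  qed (use triangle(1,2) in auto)
  have sf: "s \<in> flags" using closed_pathD(2)[OF triangle(4)] by simp
  have cnt: "count_list [s, ccw s, ccw (ccw s)] u = of_bool (tri u = tri s)" if u: "u \<in> flags" for u
  proof -
    have "ccw (ccw s) \<noteq> ccw s" using ccw_neq(1)[OF ccw_flag[OF sf]] .
    then have "distinct [s, ccw s, ccw (ccw s)]" using sf by (simp add: eq_commute)
    from count_list_distinct[OF this, of u] show ?thesis using tri_eq_iff[OF sf u] by simp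
  qed
  have "homologous G K (path_chain G p) (path_chain G q)" if p: "set p \<subseteq> sides_of K"
    unfolding homologous_def
  proof (intro exI[of _ "\<lambda>T. - of_bool (T = tri s)"] conjI allI impI ballI)
    fix T assume "T \<notin> K"
    have "s \<in> sides_of K" using p sub triangle(2) by auto
    then show "- of_bool (T = tri s) = (0::int)" using \<open>T \<notin> K\<close> by (auto simp: sides_of_def)
  next
    fix u :: "'t flag" assume u: "u \<in> flags"
    have "path_chain G q u = path_chain G p u + int (count_list [s, ccw s, ccw (ccw s)] u)
        - int (count_list [s, ccw s, ccw (ccw s)] (flip G u))"
      unfolding triangle(1,2) path_chain_def count_list_append by (simp del: count_list.simps)
    then show "path_chain G p u - path_chain G q u
        = - of_bool (tri u = tri s) - - of_bool (tri (flip G u) = tri s)"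
      using cnt[OF u] cnt[of "flip G u"] u by simp
  qed
  then show ?thesis using sub by blast
qed

lemma freely_homotopic_homologous:
  assumes K: "K \<in> cusps G" and lP: "freely_homotopic G l P" and l: "set l \<subseteq> sides_of K"
  shows "homologous G K (path_chain G l) (path_chain G P)"
proof -
  have "(symclp (homotopy_step G))\<^sup>*\<^sup>* l P" using lP unfolding freely_homotopic_def equivclp_def .
  then have "set P \<subseteq> sides_of K \<and> homologous G K (path_chain G l) (path_chain G P)"
  proof (induction rule: rtranclp_induct)
    case base
    then show ?case using l homologous_refl by blast
  next
    case (step p q)
    from step(2) show ?case
    proof (cases rule: symclpE)
      case base
      then show ?thesis using homotopy_step_homologous[OF K base] step(3) homologous_trans by blast
    next
      case sym
      then show ?thesis using homotopy_step_homologous[OF K sym] step(3) homologous_trans homologous_sym by blast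
    qed
  qed
  then show ?thesis by blast
qed

lemma flip_sides_of: "K \<in> cusps G \<Longrightarrow> s \<in> flags \<Longrightarrow> flip G s \<in> sides_of K \<longleftrightarrow> s \<in> sides_of K"
  using cusp_closed[of K s] cusp_closed[of K "flip G s"] by (auto simp: sides_of_def)

text \<open>
  A closed path starts edges at a vertex as often as it ends them there; in the sum the terms with
  reversed edges count the ends.
\<close>

lemma path_chain_cycle:
  assumes K: "K \<in> cusps G" and ds: "closed_path G ds" "set ds \<subseteq> sides_of K"
  shows "path_chain G ds \<in> cycles G K"
  unfolding cycles_def
proof (intro CollectI conjI allI ballI impI)
  note cp = closed_pathD[OF ds(1)]
  fix s :: "'t flag" assume s: "s \<notin> sides_of K"
  have "flip G s \<notin> set ds"
  proof (cases "s \<in> flags")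
    case True
    then show ?thesis using flip_sides_of[OF K True] s ds(2) by blast
  next
    case False
    then obtain t v where "s = (t, v, v)" by (cases s) (auto simp: flags_def)
    then have "flip G s \<notin> flags" by (auto simp: flip_def across_def flags_def split: prod.splits)
    then show ?thesis using cp(2) by blast
  qed
  moreover have "s \<notin> set ds" using s ds(2) by blast
  ultimately show "path_chain G ds s = 0" by (simp add: path_chain_def)
next
  fix s assume "s \<in> sides_of K"
  then have "s \<in> flags" by (simp add: sides_of_def)
  then show "path_chain G ds (flip G s) = - path_chain G ds s" by (simp add: path_chain_def)
next
  note cp = closed_pathD[OF ds(1)]
  let ?n = "length ds"
  fix x assume "x \<in> sides_of K"
  let ?B = "bd_vertex G x"
  let ?A = "{s. s \<in> flags \<and> ccw s \<in> ?B}" and ?A' = "{s. s \<in> flags \<and> ccw (ccw s) \<in> ?B}"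
  have fin: "finite ?A" "finite ?A'" by (rule finite)+
  have mem: "ccw (flip G s) \<in> ?B \<longleftrightarrow> ccw (ccw s) \<in> ?B" if "s \<in> flags" for s
    using bd_vertex_flip_ccw[OF that] bd_vertex_eq_iff by metis
  have "(\<Sum>s\<in>?A. int (count_list ds (flip G s))) = (\<Sum>s\<in>?A'. int (count_list ds s))"
  proof (rule sum.reindex_bij_witness[of _ "flip G" "flip G"])
    fix s assume "s \<in> ?A"
    then show "flip G (flip G s) = s" "flip G s \<in> ?A'"
      using mem[of "flip G s"] by simp_all
  next
    fix s assume "s \<in> ?A'"
    then show "flip G (flip G s) = s" "flip G s \<in> ?A" using mem[of s] by simp_all
  qed simp
  also have "\<dots> = (\<Sum>i<?n. of_bool (ccw (ccw (ds ! i)) \<in> ?B))"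
    unfolding sum_count_list[OF fin(2)] using cp(3) by (intro sum.cong) auto
  also have "\<dots> = (\<Sum>i<?n. of_bool (ccw (ds ! (Suc i mod ?n)) \<in> ?B))"
  proof (rule sum.cong[OF refl])
    fix i assume "i \<in> {..<?n}"
    then have "bd_vertex G (ccw (ccw (ds ! i))) = bd_vertex G (ccw (ds ! (Suc i mod ?n)))" using cp(4) by simp
    then show "of_bool (ccw (ccw (ds ! i)) \<in> ?B) = of_bool (ccw (ds ! (Suc i mod ?n)) \<in> ?B)"
      unfolding bd_vertex_eq_iff[symmetric] by simp
  qed
  also have "\<dots> = (\<Sum>i<?n. of_bool (ccw (ds ! i) \<in> ?B))"
    by (rule sum_cyclic_shift)
  also have "\<dots> = (\<Sum>s\<in>?A. int (count_list ds s))"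
    unfolding sum_count_list[OF fin(1)] using cp(3) by (intro sum.cong) auto
  finally show "(\<Sum>s | s \<in> flags \<and> ccw s \<in> ?B. path_chain G ds s) = 0"
    unfolding path_chain_def sum_subtractf by simp
qed

end

context veering_triangulation
begin

section \<open>Ladderpoles\<close>

lemma pole_side:
  assumes "s \<in> flags" "same_color G \<alpha> (ccw s) (ccw (ccw s))"
  obtains x where "x \<in> pi_flags" "s = pole x"
proof -
  obtain x where x: "x \<in> pi_flags" "tri x = tri s" using ex_pi_flag[OF assms(1)] .
  have "red (ccw s) = red (ccw (ccw s))"
    using assms left_iff_not_red[of "ccw s"] left_iff_not_red[of "ccw (ccw s)"]
    by (auto simp: same_color_def red_def)
  with side_cases[OF x(1) assms(1) x(2)[symmetric]] side_kinds[OF x(1)] have "s = pole x" by metis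
  then show ?thesis using that x by blast
qed

lemma upward_edge_iff_points_out: "upward_edge out s \<longleftrightarrow> \<not> points_out (ccw (ccw s)) \<and> points_out (ccw s)"
  by (cases s) (auto simp: upward_edge_def points_out_def)

lemma upward_pole:
  assumes x: "x \<in> pi_flags"
  shows "upward_edge out (pole x) \<longleftrightarrow> \<not> right_of_pole x"
    "upward_edge (\<lambda>t a. \<not> out t a) (pole x) \<longleftrightarrow> right_of_pole x"
proof -
  note xf = pi_flagD[OF x]
  have "upward_edge (\<lambda>t a. \<not> out t a) s \<longleftrightarrow> points_out (ccw (ccw s)) \<and> \<not> points_out (ccw s)" for s
    by (cases s) (auto simp: upward_edge_def points_out_def)
  then show "upward_edge out (pole x) \<longleftrightarrow> \<not> right_of_pole x"
    "upward_edge (\<lambda>t a. \<not> out t a) (pole x) \<longleftrightarrow> right_of_pole x"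
    using points_out_pi[OF x] xf by (auto simp: upward_edge_iff_points_out pole_def right_of_pole_def)
qed

lemma right_of_pole_cross: "x \<in> pi_flags \<Longrightarrow> right_of_pole (cross x) \<longleftrightarrow> \<not> right_of_pole x"
  using cross_props[of x] by (auto simp: right_of_pole_def)

lemma pole_ends:
  assumes x: "x \<in> pi_flags"
  shows "bd_vertex G (ccw (flip G (pole x))) = bd_vertex G (if red x then x else far_end x)"
    "bd_vertex G (ccw (ccw (flip G (pole x)))) = bd_vertex G (if red x then far_end x else x)"
  using pi_flagD[OF x] by (simp_all add: bd_vertex_flip_ccw bd_vertex_flip_ccw_ccw pole_def far_end_def)

lemma red_far_end: "x \<in> pi_flags \<Longrightarrow> red (far_end x) = red x"
  using side_kinds[of x] by (auto simp: far_end_def)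

text \<open>
  The edges of a ladderpole in terms of the triangles on their right. The edge of \<open>X
  i\<close> leads from its \<open>pi\<close>-corner to the far end if it is red and conversely if
  it is blue (\<open>pole_ends\<close>), so consecutive edges share a vertex as stated.
\<close>

definition right_triangles :: "'t flag list \<Rightarrow> (nat \<Rightarrow> 't flag) \<Rightarrow> bool" where
  "right_triangles P X \<longleftrightarrow> (\<forall>i<length P. let x = X i; x' = X (Suc i mod length P) in
     x \<in> pi_flags \<and> P ! i = flip G (pole x) \<and>
     right_of_pole x = upward_edge out (P ! i) \<and>
     (\<not> right_of_pole x) = upward_edge (\<lambda>t a. \<not> out t a) (P ! i) \<and>
     red x' = red x \<and>
     bd_vertex G (if red x then far_end x else x) = bd_vertex G (if red x then x' else far_end x'))"

lemma right_trianglesD: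
  assumes "right_triangles P X" "i < length P"
  shows "X i \<in> pi_flags" "P ! i = flip G (pole (X i))"
    "right_of_pole (X i) = upward_edge out (P ! i)"
    "(\<not> right_of_pole (X i)) = upward_edge (\<lambda>t a. \<not> out t a) (P ! i)"
    "red (X (Suc i mod length P)) = red (X i)"
    "bd_vertex G (if red (X i) then far_end (X i) else X i)
       = bd_vertex G (if red (X i) then X (Suc i mod length P) else far_end (X (Suc i mod length P)))"
  using assms unfolding right_triangles_def Let_def by blast+

lemma ladderpole_flags:
  assumes P: "ladderpole G \<alpha> K P"
  obtains X where "right_triangles P X"
proof -
  let ?n = "length P"
  have cp: "closed_path G P" using P by (simp add: ladderpole_def simple_closed_curve_def)
  note cpD = closed_pathD[OF cp]
  have "\<exists>x. x \<in> pi_flags \<and> P ! i = flip G (pole x)" if i: "i < ?n" for i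
  proof -
    have "same_color G \<alpha> (ccw (P ! i)) (ccw (ccw (P ! i)))" using P i by (simp add: ladderpole_def)
    then obtain y where y: "y \<in> pi_flags" "P ! i = pole y" using pole_side cpD(3)[OF i] by blast
    then show ?thesis using cross_props[OF y(1)] pi_flagD[OF y(1)] by (intro exI[of _ "cross y"]) simp
  qed
  then obtain X where X: "\<And>i. i < ?n \<Longrightarrow> X i \<in> pi_flags" "\<And>i. i < ?n \<Longrightarrow> P ! i = flip G (pole (X i))"
    by metis
  have up: "right_of_pole (X i) \<longleftrightarrow> upward_edge out (P ! i)" 
      "\<not> right_of_pole (X i) \<longleftrightarrow> upward_edge (\<lambda>t a. \<not> out t a) (P ! i)" if i: "i < ?n" for i
    using upward_pole[OF cross_props(1)[OF X(1)[OF i]]] cross_props(2)[OF X(1)[OF i]]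
      right_of_pole_cross[OF X(1)[OF i]] X(2)[OF i] by simp_all
  have s: "Suc i mod ?n < ?n" if "i < ?n" for i using that by (cases "P = []") auto
  have ends: "bd_vertex G (if red (X i) then far_end (X i) else X i)
       = bd_vertex G (if red (X (Suc i mod ?n)) then X (Suc i mod ?n) else far_end (X (Suc i mod ?n)))" if i: "i < ?n" for i
    using cpD(4)[OF i] pole_ends(2)[OF X(1)[OF i]] pole_ends(1)[OF X(1)[OF s[OF i]]] X(2)[OF i] X(2)[OF s[OF i]] by simp
  have r: "red (X (Suc i mod ?n)) = red (X i)" if i: "i < ?n" for i
    using red_cong[OF ends[OF i]] red_far_end[OF X(1)[OF i]] red_far_end[OF X(1)[OF s[OF i]]] by (auto split: if_splits)
  have "right_triangles P X"
    unfolding right_triangles_def Let_def using X up r ends by simp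
  then show ?thesis by (rule that)
qed

text \<open>
  Only one ladderpole edge leads upward from a vertex, and only one leads downward, so a path
  along ladderpole edges that changes its direction returns along the edge on which it came.
\<close>

lemma ladderpole_one_direction:
  assumes P: "ladderpole G \<alpha> K P"
  shows "(\<forall>s\<in>set P. upward_edge out s) \<or> (\<forall>s\<in>set P. upward_edge (\<lambda>t a. \<not> out t a) s)"
proof (rule ccontr)
  assume no: "\<not> ?thesis"
  let ?n = "length P"
  obtain X where "right_triangles P X" using ladderpole_flags[OF P] .
  note X = right_trianglesD[OF this]
  have flipP: "flip G s \<notin> set P" if "s \<in> set P" for s
    using P that by (simp add: ladderpole_def simple_closed_curve_def)
  obtain i where i: "i < ?n" "\<not> right_of_pole (X i)" using no X(3) by (metis in_set_conv_nth)
  obtain j where j: "j < ?n" "right_of_pole (X j)" using no X(4) by (metis in_set_conv_nth)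
  have "\<not> right_of_pole (X (Suc m mod ?n))" if m: "m < ?n" "\<not> right_of_pole (X m)" for m
  proof
    let ?m = "Suc m mod ?n"
    assume rp: "right_of_pole (X ?m)"
    have m': "?m < ?n" using m by (cases "P = []") auto
    note x = X(1)[OF m(1)] and x' = X(1)[OF m']
    have o: "points_out (X ?m) \<longleftrightarrow> \<not> points_out (X m)" using rp m(2) X(5)[OF m(1)] by (auto simp: right_of_pole_def)
    have "cross (X m) = X ?m"
    proof (cases "red (X m)")
      case True
      then show ?thesis
        using X(6)[OF m(1)] bd_vertex_cross[OF x] cross_props[OF x] o x'
        by (intro vertex_pi_flag_unique) auto
    next
      case False
      then have "X m = cross (X ?m)"
        using X(6)[OF m(1)] bd_vertex_cross[OF x'] cross_props[OF x'] o x
        by (intro vertex_pi_flag_unique) auto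
      then show ?thesis using cross_cross[OF x'] by simp
    qed
    then have "P ! ?m = pole (X m)"
      using X(2)[OF m'] cross_props(2)[OF x] pi_flagD[OF x] by (metis flip_flip pole_flag)
    then have "flip G (P ! ?m) = P ! m" using X(2)[OF m(1)] by simp
    then show False using flipP[of "P ! ?m"] m m' by (metis nth_mem)
  qed
  from cyclic_induct[of ?n "\<lambda>m. \<not> right_of_pole (X m)", OF this i j(1)] show False using j(2) by blast
qed

text \<open>
  The ladderpole on the left of the ladder of \<open>x\<close>, directed upward.
\<close>

definition left_pole :: "'t flag \<Rightarrow> 't flag set" where
  "left_pole x = (\<lambda>y. flip G (pole y)) ` {y \<in> ladder x. right_of_pole y}"

text \<open>
  Consecutive edges of the ladderpole are related by \<open>pole_succ\<close>, forward if they are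
  blue and backward if they are red, so they exhaust one side of a ladder.
\<close>

lemma upward_ladderpole:
  assumes P: "ladderpole G \<alpha> K P" and up: "\<forall>s\<in>set P. upward_edge out s"
  obtains x where "x \<in> pi_flags" "right_of_pole x" "tri (cross x) \<in> K"
    "set P = left_pole x"
proof -
  let ?n = "length P"
  obtain X where "right_triangles P X" using ladderpole_flags[OF P] .
  note X = right_trianglesD[OF this]
  have cp: "closed_path G P" and PK: "set P \<subseteq> sides_of K"
    using P by (auto simp: ladderpole_def simple_closed_curve_def)
  have n: "0 < ?n" using closed_pathD(1)[OF cp] by simp
  have sn: "Suc i mod ?n < ?n" for i using n by simp
  define x where "x = X 0"
  have x: "x \<in> pi_flags" using X(1)[OF n] by (simp add: x_def)
  have rp: "right_of_pole (X i)" if "i < ?n" for i using X(3)[OF that] up that by simp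
  have col: "red (X i) = red x" if "i < ?n" for i
  proof (rule cyclic_induct[of ?n "\<lambda>i. red (X i) = red x", OF _ n _ that])
    show "red (X 0) = red x" by (simp add: x_def)
    show "red (X (Suc j mod ?n)) = red x" if "j < ?n" "red (X j) = red x" for j
      unfolding X(5)[OF that(1)] by (rule that(2))
  qed
  have ou: "points_out (X i) = points_out x" if "i < ?n" for i
    using rp[OF that] rp[OF n] col[OF that] by (simp add: right_of_pole_def x_def)
  have nx: "if red x then X i = pole_succ (X (Suc i mod ?n)) else X (Suc i mod ?n) = pole_succ (X i)" if i: "i < ?n" for i
  proof (cases "red x")
    case True
    have "bd_vertex G (far_end (X i)) = bd_vertex G (X (Suc i mod ?n))" using X(6)[OF i] col[OF i] True by simp
    moreover have "points_out (X i) = points_out (X (Suc i mod ?n))" unfolding ou[OF i] ou[OF sn] ..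
    ultimately have "X i = pole_succ (X (Suc i mod ?n))" by (intro pole_succ_unique X(1) i sn)
    then show ?thesis using True by simp
  next
    case False
    have "bd_vertex G (far_end (X (Suc i mod ?n))) = bd_vertex G (X i)"
      using X(6)[OF i, symmetric] col[OF i] False by simp
    moreover have "points_out (X (Suc i mod ?n)) = points_out (X i)" unfolding ou[OF i] ou[OF sn] ..
    ultimately have "X (Suc i mod ?n) = pole_succ (X i)" by (intro pole_succ_unique X(1) i sn)
    then show ?thesis using False by simp
  qed
  have inl: "X i \<in> ladder x" if "i < ?n" for i
  proof (rule cyclic_induct[of ?n "\<lambda>i. X i \<in> ladder x", OF _ n _ that])
    fix i assume i: "i < ?n" "X i \<in> ladder x"
    have l: "ladder (X i) = ladder x" using ladder_eq[OF x i(2)] .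
    show "X (Suc i mod ?n) \<in> ladder x"
    proof (cases "red x")
      case True
      then have "X i \<in> ladder (X (Suc i mod ?n))" using nx[OF i(1)] pole_succ_props(2)[OF X(1)[OF sn]] by metis
      then show ?thesis using ladder_sym[OF X(1)[OF sn]] l by blast
    next
      case False
      then show ?thesis using nx[OF i(1)] pole_succ_props(2)[OF X(1)[OF i(1)]] l by metis
    qed
  qed (simp add: x_def)
  have nc: "\<exists>j<?n. pole_succ (X i) = X j" if i: "i < ?n" for i
  proof (cases "red x")
    case True
    define j where "j = (if i = 0 then ?n - 1 else i - 1)"
    have j: "j < ?n" "Suc j mod ?n = i" using i by (auto simp: j_def)
    then show ?thesis using nx[OF j(1)] True by metis
  next
    case False
    then show ?thesis using nx[OF i] sn by metis
  qed
  have all: "\<exists>i<?n. y = X i" if y: "y \<in> ladder x" "red y = red x" for y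
    using x y
  proof (rule pole_succ_induct)
    show "\<exists>i<?n. x = X i" using n x_def by blast
  qed (use nc in blast)
  have rpl: "right_of_pole y \<longleftrightarrow> red y = red x" if "y \<in> ladder x" for y
    using points_out_ladder[OF x that] rp[OF n] by (auto simp: right_of_pole_def x_def)
  have "set P = left_pole x"
  proof
    show "set P \<subseteq> left_pole x"
    proof
      fix s assume "s \<in> set P"
      then obtain i where "i < ?n" "s = P ! i" by (metis in_set_conv_nth)
      then show "s \<in> left_pole x"
        unfolding left_pole_def using X(2) inl rp by blast
    qed
    show "left_pole x \<subseteq> set P"
    proof
      fix s assume "s \<in> left_pole x"
      then obtain y where y: "y \<in> ladder x" "right_of_pole y" "s = flip G (pole y)" unfolding left_pole_def by blast
      then obtain i where "i < ?n" "y = X i" using all rpl by blast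
      then show "s \<in> set P" using X(2) y(3) nth_mem by metis
    qed
  qed
  moreover have "tri (cross x) \<in> K"
    using tri_cross[OF x] X(2)[OF n] nth_mem[OF n] PK by (auto simp: sides_of_def x_def)
  moreover have "right_of_pole x" using rp[OF n] by (simp add: x_def)
  ultimately show ?thesis by (intro that[OF x])
qed

text \<open>
  Crossing the ladderpole on the left of the ladder of \<open>x\<close> changes \<open>k\<close>
  by 1 modulo \<open>m\<close>, and no other crossing made by the walk changes it. Unless 1 is 0
  modulo \<open>m\<close>, the walk started on the left of this ladderpole could therefore never
  be in the ladder of \<open>x\<close>, contradicting \<open>invariant_meets_ladder\<close>. This
  shows for \<open>m = 0\<close> that the class of the ladderpole is not 0, and for other
  \<open>m\<close> that it is not a multiple.
\<close>

lemma pole_nonseparating: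
  fixes z :: "'t flag \<Rightarrow> int" and k :: "'t \<times> 4 \<Rightarrow> int"
  assumes K: "K \<in> cusps G" and x: "x \<in> pi_flags" "right_of_pole x" "tri (cross x) \<in> K"
    and zP: "\<And>y. y \<in> ladder x \<Longrightarrow> right_of_pole y \<Longrightarrow> z (pole y) = - 1"
    and z0: "\<And>y. y \<in> pi_flags \<Longrightarrow> z (rung y) = 0"
       "\<And>y. y \<in> pi_flags \<Longrightarrow> right_of_pole y \<Longrightarrow> y \<notin> ladder x \<Longrightarrow> z (pole y) = 0"
    and k: "\<And>s. s \<in> flags \<Longrightarrow> m dvd z s - (k (tri s) - k (tri (flip G s)))"
  shows "m dvd 1"
proof (rule ccontr)
  assume m: "\<not> m dvd 1"
  let ?b = "k (tri (cross x))"
  define B where "B = {y \<in> pi_flags. tri y \<in> K \<and> m dvd k (tri y) - ?b}"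
  have kl: "m dvd k (tri y) - k (tri x)" if "y \<in> ladder x" for y
    using x(1) that
  proof (induction rule: ladder_induct)
    case (advance w)
    have w: "w \<in> pi_flags" "w \<in> flags" using ladder_pi[OF x(1) advance(1)] pi_flagD by blast+
    have "m dvd - (k (tri w) - k (tri (advance w)))"
      using k[of "rung w"] z0(1)[OF w(1)] w by (simp add: advance_def)
    from dvd_add[OF this advance(2)] show ?case by simp
  qed simp
  \<comment> \<open>The crossing from the ladder of \<open>x\<close> to the triangle on the left of its pole.\<close>
  have xb: "m dvd -1 - (k (tri x) - ?b)"
    using k[of "pole x"] zP[OF self_in_ladder x(2)] pi_flagD[OF x(1)] tri_cross[OF x(1)] by simp
  have disj: "ladder x \<inter> B = {}"
  proof (rule ccontr)
    assume "\<not> ?thesis"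
    then obtain y where y: "y \<in> ladder x" "m dvd k (tri y) - ?b" by (auto simp: B_def)
    have "m dvd -1 - (k (tri x) - ?b) + ((k (tri y) - ?b) - (k (tri y) - k (tri x)))"
      by (rule dvd_add[OF xb dvd_diff[OF y(2) kl[OF y(1)]]])
    then show False using m by simp
  qed
  have closed: "walk ` B \<subseteq> B"
  proof
    fix w assume "w \<in> walk ` B"
    then obtain y where y: "w = walk y" "y \<in> B" by blast
    then have yp: "y \<in> pi_flags" "tri y \<in> K" "m dvd k (tri y) - ?b" by (auto simp: B_def)
    note yf = pi_flagD[OF yp(1)]
    have "y \<notin> ladder x" using y(2) disj by blast
    then have "z (walk_side y) = 0"
      using z0 yp(1) by (auto simp: walk_side_def turns_def)
    then have "m dvd - (k (tri y) - k (tri (walk y)))"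
      using k[of "walk_side y"] yf tri_flip_walk_side[OF yp(1)] by simp
    from dvd_add[OF this yp(3)] show "w \<in> B"
      using cusp_walk[OF K yp(1,2)] yp(1) y(1) by (simp add: B_def)
  qed
  have "cross x \<in> B" using cross_props(1)[OF x(1)] x(3) by (simp add: B_def)
  then have ne: "B \<noteq> {}" by blast
  obtain S where S: "S \<subseteq> B" "S \<noteq> {}" "walk ` S = S"
    by (rule ex_invariant_subset[OF finite_flags ne closed])
  then obtain w where w: "w \<in> S" by blast
  have wB: "w \<in> B" using w S(1) by blast
  have Sp: "S \<subseteq> pi_flags" using S(1) by (auto simp: B_def)
  have "tri x \<in> K"
    using cusp_closed[OF K, of "pole (cross x)"] cross_props[OF x(1)] x(3) pi_flagD[OF x(1)] pi_flagD[OF cross_props(1)[OF x(1)]]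
    by (metis flip_flip pole_flag tri_pole)
  then have "(tri w, tri x) \<in> (tri_adj G)\<^sup>*" using cusp_connected[OF K] wB by (simp add: B_def)
  from invariant_meets_ladder[OF Sp S(3) w x(1) this] show False using S(1) disj by blast
qed

end

context veering_triangulation
begin

section \<open>Upward curves in ladders\<close>

text \<open>
  The rung through which an upward curve enters the triangle; it leaves through \<open>out_rung
  x\<close>.
\<close>

definition in_rung :: "'t flag \<Rightarrow> 't flag" where
  "in_rung x = (if points_out x then rung x else x)"

definition out_rung :: "'t flag \<Rightarrow> 't flag" where
  "out_rung x = (if points_out x then x else rung x)"

text \<open>
  Upward is the direction of \<open>advance\<close> if \<open>points_out\<close> is false on the
  ladder, and the opposite direction if it is true.
\<close>

lemma ladder_list:
  assumes x: "x \<in> pi_flags"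
  obtains xs where "distinct xs" "set xs = ladder x" "xs \<noteq> []"
    "\<And>i. i < length xs \<Longrightarrow> flip G (in_rung (xs ! (Suc i mod length xs))) = out_rung (xs ! i)"
proof -
  define N where "N = (LEAST n. n > 0 \<and> (advance ^^ n) x = x)"
  have ex: "\<exists>n. n > 0 \<and> (advance ^^ n) x = x" using advance_periodic[OF x] by blast
  have N: "N > 0" "(advance ^^ N) x = x" using LeastI_ex[OF ex] unfolding N_def by blast+
  have least: "(advance ^^ d) x \<noteq> x" if "0 < d" "d < N" for d
    using not_less_Least[of d "\<lambda>n. n > 0 \<and> (advance ^^ n) x = x"] that unfolding N_def by blast
  define ys where "ys = map (\<lambda>i. (advance ^^ i) x) [0..<N]"
  have len: "length ys = N" by (simp add: ys_def)
  have nth: "ys ! i = (advance ^^ i) x" if "i < N" for i using that by (simp add: ys_def)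
  have ne: "(advance ^^ i) x \<noteq> (advance ^^ j) x" if ij: "i < j" "j < N" for i j
  proof
    assume "(advance ^^ i) x = (advance ^^ j) x"
    then have "(advance ^^ i) x = (advance ^^ (i + (j - i))) x" using ij by simp
    from funpow_cancel[OF bij_betw_imp_inj_on[OF bij_advance]
        equalityD1[OF bij_betw_imp_surj_on[OF bij_advance]] x this, symmetric]
    show False using least[of "j - i"] ij by linarith
  qed
  have inj: "inj_on (\<lambda>i. (advance ^^ i) x) {0..<N}"
  proof (rule inj_onI)
    fix i j assume "i \<in> {0..<N}" "j \<in> {0..<N}" "(advance ^^ i) x = (advance ^^ j) x"
    then show "i = j" using ne[of i j] ne[of j i] by (metis atLeastLessThan_iff nat_neq_iff)
  qed
  have dist: "distinct ys" using inj by (simp add: ys_def distinct_map)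
  have set: "set ys = ladder x"
  proof
    show "set ys \<subseteq> ladder x" by (auto simp: ys_def ladder_def)
    show "ladder x \<subseteq> set ys"
    proof
      fix y assume "y \<in> ladder x"
      then obtain n where "y = (advance ^^ n) x" by (auto simp: ladder_def)
      then have "y = (advance ^^ (n mod N)) x" using funpow_mod_eq[OF N(2)] by metis
      then show "y \<in> set ys" using N(1) by (auto simp: ys_def)
    qed
  qed
  have suc: "ys ! (Suc i mod N) = advance (ys ! i)" if i: "i < N" for i
  proof (cases "Suc i = N")
    case True
    then have "advance (ys ! i) = (advance ^^ N) x" using nth[OF i] by auto
    then show ?thesis using True N nth[of 0] by simp
  next
    case False
    then show ?thesis using i nth[of "Suc i"] nth[of i] by simp
  qed
  have mem: "ys ! i \<in> ladder x" "ys ! i \<in> pi_flags" "ys ! i \<in> flags" "points_out (ys ! i) = points_out x" if "i < N" for i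
  proof -
    show m: "ys ! i \<in> ladder x" using set nth_mem[of i ys] len that by simp
    show p: "ys ! i \<in> pi_flags" using ladder_pi[OF x m] .
    show "ys ! i \<in> flags" using p by (rule pi_flagD)
    show "points_out (ys ! i) = points_out x" using points_out_ladder[OF x m] .
  qed
  show ?thesis
  proof (cases "points_out x")
    case False
    show ?thesis
    proof (rule that[OF dist set])
      show "ys \<noteq> []" using len N(1) by auto
      fix i assume "i < length ys"
      then have i: "i < N" "Suc i mod N < N" using len N(1) by simp_all
      have "in_rung (ys ! (Suc i mod N)) = advance (ys ! i)"
        using suc[OF i(1)] mem(4)[OF i(2)] False by (simp add: in_rung_def)
      then show "flip G (in_rung (ys ! (Suc i mod length ys))) = out_rung (ys ! i)"
        using mem(3,4)[OF i(1)] False by (simp add: len advance_def out_rung_def)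
    qed
  next
    case True
    \<comment> \<open>On this ladder \<open>advance\<close> runs downward, so the list is reversed.\<close>
    show ?thesis
    proof (rule that[of "rev ys"])
      show "distinct (rev ys)" "set (rev ys) = ladder x" "rev ys \<noteq> []" using dist set len N(1) by auto
      fix i assume "i < length (rev ys)"
      then have i: "i < N" "Suc i mod N < N" using len N(1) by simp_all
      define j where "j = N - 1 - (Suc i mod N)"
      have j: "j < N" using i(2) by (simp add: j_def)
      have "Suc j mod N = N - 1 - i"
        using i(1) by (cases "Suc i = N") (auto simp: j_def Suc_diff_Suc)
      then have "advance (ys ! j) = ys ! (N - 1 - i)" using suc[OF j] by simp
      moreover have "rev ys ! (Suc i mod N) = ys ! j" "rev ys ! i = ys ! (N - 1 - i)"
        using i by (simp_all add: rev_nth len j_def)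
      moreover have "points_out (ys ! j)" "points_out (ys ! (N - 1 - i))" using mem(4)[OF j] mem(4)[of "N - 1 - i"] True i(1) by simp_all
      ultimately show "flip G (in_rung (rev ys ! (Suc i mod length (rev ys)))) = out_rung (rev ys ! i)"
        by (simp add: len in_rung_def out_rung_def advance_def)
    qed
  qed
qed

lemma rung_arcs:
  assumes y: "y \<in> pi_flags"
  shows "in_rung y \<in> flags" "tri (in_rung y) = tri y" "out_rung y \<in> flags"
    "right_of_pole y \<Longrightarrow> out_rung y = ccw (in_rung y)" "right_of_pole y \<Longrightarrow> ccw (ccw (in_rung y)) = pole y"
    "\<not> right_of_pole y \<Longrightarrow> out_rung y = ccw (ccw (in_rung y))" "\<not> right_of_pole y \<Longrightarrow> ccw (in_rung y) = pole y"
  using pi_flagD[OF y] by (auto simp: in_rung_def out_rung_def rung_def pole_def right_of_pole_def)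

lemma angle_pole: "y \<in> pi_flags \<Longrightarrow> corner_angle \<alpha> (pole y) = 0"
  using side_distinct(5)[of y] pi_flagD[of y] by (simp add: angle_zero_iff)

text \<open>
  As much flow enters the ladder as leaves it.
\<close>

lemma ladder_pole_flux:
  assumes F: "flux F" and x: "x \<in> pi_flags"
  shows "(\<Sum>y\<in>ladder x. F (pole y)) = 0"
proof -
  have "F (pole y) = F (advance y) - F y" if "y \<in> ladder x" for y
  proof -
    have yp: "y \<in> pi_flags" "y \<in> flags" using ladder_pi[OF x that] pi_flagD by blast+
    have "F y + F (rung y) + F (pole y) = 0" using fluxD(2)[OF F yp(2)] by (auto simp: rung_def pole_def)
    moreover have "F (advance y) = - F (rung y)" using fluxD(1)[OF F, of "rung y"] yp by (simp add: advance_def)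
    ultimately show ?thesis by simp
  qed
  then have "(\<Sum>y\<in>ladder x. F (pole y)) = (\<Sum>y\<in>ladder x. F (advance y)) - (\<Sum>y\<in>ladder x. F y)"
    by (simp add: sum_subtractf)
  then show ?thesis using sum.reindex_bij_betw[OF bij_advance_ladder[OF x], of F] by simp
qed

text \<open>
  The curve crosses all rungs at their midpoints.
\<close>

definition ladder_path :: "'t flag list \<Rightarrow> ('t flag \<times> real) list" where
  "ladder_path xs = map (\<lambda>y. (in_rung y, 1 / 2)) xs"

text \<open>
  The curve meets every triangle of the ladder once and cuts off the corner opposite to the
  ladderpole edge, to the right if the triangle is on the right of its pole. This corner has
  \<open>\<alpha>\<close>-angle 0, so what remains is the outward flow through the right pole
  minus the one through the left pole, and by \<open>ladder_pole_flux\<close> these two have sum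
  0.
\<close>

lemma ladder_curve:
  assumes K: "K \<in> cusps G" and x: "x \<in> pi_flags" "tri x \<in> K"
    and xs: "distinct xs" "set xs = ladder x" "xs \<noteq> []"
    "\<forall>i<length xs. flip G (in_rung (xs ! (Suc i mod length xs))) = out_rung (xs ! i)"
  defines "g \<equiv> ladder_path xs"
  shows "normal_curve G K g"
    and "normal_curve_chain G g s = of_bool (s \<in> left_pole x)
       - of_bool (flip G s \<in> left_pole x)"
    and "flux F \<Longrightarrow> left_angle_sum G (deform \<alpha> F) g - right_angle_sum G (deform \<alpha> F) g
      = - 2 * (\<Sum>y | y \<in> ladder x \<and> right_of_pole y. F (pole y))"
proof -
  let ?n = "length xs"
  have n: "0 < ?n" using xs(3) by simp
  have len: "length g = ?n" by (simp add: g_def ladder_path_def)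
  have mem: "xs ! i \<in> ladder x" "xs ! i \<in> pi_flags" "xs ! i \<in> flags" "tri (xs ! i) \<in> K" if "i < ?n" for i
  proof -
    show m: "xs ! i \<in> ladder x" using xs(2) nth_mem[OF that] by simp
    show p: "xs ! i \<in> pi_flags" using ladder_pi[OF x(1) m] .
    show "xs ! i \<in> flags" using p by (rule pi_flagD)
    show "tri (xs ! i) \<in> K" using ladder_in_cusp[OF K x m] .
  qed
  have ent: "entry_side g i = in_rung (xs ! i)" if "i < ?n" for i
    using that by (simp add: entry_side_def g_def ladder_path_def)
  have ext: "exit_side G g i = out_rung (xs ! i)" if "i < ?n" for i
    using xs(4)[rule_format, OF that] n by (simp add: exit_side_def next_entry_def g_def ladder_path_def)
  have cc: "ccw (ccw s) \<noteq> ccw s" if "s \<in> flags" for s :: "'t flag" using ccw_neq(1)[OF ccw_flag[OF that]] .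
  have "i \<in> right_arcs G g \<longleftrightarrow> i < ?n \<and> right_of_pole (xs ! i)"
    "i \<in> left_arcs G g \<longleftrightarrow> i < ?n \<and> \<not> right_of_pole (xs ! i)" for i
  proof -
    show "i \<in> right_arcs G g \<longleftrightarrow> i < ?n \<and> right_of_pole (xs ! i)"
      "i \<in> left_arcs G g \<longleftrightarrow> i < ?n \<and> \<not> right_of_pole (xs ! i)"
    proof (atomize (full), cases "i < ?n")
      case True
      note el = rung_arcs[OF mem(2)[OF True]]
      show "(i \<in> right_arcs G g \<longleftrightarrow> i < ?n \<and> right_of_pole (xs ! i)) \<and>
          (i \<in> left_arcs G g \<longleftrightarrow> i < ?n \<and> \<not> right_of_pole (xs ! i))"
        using True ent[OF True] ext[OF True] el(4,6) cc[OF el(1)] unfolding right_arcs_def left_arcs_def len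
        by (cases "right_of_pole (xs ! i)") auto
    qed (simp add: right_arcs_def left_arcs_def len)
  qed
  then have ra: "right_arcs G g = {i. i < ?n \<and> right_of_pole (xs ! i)}"
    and la: "left_arcs G g = {i. i < ?n \<and> \<not> right_of_pole (xs ! i)}" by blast+
  show "normal_curve G K g"
    unfolding normal_curve_def
  proof (intro conjI allI impI)
    show "g \<noteq> []" using n len by auto
    show "\<forall>(s, u)\<in>set g. s \<in> sides_of K \<and> 0 < u \<and> u < 1"
    proof
      fix p assume "p \<in> set g"
      then obtain y where y: "y \<in> ladder x" "p = (in_rung y, 1 / 2)" using xs(2) by (auto simp: g_def ladder_path_def)
      have "y \<in> pi_flags" "tri y \<in> K" using ladder_pi[OF x(1) y(1)] ladder_in_cusp[OF K x y(1)] by simp_all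
      then show "case p of (s, u) \<Rightarrow> s \<in> sides_of K \<and> 0 < u \<and> u < 1"
        using y(2) rung_arcs(1,2)[of y] by (simp add: sides_of_def)
    qed
    show "{..<length g} = left_arcs G g \<union> right_arcs G g" unfolding la ra len by auto
    fix i j assume ij: "i < length g" "j < length g" "i \<noteq> j \<and> tri (entry_side g i) = tri (entry_side g j)"
    then have l: "i < ?n" "j < ?n" using len by simp_all
    then have "tri (xs ! i) = tri (xs ! j)"
      using ij(3) ent rung_arcs(2)[OF mem(2)[OF l(1)]] rung_arcs(2)[OF mem(2)[OF l(2)]] by simp
    then have "xs ! i = xs ! j" using pi_flag_unique mem(2) l by blast
    then show "curve_arc G g i \<inter> curve_arc G g j = {}" using xs(1) l ij(3) nth_eq_iff_index_eq by blast
  qed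
  define ds where "ds = map (\<lambda>i. flip G (ccw (ccw (entry_side g i)))) (sorted_list_of_set (right_arcs G g))"
  have fin: "finite (right_arcs G g)" unfolding ra by simp
  have de: "flip G (ccw (ccw (entry_side g i))) = flip G (pole (xs ! i))" if "i \<in> right_arcs G g" for i
    using that ent[of i] rung_arcs(5)[OF mem(2)[of i]] unfolding ra by simp
  have "inj_on (\<lambda>i. flip G (pole (xs ! i))) (right_arcs G g)"
  proof (rule inj_onI)
    fix i j assume ij: "i \<in> right_arcs G g" "j \<in> right_arcs G g" "flip G (pole (xs ! i)) = flip G (pole (xs ! j))"
    then have l: "i < ?n" "j < ?n" unfolding ra by simp_all
    have "pole (xs ! i) = pole (xs ! j)" using ij(3) mem(3) l by (metis flip_flip pole_flag)
    then have "xs ! i = xs ! j" using pole_inj mem(2) l by blast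
    then show "i = j" using xs(1) l nth_eq_iff_index_eq by blast
  qed
  moreover have "inj_on (\<lambda>i. flip G (ccw (ccw (entry_side g i)))) (right_arcs G g)
      = inj_on (\<lambda>i. flip G (pole (xs ! i))) (right_arcs G g)"
    by (rule inj_on_cong) (rule de)
  ultimately have "inj_on (\<lambda>i. flip G (ccw (ccw (entry_side g i)))) (right_arcs G g)" by (rule iffD2[rotated])
  then have dds: "distinct ds" using fin by (simp add: ds_def distinct_map)
  have sds: "set ds = left_pole x"
  proof -
    have "set ds = (\<lambda>i. flip G (pole (xs ! i))) ` right_arcs G g"
      unfolding ds_def using fin de by simp
    also have "\<dots> = (\<lambda>y. flip G (pole y)) ` ((!) xs ` right_arcs G g)" by (simp add: image_image)
    also have "(!) xs ` right_arcs G g = {y \<in> ladder x. right_of_pole y}"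
    proof
      show "(!) xs ` right_arcs G g \<subseteq> {y \<in> ladder x. right_of_pole y}" unfolding ra using mem(1) by blast
      show "{y \<in> ladder x. right_of_pole y} \<subseteq> (!) xs ` right_arcs G g"
      proof
        fix y assume y: "y \<in> {y \<in> ladder x. right_of_pole y}"
        then have "y \<in> set xs" using xs(2) by simp
        then obtain i where "i < ?n" "xs ! i = y" by (meson in_set_conv_nth)
        then show "y \<in> (!) xs ` right_arcs G g" unfolding ra using y by (intro image_eqI[of _ _ i]) simp_all
      qed
    qed
    finally show ?thesis unfolding left_pole_def .
  qed
  have "normal_curve_chain G g = path_chain G ds" unfolding normal_curve_chain_def ds_def ..
  then show "normal_curve_chain G g s = of_bool (s \<in> left_pole x) - of_bool (flip G s \<in> left_pole x)"
    using count_list_distinct[OF dds] sds by (simp add: path_chain_def)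
  assume F: "flux F"
  let ?\<theta> = "deform \<alpha> F"
  have ca: "corner_angle ?\<theta> (pole (xs ! i)) = pair_flux F (pole (xs ! i))" if "i < ?n" for i
    using corner_angle_deform[OF pole_flag[OF mem(3)[OF that]]] angle_pole[OF mem(2)[OF that]] by simp
  have L: "left_angle_sum G ?\<theta> g = (\<Sum>i\<in>left_arcs G g. pair_flux F (pole (xs ! i)))"
    unfolding left_angle_sum_def
  proof (rule sum.cong[OF refl])
    fix i assume "i \<in> left_arcs G g"
    then have i: "i < ?n" "\<not> right_of_pole (xs ! i)" unfolding la by simp_all
    show "corner_angle ?\<theta> (ccw (entry_side g i)) = pair_flux F (pole (xs ! i))"
      using ca[OF i(1)] ent[OF i(1)] rung_arcs(7)[OF mem(2)[OF i(1)] i(2)] by simp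
  qed
  have R: "right_angle_sum G ?\<theta> g = (\<Sum>i\<in>right_arcs G g. pair_flux F (pole (xs ! i)))"
    unfolding right_angle_sum_def
  proof (rule sum.cong[OF refl])
    fix i assume "i \<in> right_arcs G g"
    then have i: "i < ?n" "right_of_pole (xs ! i)" unfolding ra by simp_all
    show "corner_angle ?\<theta> (ccw (ccw (entry_side g i))) = pair_flux F (pole (xs ! i))"
      using ca[OF i(1)] ent[OF i(1)] rung_arcs(5)[OF mem(2)[OF i(1)] i(2)] by simp
  qed
  let ?c = "\<lambda>i. cross_flux F (in_rung (xs ! i))"
  have pf: "(if right_of_pole (xs ! i) then - pair_flux F (pole (xs ! i)) else pair_flux F (pole (xs ! i)))
      = (if right_of_pole (xs ! i) then - F (pole (xs ! i)) else F (pole (xs ! i))) + (?c i - ?c (Suc i mod ?n))"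
    if i: "i < ?n" for i
  proof -
    have s: "Suc i mod ?n < ?n" using n by simp
    note el = rung_arcs[OF mem(2)[OF i]]
    have "cross_flux F (out_rung (xs ! i)) = ?c (Suc i mod ?n)"
      using cross_flux_flip[OF F rung_arcs(1)[OF mem(2)[OF s]]] xs(4)[rule_format, OF i] by simp
    then show ?thesis
      using pair_flux_left_arc[OF F el(1)] pair_flux_right_arc[OF F el(1)] el(4-7) by (cases "right_of_pole (xs ! i)") simp_all
  qed
  have "left_angle_sum G ?\<theta> g - right_angle_sum G ?\<theta> g
    = (\<Sum>i<?n. if right_of_pole (xs ! i) then - pair_flux F (pole (xs ! i)) else pair_flux F (pole (xs ! i)))"
    unfolding L R la ra by (simp add: sum.If_cases sum_negf Collect_conj_eq lessThan_def Collect_neg_eq)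
  also have "\<dots> = (\<Sum>i<?n. (if right_of_pole (xs ! i) then - F (pole (xs ! i)) else F (pole (xs ! i)))
      + (?c i - ?c (Suc i mod ?n)))"
    using pf by (intro sum.cong) auto
  also have "\<dots> = (\<Sum>i<?n. if right_of_pole (xs ! i) then - F (pole (xs ! i)) else F (pole (xs ! i)))"
    unfolding sum.distrib sum_subtractf sum_cyclic_shift[of ?c] by simp
  also have "\<dots> = (\<Sum>y\<in>ladder x. if right_of_pole y then - F (pole y) else F (pole y))"
    unfolding xs(2)[symmetric] using sum.reindex_bij_betw[OF bij_betw_nth[OF xs(1) refl refl], of "\<lambda>y. if right_of_pole y then - F (pole y) else F (pole y)"]
    by simp
  also have "\<dots> = (\<Sum>y\<in>ladder x. F (pole y) - 2 * (if right_of_pole y then F (pole y) else 0))"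
    by (intro sum.cong) auto
  also have "\<dots> = (\<Sum>y\<in>ladder x. F (pole y)) - 2 * (\<Sum>y\<in>ladder x. if right_of_pole y then F (pole y) else 0)"
    by (simp add: sum_subtractf sum_distrib_left)
  also have "(\<Sum>y\<in>ladder x. if right_of_pole y then F (pole y) else 0) = (\<Sum>y | y \<in> ladder x \<and> right_of_pole y. F (pole y))"
    by (rule sum.mono_neutral_cong_right) auto
  finally show "left_angle_sum G ?\<theta> g - right_angle_sum G ?\<theta> g = - 2 * (\<Sum>y | y \<in> ladder x \<and> right_of_pole y. F (pole y))"
    using ladder_pole_flux[OF F x(1)] by simp
qed

text \<open>
  If the class is 0 or a multiple of a class, then a 2-chain as in
  \<open>pole_nonseparating\<close> exists.
\<close>

lemma left_pole_primitive:
  assumes K: "K \<in> cusps G" and x: "x \<in> pi_flags" and rp: "right_of_pole x" and xK: "tri (cross x) \<in> K"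
    and z: "\<And>s. z s = of_bool (s \<in> left_pole x) - of_bool (flip G s \<in> left_pole x)"
    and cyc: "z \<in> cycles G K"
  shows "primitive_class G K z"
proof -
  have ladder_flags: "y \<in> pi_flags" "y \<in> flags" if "y \<in> ladder x" for y
    using ladder_pi[OF x that] pi_flagD by blast+
  have flip_pole_mem: "flip G (pole y) \<in> left_pole x \<longleftrightarrow> y \<in> ladder x \<and> right_of_pole y" if y: "y \<in> pi_flags" for y
  proof
    assume "flip G (pole y) \<in> left_pole x"
    then obtain w where w: "w \<in> ladder x" "right_of_pole w" "flip G (pole y) = flip G (pole w)"
      unfolding left_pole_def by blast
    have "pole y = pole w" using w(3) pi_flagD[OF y] ladder_flags[OF w(1)] by (metis flip_flip pole_flag)
    then have "y = w" using pole_inj[OF y] ladder_flags[OF w(1)] by blast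
    then show "y \<in> ladder x \<and> right_of_pole y" using w by simp
  qed (auto simp: left_pole_def)
  have pole_mem: "pole y \<in> left_pole x \<longleftrightarrow> cross y \<in> ladder x \<and> right_of_pole (cross y)" if y: "y \<in> pi_flags" for y
    using flip_pole_mem[OF cross_props(1)[OF y]] cross_props(2)[OF y] pi_flagD[OF y] by simp
  have z1: "z (pole y) = - 1" if y: "y \<in> ladder x" "right_of_pole y" for y
    using z[of "pole y"] flip_pole_mem[of y] pole_mem[of y] right_of_pole_cross[of y] ladder_flags[OF y(1)] y by simp
  have z0: "z (rung y) = 0" if y: "y \<in> pi_flags" for y
  proof -
    have "s \<notin> left_pole x" if s: "s = rung y \<or> s = flip G (rung y)" for s
    proof
      assume "s \<in> left_pole x"
      then obtain w where w: "w \<in> pi_flags" "s = flip G (pole w)"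
        using ladder_flags unfolding left_pole_def by blast
      then have s': "s = pole (cross w)" using cross_props(2) by simp
      note sd = side_distinct[OF cross_props(1)[OF w(1)]]
      from s show False
      proof
        assume "s = rung y"
        then have "pole (cross w) \<in> rung ` pi_flags" using s' y by simp
        then show False using sd(6) by blast
      next
        assume "s = flip G (rung y)"
        then have "s \<in> pi_flags" using advance_pi[OF y] by (simp add: advance_def)
        then show False using sd(5) s' by simp
      qed
    qed
    then show ?thesis using z[of "rung y"] by simp
  qed
  have z2: "z (pole y) = 0" if y: "y \<in> pi_flags" "right_of_pole y" "y \<notin> ladder x" for y
    using z[of "pole y"] flip_pole_mem[OF y(1)] pole_mem[OF y(1)] right_of_pole_cross[OF y(1)] y by simp
  have unit: "m dvd 1" if hom: "\<And>s. s \<in> flags \<Longrightarrow> m dvd z s - (k (tri s) - k (tri (flip G s)))" for m k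
    using pole_nonseparating[OF K x rp xK, where z = z] z1 z0 z2 hom by blast
  show ?thesis
    unfolding primitive_class_def
  proof (intro conjI ballI allI impI notI)
    show "z \<in> cycles G K" by (rule cyc)
  next
    assume "homologous G K z (\<lambda>_. 0)"
    then obtain k :: "'t \<times> 4 \<Rightarrow> int" where k: "\<forall>s\<in>flags. z s - 0 = k (tri s) - k (tri (flip G s))"
      unfolding homologous_def by blast
    have "(0::int) dvd z s - (k (tri s) - k (tri (flip G s)))" if "s \<in> flags" for s
      using bspec[OF k that] by simp
    from unit[OF this] show False by simp
  next
    fix y m assume "homologous G K z (\<lambda>s. m * y s)"
    then obtain k :: "'t \<times> 4 \<Rightarrow> int" where k: "\<forall>s\<in>flags. z s - m * y s = k (tri s) - k (tri (flip G s))"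
      unfolding homologous_def by blast
    have "m dvd z s - (k (tri s) - k (tri (flip G s)))" if "s \<in> flags" for s
    proof -
      have "z s - (k (tri s) - k (tri (flip G s))) = m * y s" using bspec[OF k that] by linarith
      then show ?thesis by simp
    qed
    from unit[OF this] show "\<bar>m\<bar> = 1" by simp
  qed
qed

section \<open>Realizing the holonomies\<close>

lemma upward_holonomy:
  assumes V: "bij_betw V {1..c} (cusps G)"
    and l: "\<And>i. i \<in> {1..c::nat} \<Longrightarrow> set (l i) \<subseteq> sides_of (V i)"
    and P: "\<And>i. i \<in> {1..c} \<Longrightarrow>
      \<exists>P. ladderpole G \<alpha> (V i) P \<and> (\<forall>s\<in>set P. upward_edge out s) \<and> freely_homotopic G (l i) P"
    and J: "J \<subseteq> {1..c}"
  shows "\<exists>\<theta>. nonneg_angle_structure G \<theta> \<and>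
    (\<forall>i\<in>{1..c}. has_angular_holonomy G \<theta> (V i) (path_chain G (l i)) (if i \<in> J then pi / 2 else 0))"
proof -
  obtain P where P: "\<And>i. i \<in> {1..c} \<Longrightarrow> ladderpole G \<alpha> (V i) (P i)"
    "\<And>i. i \<in> {1..c} \<Longrightarrow> \<forall>s\<in>set (P i). upward_edge out s"
    "\<And>i. i \<in> {1..c} \<Longrightarrow> freely_homotopic G (l i) (P i)" using P by metis
  have K: "V i \<in> cusps G" if "i \<in> {1..c}" for i using V that by (auto simp: bij_betw_def)
  let ?ok = "\<lambda>i x. x \<in> pi_flags \<and> right_of_pole x \<and> tri (cross x) \<in> V i \<and>
    set (P i) = left_pole x"
  have ex: "\<exists>x. ?ok i x" if i: "i \<in> {1..c}" for i
    by (rule upward_ladderpole[OF P(1,2)[OF i]]) blast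
  define x where "x i = (SOME x. ?ok i x)" for i
  have ok: "?ok i (x i)" if i: "i \<in> {1..c}" for i
    unfolding x_def by (rule someI_ex[OF ex[OF i]])
  have x: "x i \<in> pi_flags" "right_of_pole (x i)" "tri (cross (x i)) \<in> V i"
    "set (P i) = left_pole (x i)" if i: "i \<in> {1..c}" for i
    using ok[OF i] by simp_all
  have xV: "tri (x i) \<in> V i" if i: "i \<in> {1..c}" for i
    using cusp_closed[OF K[OF i], of "pole (cross (x i))"] cross_props(1,2)[OF x(1)[OF i]] x(3)[OF i]
      pi_flagD[OF x(1)[OF i]] pi_flagD[OF cross_props(1)[OF x(1)[OF i]]]
    by (metis flip_flip pole_flag tri_pole)
  obtain \<mu> where \<mu>: "stationary \<mu>"
    "\<forall>i\<in>{1..c}. (\<Sum>y | y \<in> ladder (x i) \<and> turns y. \<mu> y) = of_bool (i \<in> J)"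
    using ex_stationary[of "{1..c}" V x J] V x(1) xV J by (auto simp: bij_betw_def)
  let ?F = "ladder_flow \<mu>" and ?\<theta> = "deform \<alpha> (ladder_flow \<mu>)"
  note F = flux_ladder_flow[OF \<mu>(1)]
  have "has_angular_holonomy G ?\<theta> (V i) (path_chain G (l i)) (if i \<in> J then pi / 2 else 0)" if i: "i \<in> {1..c}" for i
  proof -
    note xi = x(1)[OF i]
    obtain xs where xs: "distinct xs" "set xs = ladder (x i)" "xs \<noteq> []"
      "\<forall>i<length xs. flip G (in_rung (xs ! (Suc i mod length xs))) = out_rung (xs ! i)"
      using ladder_list[OF xi] by blast
    note lc = ladder_curve[OF K[OF i] xi xV[OF i] xs]
    let ?g = "ladder_path xs" and ?z = "normal_curve_chain G (ladder_path xs)"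
    have scc: "simple_closed_curve G (V i) (P i)" using P(1)[OF i] by (simp add: ladderpole_def)
    then have cp: "closed_path G (P i)" and PV: "set (P i) \<subseteq> sides_of (V i)"
      and dist: "distinct (P i)" by (auto simp: simple_closed_curve_def distinct_map)
    have z: "?z = path_chain G (P i)"
      using lc(2) count_list_distinct[OF dist] x(4)[OF i] by (intro ext) (simp add: path_chain_def)
    have ladder_flags: "y \<in> pi_flags" if "y \<in> ladder (x i)" for y
      using ladder_pi[OF xi that] .
    have "primitive_class G (V i) ?z"
    proof (rule left_pole_primitive[OF K[OF i] xi x(2,3)[OF i] lc(2)])
      show "?z \<in> cycles G (V i)" unfolding z by (rule path_chain_cycle[OF K[OF i] cp PV])
    qed
    moreover have "homologous G (V i) (path_chain G (l i)) (\<lambda>s. 1 * ?z s)"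
      using freely_homotopic_homologous[OF K[OF i] P(3)[OF i] l[OF i]] unfolding z by simp
    moreover have "(if i \<in> J then pi / 2 else 0) = of_int 1 * (left_angle_sum G ?\<theta> ?g - right_angle_sum G ?\<theta> ?g)"
    proof -
      have "?F (pole y) = - (pi / 4) * (if turns y then \<mu> y else 0)" if y: "y \<in> ladder (x i)" "right_of_pole y" for y
      proof -
        have "\<not> turns (cross y)"
          using right_of_pole_cross[of y] ladder_flags[OF y(1)] y(2) by (simp add: turns_def)
        then show ?thesis using ladder_flow_values(3)[of y \<mu>] ladder_flags[OF y(1)] by simp
      qed
      then have "(\<Sum>y | y \<in> ladder (x i) \<and> right_of_pole y. ?F (pole y))
        = (\<Sum>y | y \<in> ladder (x i) \<and> right_of_pole y. - (pi / 4) * (if turns y then \<mu> y else 0))"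
        by (intro sum.cong) auto
      also have "\<dots> = - (pi / 4) * (\<Sum>y | y \<in> ladder (x i) \<and> right_of_pole y. if turns y then \<mu> y else 0)"
        by (simp only: sum_distrib_left)
      also have "(\<Sum>y | y \<in> ladder (x i) \<and> right_of_pole y. if turns y then \<mu> y else 0)
        = (\<Sum>y | y \<in> ladder (x i) \<and> turns y. \<mu> y)"
        by (rule sum.mono_neutral_cong_right) (auto simp: turns_def)
      also have "\<dots> = of_bool (i \<in> J)" using \<mu>(2) i by blast
      finally show ?thesis unfolding lc(3)[OF F] by simp
    qed
    ultimately show ?thesis unfolding has_angular_holonomy_def using lc(1) by blast
  qed
  then show ?thesis using nonneg_deform[OF \<mu>(1)] by blast
qed

end

lemma transverse_taut_reverse:
  assumes "transverse_taut G \<alpha> out"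
  shows "transverse_taut G \<alpha> (\<lambda>t a. \<not> out t a)"
  unfolding transverse_taut_def
proof (intro conjI allI impI)
  show "taut_angle_structure G \<alpha>" using assms by (simp add: transverse_taut_def)
next
  fix t a t' \<sigma> assume "G t a = (t', \<sigma>)"
  then have "out t' (\<sigma> a) \<longleftrightarrow> \<not> out t a" using assms unfolding transverse_taut_def by blast
  then show "(\<not> out t' (\<sigma> a)) = (\<not> \<not> out t a)" by simp
next
  fix t
  obtain e where e: "card e = 2" "edge_angle \<alpha> t e = pi" "\<forall>a\<in>-e. \<not> out t a" "\<forall>a\<in>e. out t a"
    using assms unfolding transverse_taut_def by blast
  have "card (- e) = 2" using e(1) by (simp add: Compl_eq_Diff_UNIV card_Diff_subset)
  moreover have "edge_angle \<alpha> t (- e) = pi" using e(2) by (simp add: edge_angle_def insert_commute)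
  ultimately show "\<exists>e. card e = 2 \<and> edge_angle \<alpha> t e = pi \<and> (\<forall>a\<in>-e. \<not> \<not> out t a) \<and> (\<forall>a\<in>e. \<not> out t a)"
    using e(3,4) by (intro exI[of _ "- e"]) simp
qed

theorem proposition6p12:
  fixes G :: "'t::finite gluing" and \<alpha> :: "'t angles" and out :: "'t \<Rightarrow> 4 \<Rightarrow> bool"
    and c :: nat and V :: "nat \<Rightarrow> ('t \<times> 4) set" and l :: "nat \<Rightarrow> 't flag list" and J :: "nat set"
  assumes "ideal_triangulation G"
    and "veering G \<alpha>"
    and "transverse_taut G \<alpha> out"
    and "bij_betw V {1..c} (cusps G)"
    and "\<And>i. i \<in> {1..c} \<Longrightarrow> along_ladderpoles G \<alpha> (V i) (l i)"
    and "(\<forall>i\<in>{1..c}. agrees G \<alpha> out (V i) (l i)) \<or> (\<forall>i\<in>{1..c}. \<not> agrees G \<alpha> out (V i) (l i))"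
    and "J \<subseteq> {1..c}"
  shows "\<exists>\<theta>. nonneg_angle_structure G \<theta> \<and>
    (\<forall>i\<in>{1..c}. has_angular_holonomy G \<theta> (V i) (path_chain G (l i)) (if i \<in> J then pi / 2 else 0))"
proof -
  interpret up: veering_triangulation G \<alpha> out
    using assms(1-3) by unfold_locales
  interpret down: veering_triangulation G \<alpha> "\<lambda>t a. \<not> out t a"
    using assms(1,2) transverse_taut_reverse[OF assms(3)] by unfold_locales
  have l: "set (l i) \<subseteq> sides_of (V i)" if "i \<in> {1..c}" for i
    using assms(5)[OF that] by (simp add: along_ladderpoles_def simple_closed_curve_def)
  from assms(6) show ?thesis
  proof
    assume "\<forall>i\<in>{1..c}. agrees G \<alpha> out (V i) (l i)"
    then show ?thesis
      using up.upward_holonomy[OF assms(4) l _ assms(7)] unfolding agrees_def by blast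
  next
    assume dis: "\<forall>i\<in>{1..c}. \<not> agrees G \<alpha> out (V i) (l i)"
    have "\<exists>P. ladderpole G \<alpha> (V i) P \<and> (\<forall>s\<in>set P. upward_edge (\<lambda>t a. \<not> out t a) s) \<and> freely_homotopic G (l i) P"
      if i: "i \<in> {1..c}" for i
    proof -
      obtain P where P: "ladderpole G \<alpha> (V i) P" "freely_homotopic G (l i) P"
        using assms(5)[OF i] unfolding along_ladderpoles_def by blast
      moreover have "\<not> (\<forall>s\<in>set P. upward_edge out s)" using dis i P unfolding agrees_def by blast
      ultimately show ?thesis using up.ladderpole_one_direction[OF P(1)] by blast
    qed
    then show ?thesis using down.upward_holonomy[OF assms(4) l _ assms(7)] by blast
  qed
qed

end
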